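(* Consider an $n$-symmetric oval $\Gamma\in\mathcal{N}$, let $(\phi_0,\alpha_0)$ and $(\phi_1,\alpha_1)$ be two hyperbolic periodic points of its billiard map (the same or distinct), and assume that there is a tangent heteroclinic (respectively homoclinic) point $(\phi_*,\alpha_* )\in W^s(\phi_0,\alpha_0)\cap W^u(\phi_1,\alpha_1)$. Then there is an $n$-symmetric oval $\Gamma_\epsilon\in\mathcal{N}$ arbitrarily close to $\Gamma$ such that, for the billiard map of $\Gamma_\epsilon$, $(\phi_*,\alpha_* )$ is a transversal heteroclinic (respectively homoclinic) intersection of $W^s(\phi_0,\alpha_0)$ and $W^u(\phi_1,\alpha_1)$.
   Context: Fix an integer $n\ge 2$. An oval is a regular, closed, $C^\infty$ plane curve with strictly positive curvature, parametrized by the angle $\phi\in\mathbb{R}/2\pi\mathbb{Z}$ between its tangent vector $\sigma(\phi)=(\cos\phi,\sin\phi)$ and the positive horizontal axis. It is $n$-symmetric if it is invariant under the rotation by $\frac{2\pi}{n}$ around a point (the symmetry center), taken to be the origin. $\mathcal{N}$ denotes the set of $C^\infty$ $n$-symmetric ovals with symmetry center at the origin. With $\eta(\phi)=(-\sin\phi,\cos\phi)$ the inward normal, the support function of $\Gamma$ is $g(\phi)=-\langle\Gamma(\phi),\eta(\phi)\rangle$. With $S_n=\mathbb{R}/\frac{2\pi}{n}\mathbb{Z}$, the map $\Gamma\mapsto g$ is a bijection from $\mathcal{N}$ onto $\mathcal{G}=\{g\in C^\infty(S_n,\mathbb{R}): g>0,\ g+g''>0\}$. $\mathcal{G}$ carries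 the topology of the $C^2$ norm $\|\cdot\|_2$, and $\mathcal{N}$ the topology making this bijection a homeomorphism; closeness in $\mathcal{N}$ refers to this topology. Billiard map: a particle moves at constant speed along straight segments inside the region bounded by $\Gamma$ and reflects elastically at $\Gamma$. A collision is described by $(\phi,\alpha)$ (equivalently by $(\phi,p)$ with $p=\cos\alpha$), where $\Gamma(\phi)$ is the impact point and $\alpha\in(0,\pi)$ is the outgoing angle measured from $\sigma(\phi)$. The billiard map sends each collision to the next. $W^s$ and $W^u$ denote the stable and unstable manifolds of a hyperbolic periodic point. A tangent (transversal) homo/heteroclinic point is a point of $W^s\cap W^u$, other than the periodic points, at which the two curves have the same (different) tangent lines. *)

theory Defs
  imports "HOL-Analysis.Analysis"
begin

section \<open>Symmetric ovals\<close>

text \<open>The Euclidean plane is \<^typ>\<open>complex\<close>, with its real inner product. Functions on the circle are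
  \<open>2 * pi\<close>-periodic functions on the reals. The tangent vector \<open>\<sigma>(\<phi>)\<close> is \<open>cis \<phi>\<close>.\<close>

definition \<eta> :: "real \<Rightarrow> complex" where
  "\<eta> \<phi> = Complex (- sin \<phi>) (cos \<phi>)"

definition smooth :: "(real \<Rightarrow> 'a::real_normed_vector) \<Rightarrow> bool" where
  "smooth f \<longleftrightarrow> (\<forall>k x. ((\<lambda>h y. vector_derivative h (at y)) ^^ k) f differentiable (at x))"

definition velocity :: "(real \<Rightarrow> complex) \<Rightarrow> real \<Rightarrow> complex" where
  "velocity \<Gamma> \<phi> = vector_derivative \<Gamma> (at \<phi>)"

text \<open>Signed curvature \<open>(x' y'' - y' x'') / (x'^2 + y'^2) powr (3/2)\<close>.\<close>

definition curvature :: "(real \<Rightarrow> complex) \<Rightarrow> real \<Rightarrow> real" where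
  "curvature \<Gamma> \<phi> = Im (cnj (velocity \<Gamma> \<phi>) * velocity (velocity \<Gamma>) \<phi>) / norm (velocity \<Gamma> \<phi>) ^ 3"

text \<open>The fourth condition says that the parameter is the angle of the tangent vector.\<close>

definition oval :: "(real \<Rightarrow> complex) \<Rightarrow> bool" where
  "oval \<Gamma> \<longleftrightarrow>
     smooth \<Gamma> \<and> (\<forall>\<phi>. \<Gamma> (\<phi> + 2 * pi) = \<Gamma> \<phi>) \<and>
     (\<forall>\<phi>. velocity \<Gamma> \<phi> \<noteq> 0) \<and>
     (\<forall>\<phi>. sgn (velocity \<Gamma> \<phi>) = cis \<phi>) \<and>
     (\<forall>\<phi>. curvature \<Gamma> \<phi> > 0)"

definition symmetric_ovals :: "nat \<Rightarrow> (real \<Rightarrow> complex) set" where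
  "symmetric_ovals n = {\<Gamma>. oval \<Gamma> \<and> (\<lambda>z. cis (2 * pi / real n) * z) ` range \<Gamma> = range \<Gamma>}"

definition support_fun :: "(real \<Rightarrow> complex) \<Rightarrow> real \<Rightarrow> real" where
  "support_fun \<Gamma> \<phi> = - (\<Gamma> \<phi> \<bullet> \<eta> \<phi>)"

text \<open>Only meant for periodic \<open>C^2\<close> functions, for which the suprema are finite.\<close>

definition C2_norm :: "(real \<Rightarrow> real) \<Rightarrow> real" where
  "C2_norm g = (SUP x. \<bar>g x\<bar>) + (SUP x. \<bar>deriv g x\<bar>) + (SUP x. \<bar>deriv (deriv g) x\<bar>)"

definition oval_dist :: "(real \<Rightarrow> complex) \<Rightarrow> (real \<Rightarrow> complex) \<Rightarrow> real" where
  "oval_dist \<Gamma> \<Delta> = C2_norm (\<lambda>\<phi>. support_fun \<Gamma> \<phi> - support_fun \<Delta> \<phi>)"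


section \<open>The billiard map\<close>

text \<open>The phase space is the open cylinder of all \<open>(\<phi>, \<alpha>)\<close> with \<open>\<phi>\<close> taken modulo \<open>2 * pi\<close>. We work on
  its universal cover \<open>phase\<close>; \<open>cyl\<close> is the covering projection onto the cylinder, realized in
  \<^typ>\<open>complex \<times> real\<close>. All notions below that compare points of the phase space do so through
  \<open>cyl\<close>.\<close>

definition phase :: "(real \<times> real) set" where
  "phase = UNIV \<times> {0<..<pi}"

definition cyl :: "real \<times> real \<Rightarrow> complex \<times> real" where
  "cyl x = (cis (fst x), snd x)"

definition outgoing :: "real \<times> real \<Rightarrow> complex" where
  "outgoing x = cis (fst x + snd x)"

text \<open>Elastic reflection at the point with parameter \<open>\<phi>\<close>: the tangential component of the velocity
  is kept, the normal component is reversed.\<close>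

definition reflect :: "real \<Rightarrow> complex \<Rightarrow> complex" where
  "reflect \<phi> v = (v \<bullet> cis \<phi>) *\<^sub>R cis \<phi> - (v \<bullet> \<eta> \<phi>) *\<^sub>R \<eta> \<phi>"

definition next_collision :: "(real \<Rightarrow> complex) \<Rightarrow> real \<times> real \<Rightarrow> real \<times> real \<Rightarrow> bool" where
  "next_collision \<Gamma> x y \<longleftrightarrow> y \<in> phase \<and>
     (\<exists>t>0. \<Gamma> (fst y) = \<Gamma> (fst x) + t *\<^sub>R outgoing x \<and>
        (\<forall>s. 0 < s \<and> s < t \<longrightarrow> \<Gamma> (fst x) + s *\<^sub>R outgoing x \<notin> range \<Gamma>)) \<and>
     outgoing y = reflect (fst y) (outgoing x)"

text \<open>\<open>next_collision\<close> determines \<open>y\<close> up to a multiple of \<open>2 * pi\<close> in its angle. Choosing the angle in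
  the interval between \<open>\<phi>\<close> and \<open>\<phi> + 2 * pi\<close> gives a lift of the billiard map to \<open>phase\<close>, which is
  again a diffeomorphism.\<close>

definition billiard_map :: "(real \<Rightarrow> complex) \<Rightarrow> real \<times> real \<Rightarrow> real \<times> real" where
  "billiard_map \<Gamma> x = (THE y. next_collision \<Gamma> x y \<and> fst x < fst y \<and> fst y < fst x + 2 * pi)"

definition billiard_inv :: "(real \<Rightarrow> complex) \<Rightarrow> real \<times> real \<Rightarrow> real \<times> real" where
  "billiard_inv \<Gamma> = inv_into phase (billiard_map \<Gamma>)"


section \<open>Hyperbolic periodic points and their invariant manifolds\<close>

text \<open>\<open>v + \<i> w\<close> is an eigenvector of the complexification of \<open>D\<close>, written out in real and imaginary
  parts.\<close>

definition complex_eigenvalue :: "(real \<times> real \<Rightarrow> real \<times> real) \<Rightarrow> complex \<Rightarrow> bool" where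
  "complex_eigenvalue D \<mu> \<longleftrightarrow>
     (\<exists>v w. (v \<noteq> 0 \<or> w \<noteq> 0) \<and>
        D v = Re \<mu> *\<^sub>R v - Im \<mu> *\<^sub>R w \<and> D w = Im \<mu> *\<^sub>R v + Re \<mu> *\<^sub>R w)"

definition hyperbolic_periodic :: "(real \<Rightarrow> complex) \<Rightarrow> real \<times> real \<Rightarrow> bool" where
  "hyperbolic_periodic \<Gamma> z \<longleftrightarrow> z \<in> phase \<and>
     (\<exists>q>0. cyl ((billiard_map \<Gamma> ^^ q) z) = cyl z \<and>
        (\<exists>D. ((billiard_map \<Gamma> ^^ q) has_derivative D) (at z) \<and>
             (\<forall>\<mu>. complex_eigenvalue D \<mu> \<longrightarrow> cmod \<mu> \<noteq> 1)))"

definition asymptotic_set :: "(real \<times> real \<Rightarrow> real \<times> real) \<Rightarrow> real \<times> real \<Rightarrow> (real \<times> real) set" where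
  "asymptotic_set f z =
     {x \<in> phase. (\<lambda>k. dist (cyl ((f ^^ k) x)) (cyl ((f ^^ k) z))) \<longlonglongrightarrow> 0}"

text \<open>The invariant manifolds are injectively immersed curves that may accumulate on themselves, so
  their tangent lines depend on the immersed structure and not on the topology of the set. The curves
  lying in the immersed manifold, continuous for its own topology, are locally those along which the
  convergence of the orbits is uniform: such a curve is mapped into the local invariant manifold by
  one single iterate. Accordingly the tangent space consists of the velocities of these curves.\<close>

definition asymptotic_arc ::
  "(real \<times> real \<Rightarrow> real \<times> real) \<Rightarrow> real \<times> real \<Rightarrow> (real \<Rightarrow> real \<times> real) \<Rightarrow> bool" where
  "asymptotic_arc f z c \<longleftrightarrow>
     c C1_differentiable_on {-1<..<1} \<and> c ` {-1<..<1} \<subseteq> asymptotic_set f z \<and>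
     uniform_limit {-1<..<1} (\<lambda>k t. dist (cyl ((f ^^ k) (c t))) (cyl ((f ^^ k) z))) (\<lambda>_. 0)
       sequentially"

definition asymptotic_tangent_space ::
  "(real \<times> real \<Rightarrow> real \<times> real) \<Rightarrow> real \<times> real \<Rightarrow> real \<times> real \<Rightarrow> (real \<times> real) set" where
  "asymptotic_tangent_space f z x =
     {v. \<exists>c. asymptotic_arc f z c \<and> c 0 = x \<and> (c has_vector_derivative v) (at 0)}"

definition W_s :: "(real \<Rightarrow> complex) \<Rightarrow> real \<times> real \<Rightarrow> (real \<times> real) set" where
  "W_s \<Gamma> z = asymptotic_set (billiard_map \<Gamma>) z"

definition W_u :: "(real \<Rightarrow> complex) \<Rightarrow> real \<times> real \<Rightarrow> (real \<times> real) set" where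
  "W_u \<Gamma> z = asymptotic_set (billiard_inv \<Gamma>) z"

definition tangent_line_s ::
  "(real \<Rightarrow> complex) \<Rightarrow> real \<times> real \<Rightarrow> real \<times> real \<Rightarrow> (real \<times> real) set \<Rightarrow> bool" where
  "tangent_line_s \<Gamma> z x L \<longleftrightarrow>
     L = asymptotic_tangent_space (billiard_map \<Gamma>) z x \<and> (\<exists>v. v \<noteq> 0 \<and> L = span {v})"

definition tangent_line_u ::
  "(real \<Rightarrow> complex) \<Rightarrow> real \<times> real \<Rightarrow> real \<times> real \<Rightarrow> (real \<times> real) set \<Rightarrow> bool" where
  "tangent_line_u \<Gamma> z x L \<longleftrightarrow>
     L = asymptotic_tangent_space (billiard_inv \<Gamma>) z x \<and> (\<exists>v. v \<noteq> 0 \<and> L = span {v})"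

text \<open>To be used for hyperbolic periodic points \<open>z0\<close> and \<open>z1\<close>. The point \<open>x\<close> is called homoclinic if \<open>z0\<close> and \<open>z1\<close> are the same point of the cylinder and
  heteroclinic otherwise.\<close>

definition connecting_point ::
  "(real \<Rightarrow> complex) \<Rightarrow> real \<times> real \<Rightarrow> real \<times> real \<Rightarrow> real \<times> real \<Rightarrow> bool" where
  "connecting_point \<Gamma> z0 z1 x \<longleftrightarrow>
     x \<in> W_s \<Gamma> z0 \<inter> W_u \<Gamma> z1 \<and> cyl x \<noteq> cyl z0 \<and> cyl x \<noteq> cyl z1"

definition tangent_connecting_point ::
  "(real \<Rightarrow> complex) \<Rightarrow> real \<times> real \<Rightarrow> real \<times> real \<Rightarrow> real \<times> real \<Rightarrow> bool" where
  "tangent_connecting_point \<Gamma> z0 z1 x \<longleftrightarrow> connecting_point \<Gamma> z0 z1 x \<and>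
     (\<exists>L. tangent_line_s \<Gamma> z0 x L \<and> tangent_line_u \<Gamma> z1 x L)"

definition transversal_connecting_point ::
  "(real \<Rightarrow> complex) \<Rightarrow> real \<times> real \<Rightarrow> real \<times> real \<Rightarrow> real \<times> real \<Rightarrow> bool" where
  "transversal_connecting_point \<Gamma> z0 z1 x \<longleftrightarrow> connecting_point \<Gamma> z0 z1 x \<and>
     (\<exists>L L'. tangent_line_s \<Gamma> z0 x L \<and> tangent_line_u \<Gamma> z1 x L' \<and> L \<noteq> L')"

end

(*
  The support function of the oval is changed by a small n-symmetric bump which is flat to first order
  at one impact angle of the connecting orbit and vanishes near all other angles visited by the three orbits,
  unless they agree with this angle up to the symmetry. The curve keeps its points and tangents along the orbits,
  so all orbits persist, and the maps near the tails are unchanged; only the curvature at some of the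
  impacts of the connecting orbit changes. In the symplectic coordinates "beam width, beam direction"
  a change of curvature acts as a shear, and all shears have the same sign. The determinant between the
  perturbed and the unperturbed image of the common tangent vector is therefore a sum of terms of one sign,
  and it is nonzero as soon as the beam has nonzero width at one of the changed impacts. Such an impact,
  at an angle that the periodic orbits do not visit, exists by a cone argument at the periodic orbit.
*)
theory Submission
  imports Defs
begin

section \<open>Smooth functions\<close>

text \<open>The bump cannot be confined to a single impact: it repeats with period 2 pi / n, and the
  connecting orbit may return to the chosen angle, or to a symmetric copy of it, several times.
  Hence the weight on signs. Angles are compared through \<open>cis \<phi> ^ n\<close>, which
  forgets the symmetry. The chosen angle must avoid the finitely many angles of the periodic orbits,
  because the derivatives along these orbits and the dynamics near them are to remain literally the
  same. But the common tangent vector might be vertical (d\<phi> = 0) at every other impact, and a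
  curvature change does not move a vertical vector. Excluding this is the hard step. Tangent lines
  consist of velocities of uniformly asymptotic arcs, so the lines of the two maps are related by
  carrying arcs through finitely many iterates: the maps agree near the tails, beyond N steps
  forward and M steps backward, and only the finite stretch in between has to be compared.\<close>

lemma smooth_iff:
  "smooth f \<longleftrightarrow> (\<exists>F. F 0 = f \<and> (\<forall>k x. (F k has_vector_derivative F (Suc k) x) (at x)))"
proof
  assume f: "smooth f"
  define F where "F k = ((\<lambda>h y. vector_derivative h (at y)) ^^ k) f" for k
  have "(F k has_vector_derivative F (Suc k) x) (at x)" for k x
    using f by (simp add: smooth_def F_def vector_derivative_works)
  moreover have "F 0 = f" by (simp add: F_def)
  ultimately show "\<exists>F. F 0 = f \<and> (\<forall>k x. (F k has_vector_derivative F (Suc k) x) (at x))" by blast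
next
  assume "\<exists>F. F 0 = f \<and> (\<forall>k x. (F k has_vector_derivative F (Suc k) x) (at x))"
  then obtain F where F: "F 0 = f" "\<And>k x. (F k has_vector_derivative F (Suc k) x) (at x)" by blast
  have *: "((\<lambda>h y. vector_derivative h (at y)) ^^ k) f = F k" for k
  proof (induction k)
    case (Suc k)
    show ?case using F(2) by (auto simp: Suc vector_derivative_at)
  qed (simp add: F)
  show "smooth f"
    unfolding smooth_def * using F(2) by (meson differentiableI_vector)
qed

text \<open>Choosing in \<open>S\<close> a derivative of each member gives an operator
  \<open>d\<close> on \<open>S\<close>, and its iterates at \<open>f\<close> form the tower of
  \<open>smooth_iff\<close>.\<close>

lemma smooth_closedI:
  assumes "f \<in> S" and S: "\<And>h. h \<in> S \<Longrightarrow> \<exists>h'\<in>S. \<forall>x. (h has_vector_derivative h' x) (at x)"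
  shows "smooth f"
proof -
  obtain d where d: "\<And>h. h \<in> S \<Longrightarrow> d h \<in> S \<and> (\<forall>x. (h has_vector_derivative d h x) (at x))"
    using S by metis
  have "(d ^^ k) f \<in> S" for k
    by (induction k) (use d assms in auto)
  then show ?thesis
    unfolding smooth_iff using d by (intro exI[of _ "\<lambda>k. (d ^^ k) f"]) auto
qed

text \<open>Higher derivatives of products and compositions are polynomials in the given
  derivatives. The algebra generated by these is closed under differentiation, which replaces the
  Leibniz and Faa di Bruno formulas.\<close>

inductive_set fun_algebra ::
  "(real \<Rightarrow> 'a::real_normed_algebra) set \<Rightarrow> (real \<Rightarrow> 'a) set" for B where
  base: "f \<in> B \<Longrightarrow> f \<in> fun_algebra B"
| const: "(\<lambda>_. c) \<in> fun_algebra B"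
| add: "f \<in> fun_algebra B \<Longrightarrow> g \<in> fun_algebra B \<Longrightarrow> (\<lambda>x. f x + g x) \<in> fun_algebra B"
| mult: "f \<in> fun_algebra B \<Longrightarrow> g \<in> fun_algebra B \<Longrightarrow> (\<lambda>x. f x * g x) \<in> fun_algebra B"

lemma smooth_fun_algebra:
  assumes "f \<in> fun_algebra B"
    and B: "\<And>b. b \<in> B \<Longrightarrow> \<exists>b'\<in>fun_algebra B. \<forall>x. (b has_vector_derivative b' x) (at x)"
  shows "smooth f"
proof (rule smooth_closedI[OF assms(1)])
  fix h assume "h \<in> fun_algebra B"
  then show "\<exists>h'\<in>fun_algebra B. \<forall>x. (h has_vector_derivative h' x) (at x)"
  proof (induction rule: fun_algebra.induct)
    case (base f)
    then show ?case using B by blast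
  next
    case (const c)
    show ?case by (intro bexI[of _ "\<lambda>_. 0"]) (auto intro: fun_algebra.const)
  next
    case (add f g)
    then obtain f' g' where "f' \<in> fun_algebra B" "g' \<in> fun_algebra B"
      "\<forall>x. (f has_vector_derivative f' x) (at x)" "\<forall>x. (g has_vector_derivative g' x) (at x)" by blast
    then show ?case
      by (intro bexI[of _ "\<lambda>x. f' x + g' x"])
        (auto intro: fun_algebra.add has_vector_derivative_add)
  next
    case (mult f g)
    then obtain f' g' where "f' \<in> fun_algebra B" "g' \<in> fun_algebra B"
      "\<forall>x. (f has_vector_derivative f' x) (at x)" "\<forall>x. (g has_vector_derivative g' x) (at x)" by blast
    then show ?case using mult
      by (intro bexI[of _ "\<lambda>x. f x * g' x + f' x * g x"])
        (auto intro!: fun_algebra.add fun_algebra.mult has_vector_derivative_mult)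
  qed
qed

lemma smooth_add:
  assumes "smooth f" "smooth g"
  shows "smooth (\<lambda>x. f x + g x)"
proof -
  obtain F G where F: "F 0 = f" "\<And>k x. (F k has_vector_derivative F (Suc k) x) (at x)"
    and G: "G 0 = g" "\<And>k x. (G k has_vector_derivative G (Suc k) x) (at x)"
    using assms by (meson smooth_iff)
  show ?thesis
    unfolding smooth_iff
    by (intro exI[of _ "\<lambda>k x. F k x + G k x"]) (auto simp: F G intro: has_vector_derivative_add)
qed

lemma smooth_mult:
  fixes f g :: "real \<Rightarrow> 'a::real_normed_algebra"
  assumes "smooth f" "smooth g"
  shows "smooth (\<lambda>x. f x * g x)"
proof -
  obtain F G where F: "F 0 = f" "\<And>k x. (F k has_vector_derivative F (Suc k) x) (at x)"
    and G: "G 0 = g" "\<And>k x. (G k has_vector_derivative G (Suc k) x) (at x)"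
    using assms by (meson smooth_iff)
  have "(\<lambda>x. F 0 x * G 0 x) \<in> fun_algebra (range F \<union> range G)"
    by (intro fun_algebra.mult fun_algebra.base) auto
  then show ?thesis unfolding F G
    by (rule smooth_fun_algebra) (use F G in \<open>blast intro: fun_algebra.base\<close>)
qed

lemma smooth_const: "smooth (\<lambda>_. c)"
  unfolding smooth_iff by (intro exI[of _ "\<lambda>k _. if k = 0 then c else 0"]) auto

lemma smooth_compose:
  fixes f :: "real \<Rightarrow> real"
  assumes "smooth f" "smooth g"
  shows "smooth (\<lambda>x. f (g x))"
proof -
  obtain F G where F: "F 0 = f" "\<And>k x. (F k has_vector_derivative F (Suc k) x) (at x)"
    and G: "G 0 = g" "\<And>k x. (G k has_vector_derivative G (Suc k) x) (at x)"
    using assms by (meson smooth_iff)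
  \<comment> \<open>The chain rule produces only derivatives of \<open>f\<close> evaluated along
    \<open>g\<close> and derivatives of \<open>g\<close>, so these generate a suitable
    algebra.\<close>
  let ?B = "range (\<lambda>k x. F k (G 0 x)) \<union> range G"
  have "smooth (\<lambda>x. F 0 (G 0 x))"
  proof (rule smooth_fun_algebra[of _ ?B])
    show "(\<lambda>x. F 0 (G 0 x)) \<in> fun_algebra ?B"
      by (intro fun_algebra.base) auto
    fix b assume "b \<in> ?B"
    then show "\<exists>b'\<in>fun_algebra ?B. \<forall>x. (b has_vector_derivative b' x) (at x)"
    proof
      assume "b \<in> range (\<lambda>k x. F k (G 0 x))"
      then obtain k where b: "b = (\<lambda>x. F k (G 0 x))" by blast
      have "(b has_vector_derivative G 1 x * F (Suc k) (G 0 x)) (at x)" for x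
        using vector_diff_chain_at[OF G(2)[of 0 x] F(2)[of k "G 0 x"]] by (simp add: b o_def)
      then show ?thesis
        by (intro bexI[of _ "\<lambda>x. G 1 x * F (Suc k) (G 0 x)"])
          (auto intro!: fun_algebra.mult intro: fun_algebra.base)
    next
      assume "b \<in> range G"
      then show ?thesis using G(2) by (blast intro: fun_algebra.base)
    qed
  qed
  then show ?thesis by (simp add: F G)
qed

lemma smooth_bounded_linear:
  assumes "bounded_linear L" "smooth f"
  shows "smooth (\<lambda>x. L (f x))"
proof -
  obtain F where F: "F 0 = f" "\<And>k x. (F k has_vector_derivative F (Suc k) x) (at x)"
    using assms by (meson smooth_iff)
  show ?thesis
    unfolding smooth_iff
    by (intro exI[of _ "\<lambda>k x. L (F k x)"])
      (auto simp: F intro: bounded_linear.has_vector_derivative[OF assms(1)])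
qed

lemma smooth_deriv:
  assumes "smooth f" "\<And>x. (f has_vector_derivative f' x) (at x)"
  shows "smooth f'"
proof -
  obtain F where F: "F 0 = f" "\<And>k x. (F k has_vector_derivative F (Suc k) x) (at x)"
    using assms by (meson smooth_iff)
  have "f' = F 1"
    using F(2)[of 0] assms(2) F(1) by (metis One_nat_def ext vector_derivative_unique_at)
  then show ?thesis
    unfolding smooth_iff using F by (intro exI[of _ "\<lambda>k. F (Suc k)"]) auto
qed

lemma smooth_differentiable: "smooth f \<Longrightarrow> f differentiable (at x)"
  unfolding smooth_def by (metis funpow_0)

lemma smooth_continuous: "smooth f \<Longrightarrow> continuous_on S f"
  by (meson continuous_at_imp_continuous_on differentiable_imp_continuous_within smooth_differentiable)

lemma smooth_obtain_deriv:
  assumes "smooth f"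
  obtains f' where "smooth f'" "\<And>x. (f has_vector_derivative f' x) (at x)"
  using that[of "\<lambda>x. vector_derivative f (at x)"] smooth_deriv[OF assms] smooth_differentiable[OF assms]
  by (simp add: vector_derivative_works)

lemma cis_has_vector_derivative: "(cis has_vector_derivative \<i> * cis x) (at x)"
  unfolding has_vector_derivative_def by (auto intro!: derivative_eq_intros)

lemma smooth_cis: "smooth cis"
proof -
  have "cis \<in> fun_algebra {cis}" by (simp add: fun_algebra.base)
  then show ?thesis
    by (rule smooth_fun_algebra)
      (auto intro!: bexI[of _ "\<lambda>x. \<i> * cis x"] fun_algebra.const fun_algebra.mult cis_has_vector_derivative
        intro: fun_algebra.base)
qed

lemma smooth_affine: "smooth (\<lambda>x::real. a * x + b)"
proof -
  have "(\<lambda>x::real. x) \<in> fun_algebra {\<lambda>x. x}" by (simp add: fun_algebra.base)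
  then have "smooth (\<lambda>x::real. x)"
    by (rule smooth_fun_algebra)
      (auto intro!: bexI[of _ "\<lambda>_. 1"] fun_algebra.const)
  then show ?thesis
    by (intro smooth_add smooth_mult smooth_const)
qed

lemma smooth_cos: "smooth (cos :: real \<Rightarrow> real)"
proof -
  have "cos = (\<lambda>x. Re (cis x))" by auto
  then show ?thesis using smooth_bounded_linear[OF bounded_linear_Re smooth_cis] by simp
qed

section \<open>Flat functions and the periodic bump\<close>

lemma poly_div_exp_tendsto_0: "((\<lambda>x::real. x ^ k * poly p x / exp x) \<longlongrightarrow> 0) at_top"
proof (induction p arbitrary: k)
  case (pCons a p)
  have "((\<lambda>x. a * (x ^ k / exp x) + x ^ Suc k * poly p x / exp x) \<longlongrightarrow> a * 0 + 0) at_top"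
    by (intro tendsto_add tendsto_mult tendsto_const tendsto_power_div_exp_0 pCons.IH)
  then show ?case by (simp add: field_simps)
qed simp

text \<open>The polynomial parameter makes the family closed under differentiation;
  \<open>flat 1\<close> is the classical exp (-1/x), continued by zero.\<close>

definition flat :: "real poly \<Rightarrow> real \<Rightarrow> real" where
  "flat p x = (if x > 0 then poly p (1 / x) / exp (1 / x) else 0)"

text \<open>With s = 1/x and ds/dx = - s^2, the derivative of p(s) exp (-s) is s^2 (p(s) - p'(s))
  exp (-s). At 0 the difference quotient from the right is s p(s) exp (-s), which tends to 0 as s
  grows.\<close>

lemma flat_has_derivative:
  "(flat p has_real_derivative flat (monom 1 2 * (p - pderiv p)) x) (at x)"
proof -
  consider "x > 0" | "x < 0" | "x = 0" by linarith
  then show ?thesis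
  proof cases
    case 1
    have "((\<lambda>x. poly p (1 / x) / exp (1 / x)) has_real_derivative
        flat (monom 1 2 * (p - pderiv p)) x) (at x)"
      using 1 by (auto intro!: derivative_eq_intros DERIV_chain'[OF _ poly_DERIV]
        simp: flat_def poly_monom field_simps power2_eq_square)
    then show ?thesis
      by (rule has_field_derivative_transform_within_open[of _ _ _ "{0<..}"])
        (use 1 in \<open>auto simp: flat_def\<close>)
  next
    case 2
    have "((\<lambda>x. 0) has_real_derivative flat (monom 1 2 * (p - pderiv p)) x) (at x)"
      using 2 by (simp add: flat_def)
    then show ?thesis
      by (rule has_field_derivative_transform_within_open[of _ _ _ "{..<0}"])
        (use 2 in \<open>auto simp: flat_def\<close>)
  next
    case 3
    have "((\<lambda>h. flat p h / h) \<longlongrightarrow> 0) (at_right 0)"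
    proof -
      have "((\<lambda>h. (inverse h) ^ 1 * poly p (inverse h) / exp (inverse h)) \<longlongrightarrow> 0) (at_right (0::real))"
        by (rule filterlim_compose[OF poly_div_exp_tendsto_0 filterlim_inverse_at_top_right])
      then show ?thesis
        by (rule Lim_transform_eventually)
          (auto simp: flat_def field_simps eventually_at_filter)
    qed
    moreover have "((\<lambda>h. flat p h / h) \<longlongrightarrow> 0) (at_left 0)"
      by (rule Lim_transform_eventually[OF tendsto_const])
        (auto simp: flat_def eventually_at_filter)
    ultimately have "((\<lambda>h. flat p h / h) \<longlongrightarrow> 0) (at 0)"
      by (simp add: filterlim_split_at)
    then show ?thesis
      by (simp add: 3 DERIV_def flat_def)
  qed
qed

lemma smooth_flat: "smooth (flat p)"
proof (rule smooth_closedI[of _ "range flat"])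
  fix h assume "h \<in> range flat"
  then show "\<exists>h'\<in>range flat. \<forall>x. (h has_vector_derivative h' x) (at x)"
    using flat_has_derivative by (auto simp: has_real_derivative_iff_has_vector_derivative)
qed simp

lemma flat_1_pos: "x > 0 \<Longrightarrow> flat 1 x > 0"
  and flat_nonpos: "x \<le> 0 \<Longrightarrow> flat p x = 0"
  by (auto simp: flat_def)

text \<open>The bump is \<open>h (s x)\<close> with \<open>s x = 1 - cos (n * (x - c))\<close> and
  h(t) = t exp (-1/(r - t)) for t < r. Since \<open>s\<close> vanishes to exactly second order at
  its zeros, the factor t makes \<open>b\<close> and \<open>b1\<close> vanish there while
  \<open>b2\<close> equals n^2 exp (-1/r); the flat factor cuts the bump off where \<open>s\<close>
  reaches \<open>r\<close>. The centres form the class of c modulo 2 pi / n.\<close>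

lemma periodic_bump:
  fixes n :: nat and c r :: real
  assumes "n > 0" "r > 0"
  obtains b b1 b2 :: "real \<Rightarrow> real" where
    "smooth b" "smooth b1" "smooth b2"
    "\<And>x. (b has_real_derivative b1 x) (at x)" "\<And>x. (b1 has_real_derivative b2 x) (at x)"
    "\<And>x. b (x + 2 * pi / n) = b x" "\<And>x. b1 (x + 2 * pi / n) = b1 x"
    "bounded (range b)" "bounded (range b1)" "bounded (range b2)"
    "\<And>x. 1 - cos (n * (x - c)) \<ge> r \<Longrightarrow> b x = 0 \<and> b1 x = 0 \<and> b2 x = 0"
    "\<And>x. cos (n * (x - c)) = 1 \<Longrightarrow> b x = 0 \<and> b1 x = 0 \<and> b2 x > 0"
proof -
  define p1 p2 :: "real poly" where "p1 = monom 1 2 * (1 - pderiv 1)"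
    and "p2 = monom 1 2 * (p1 - pderiv p1)"
  define h h1 h2 where "h t = t * flat 1 (r - t)" and "h1 t = flat 1 (r - t) - t * flat p1 (r - t)"
    and "h2 t = t * flat p2 (r - t) - 2 * flat p1 (r - t)" for t
  have flat_diff: "((\<lambda>t. flat q (r - t)) has_real_derivative - flat (monom 1 2 * (q - pderiv q)) (r - t)) (at t)"
    for q t
  proof -
    have "((\<lambda>t. r - t) has_real_derivative -1) (at t)" by (auto intro!: derivative_eq_intros)
    from DERIV_chain2[OF flat_has_derivative this] show ?thesis by simp
  qed
  have h: "(h has_real_derivative h1 t) (at t)" for t
    unfolding h_def h1_def by (auto intro!: derivative_eq_intros flat_diff simp: p1_def)
  have h1: "(h1 has_real_derivative h2 t) (at t)" for t
    unfolding h1_def h2_def by (auto intro!: derivative_eq_intros flat_diff simp: p1_def p2_def)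
  have sm_aff: "smooth (\<lambda>t. r - t)"
    using smooth_affine[of "-1" r] by (simp add: add.commute)
  have sm_id: "smooth (\<lambda>t::real. t)" using smooth_affine[of 1 0] by simp
  have "smooth h"
    unfolding h_def by (intro smooth_mult sm_id smooth_compose[OF smooth_flat] sm_aff)
  define s where "s x = 1 - cos (n * (x - c))" for x
  define b b1 b2 where "b x = h (s x)" and "b1 x = h1 (s x) * (n * sin (n * (x - c)))"
    and "b2 x = h2 (s x) * (n * sin (n * (x - c)))\<^sup>2 + h1 (s x) * (n\<^sup>2 * cos (n * (x - c)))" for x
  have s: "(s has_real_derivative n * sin (n * (x - c))) (at x)" for x
    unfolding s_def by (auto intro!: derivative_eq_intros)
  have b: "(b has_real_derivative b1 x) (at x)" for x
    unfolding b_def b1_def using DERIV_chain2[OF h s] by simp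
  have b1: "(b1 has_real_derivative b2 x) (at x)" for x
    unfolding b1_def b2_def
    by (auto intro!: derivative_eq_intros DERIV_chain2[OF h1 s] simp: power2_eq_square algebra_simps)
  have "smooth (\<lambda>x. (-1) * cos (n * x + (- n * c)))"
    by (intro smooth_mult smooth_const smooth_compose[OF smooth_cos] smooth_affine)
  from smooth_add[OF smooth_const this, of 1] have "smooth s"
    by (simp add: s_def[abs_def] algebra_simps)
  then have sb: "smooth b"
    unfolding b_def by (rule smooth_compose[OF \<open>smooth h\<close>])
  have sb1: "smooth b1"
    by (rule smooth_deriv[OF sb]) (use b in \<open>simp add: has_real_derivative_iff_has_vector_derivative\<close>)
  have sb2: "smooth b2"
    by (rule smooth_deriv[OF sb1]) (use b1 in \<open>simp add: has_real_derivative_iff_has_vector_derivative\<close>)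
  have arg: "n * (x + 2 * pi / n - c) = n * (x - c) + 2 * pi" for x
    using assms by (simp add: field_simps)
  have per: "s (x + 2 * pi / n) = s x" "sin (n * (x + 2 * pi / n - c)) = sin (n * (x - c))"
     "cos (n * (x + 2 * pi / n - c)) = cos (n * (x - c))" for x
    unfolding s_def arg by simp_all
  have bd: "bounded (range f)" if "smooth f" and p: "\<And>x. f (x + 2 * pi / n) = f x" for f :: "real \<Rightarrow> real"
  proof -
    have "f x \<in> f ` {0..2 * pi / n}" for x
    proof -
      define P where "P = 2 * pi / n"
      have "P > 0" using assms by (simp add: P_def)
      have pP: "f (x + P) = f x" for x using p by (simp add: P_def)
      have pk: "f (x + of_int k * P) = f x" for x k
      proof (induction k rule: int_induct[of _ 0])
        case base show ?case by simp
      next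
        case (step1 i) then show ?case using pP[of "x + of_int i * P"] by (simp add: algebra_simps)
      next
        case (step2 i) then show ?case using pP[of "x + of_int (i - 1) * P"] by (simp add: algebra_simps)
      qed
      define k where "k = \<lfloor>x / P\<rfloor>"
      have "of_int k \<le> x / P" "x / P < of_int k + 1" by (auto simp: k_def)
      then have "x + of_int (- k) * P \<in> {0..P}"
        using \<open>P > 0\<close> by (auto simp: field_simps)
      then show ?thesis using pk[of x "- k"] unfolding P_def by (metis image_eqI)
    qed
    then have "range f \<subseteq> f ` {0..2 * pi / n}" by auto
    moreover have "bounded (f ` {0..2 * pi / n})"
      by (intro compact_imp_bounded compact_continuous_image smooth_continuous \<open>smooth f\<close>) auto
    ultimately show ?thesis by (rule bounded_subset[rotated])
  qed
  have van: "b x = 0 \<and> b1 x = 0 \<and> b2 x = 0" if "1 - cos (n * (x - c)) \<ge> r" for x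
  proof -
    have "r - s x \<le> 0" using that by (simp add: s_def)
    then show ?thesis
      by (simp add: b_def b1_def b2_def h_def h1_def h2_def flat_nonpos)
  qed
  have cen: "b x = 0 \<and> b1 x = 0 \<and> b2 x > 0" if "cos (n * (x - c)) = 1" for x
  proof -
    have "s x = 0" "sin (n * (x - c)) = 0"
      using that by (simp add: s_def, metis cos_one_sin_zero)
    then show ?thesis
      using that assms flat_1_pos[of r] by (simp add: b_def b1_def b2_def h_def h1_def h2_def)
  qed
  have pb: "b (x + 2 * pi / n) = b x" "b1 (x + 2 * pi / n) = b1 x" "b2 (x + 2 * pi / n) = b2 x" for x
    unfolding b_def b1_def b2_def per by simp_all
  show ?thesis
    by (rule that[OF sb sb1 sb2 b b1 pb(1,2) bd[OF sb pb(1)] bd[OF sb1 pb(2)] bd[OF sb2 pb(3)] van cen])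
qed

section \<open>The lifted billiard map\<close>

lemma ex_pos_less_finite:
  fixes A :: "real set"
  assumes "finite A" "\<And>a. a \<in> A \<Longrightarrow> 0 < a"
  obtains d where "d > 0" "\<And>a. a \<in> A \<Longrightarrow> d < a"
proof (cases "A = {}")
  case False
  then have "Min A > 0" using assms by (subst Min_gr_iff) auto
  moreover have "Min A / 2 < a" if "a \<in> A" for a
    using \<open>Min A > 0\<close> Min_le[OF assms(1) that] by linarith
  ultimately show thesis using that[of "Min A / 2"] by simp
qed (use that[of 1] in auto)

text \<open>Continuity of \<open>y\<close> being given, a bootstrap remains: for increments u and s,
  A u + B s is at most e' (|u| + |s|). Absorbing half of B s gives |s| \<le> C |u|, and then the
  error is of order |u|.\<close>

lemma implicit_function_has_derivative:
  fixes h :: "'a::real_normed_vector \<times> real \<Rightarrow> real"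
  assumes h: "(h has_derivative (\<lambda>(u, s). A u + B * s)) (at (x, y x))"
    and B: "B \<noteq> 0"
    and A: "bounded_linear A"
    and y: "isCont y x"
    and zero: "eventually (\<lambda>x. h (x, y x) = 0) (nhds x)"
  shows "(y has_derivative (\<lambda>u. - A u / B)) (at x)"
proof -
  obtain K where K: "K > 0" "\<And>u. norm (A u) \<le> norm u * K"
    using bounded_linear.pos_bounded[OF A] by blast
  have h0: "h (x, y x) = 0" using zero by (rule eventually_nhds_x_imp_x)
  define C where "C = 2 * (K + \<bar>B\<bar>) / \<bar>B\<bar>"
  have C: "C > 0" using K B by (simp add: C_def add_pos_pos)
  have "\<exists>d>0. \<forall>z. norm (z - x) < d \<longrightarrow> norm (y z - y x - (- A (z - x) / B)) \<le> e * norm (z - x)"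
    if "e > 0" for e
  proof -
    \<comment> \<open>The first bound lets the term in |s| be absorbed, the second turns e' (1 + C)
      / |B| into the prescribed \<open>e\<close>.\<close>
    define e' where "e' = min (\<bar>B\<bar> / 2) (e * \<bar>B\<bar> / (1 + C))"
    have e': "e' > 0" "e' \<le> \<bar>B\<bar> / 2" "e' \<le> e * \<bar>B\<bar> / (1 + C)"
      unfolding e'_def using B C \<open>e > 0\<close> by (simp_all only: min.cobounded1 min.cobounded2) simp
    obtain d where d: "d > 0" "\<And>z. norm (z - (x, y x)) < d \<Longrightarrow>
        norm (h z - h (x, y x) - (\<lambda>(u, s). A u + B * s) (z - (x, y x))) \<le> e' * norm (z - (x, y x))"
      using h[unfolded has_derivative_at_alt] e'(1) by blast
    obtain d1 where d1: "d1 > 0" "\<And>z. dist z x < d1 \<Longrightarrow> dist (y z) (y x) < d / 2"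
      using y[unfolded continuous_at_eps_delta] d(1) by (metis half_gt_zero)
    obtain d2 where d2: "d2 > 0" "\<And>z. dist z x < d2 \<Longrightarrow> h (z, y z) = 0"
      using zero unfolding eventually_nhds_metric by blast
    show ?thesis
    proof (intro exI[of _ "Min {d / 2, d1, d2}"] conjI allI impI)
      fix z assume z: "norm (z - x) < Min {d / 2, d1, d2}"
      define u s where "u = z - x" and "s = y z - y x"
      have nz: "norm (z - x) < d / 2" "dist z x < d1" "dist z x < d2" using z by (auto simp: dist_norm)
      have nle: "norm (u, s) \<le> norm u + \<bar>s\<bar>" using norm_Pair_le[of u s] by simp
      have eq: "(z, y z) - (x, y x) = (u, s)" by (simp add: u_def s_def)
      have "norm (u, s) < d"
        using nle nz(1) d1(2)[OF nz(2)] by (simp add: u_def s_def dist_norm)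
      then have "norm (0 - 0 - (A u + B * s)) \<le> e' * norm (u, s)"
        using d(2)[of "(z, y z)", unfolded eq h0 d2(2)[OF nz(3)] prod.case] by blast
      then have "\<bar>A u + B * s\<bar> \<le> e' * norm (u, s)"
        by (simp only: diff_0_right diff_0 norm_minus_cancel real_norm_def)
      also have "\<dots> \<le> e' * (norm u + \<bar>s\<bar>)" using nle e' by simp
      finally have *: "\<bar>A u + B * s\<bar> \<le> e' * (norm u + \<bar>s\<bar>)" .
      have "\<bar>B\<bar> * \<bar>s\<bar> \<le> \<bar>A u + B * s\<bar> + \<bar>A u\<bar>"
        unfolding abs_mult[symmetric] by linarith
      also have "\<dots> \<le> e' * (norm u + \<bar>s\<bar>) + norm u * K" using * K(2)[of u] by simp
      also have "\<dots> \<le> \<bar>B\<bar> / 2 * (norm u + \<bar>s\<bar>) + norm u * K"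
        using mult_right_mono[OF e'(2), of "norm u + \<bar>s\<bar>"] by simp
      finally have "\<bar>B\<bar> * \<bar>s\<bar> \<le> norm u * (2 * K + \<bar>B\<bar>)" by argo
      also have "\<dots> \<le> norm u * (2 * (K + \<bar>B\<bar>))"
        using K by (intro mult_left_mono) auto
      also have "\<dots> = \<bar>B\<bar> * (C * norm u)" using B by (simp add: C_def field_simps)
      finally have s: "\<bar>s\<bar> \<le> C * norm u" using B by simp
      have "\<bar>B\<bar> * \<bar>s + A u / B\<bar> = \<bar>A u + B * s\<bar>"
        using B by (simp add: abs_mult[symmetric] field_simps)
      also have "\<dots> \<le> e' * (norm u + C * norm u)"
        using * s e' by (smt (verit) mult_left_mono)
      also have "\<dots> = e' * (1 + C) * norm u" by (simp add: algebra_simps)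
      also have "\<dots> \<le> e * \<bar>B\<bar> * norm u"
        using e'(3) C by (intro mult_right_mono) (auto simp: field_simps)
      also have "\<dots> = \<bar>B\<bar> * (e * norm u)" by simp
      finally have "\<bar>s + A u / B\<bar> \<le> e * norm u" using B by simp
      then show "norm (y z - y x - (- A (z - x) / B)) \<le> e * norm (z - x)"
        by (simp add: u_def s_def)
    qed (use d d1 d2 in auto)
  qed
  moreover have "bounded_linear (\<lambda>u. - A u / B)"
    using bounded_linear_compose[OF bounded_linear_mult_left[of "- 1 / B"] A] by simp
  ultimately show ?thesis
    unfolding has_derivative_at_alt by blast
qed

text \<open>Continuity is joint in base point and vector so that the velocity
  \<open>D (c t) (c' t)\<close> of an image arc is continuous in t.\<close>

definition C1_map :: "(real \<times> real \<Rightarrow> real \<times> real) \<Rightarrow> (real \<times> real \<Rightarrow> real \<times> real \<Rightarrow> real \<times> real) \<Rightarrow> bool" where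
  "C1_map f D \<longleftrightarrow> (\<forall>x\<in>phase. f x \<in> phase \<and> (f has_derivative D x) (at x)) \<and>
     continuous_on (phase \<times> UNIV) (\<lambda>(x, v). D x v)"

lemma open_phase: "open phase"
  unfolding phase_def by (intro open_Times) auto

text \<open>In the parametrization by the tangent angle the speed \<open>\<rho>\<close> is the
  radius of curvature. With \<open>\<rho>\<close> continuous the billiard map is continuously
  differentiable.\<close>

locale angle_curve =
  fixes \<Gamma> :: "real \<Rightarrow> complex" and \<rho> :: "real \<Rightarrow> real"
  assumes deriv: "(\<Gamma> has_vector_derivative \<rho> \<phi> *\<^sub>R cis \<phi>) (at \<phi>)"
    and pos: "\<rho> \<phi> > 0"
    and cont: "continuous_on UNIV \<rho>"
    and per: "\<Gamma> (\<phi> + 2 * pi) = \<Gamma> \<phi>"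
begin

abbreviation "T \<equiv> billiard_map \<Gamma>"

lemma per_minus: "\<Gamma> (\<phi> - 2 * pi) = \<Gamma> \<phi>"
  using per[of "\<phi> - 2 * pi"] by simp

lemma per_int: "\<Gamma> (\<phi> + 2 * pi * of_int k) = \<Gamma> \<phi>"
proof (induction k rule: int_induct[of _ 0])
  case (step1 i)
  then show ?case using per[of "\<phi> + 2 * pi * of_int i"] by (simp add: algebra_simps)
next
  case (step2 i)
  then show ?case using per_minus[of "\<phi> + 2 * pi * of_int i"] by (simp add: algebra_simps)
qed simp

lemma continuous_\<Gamma>: "continuous_on S \<Gamma>"
  by (meson continuous_at_imp_continuous_on deriv has_vector_derivative_continuous)

lemma per_\<rho>: "\<rho> (\<phi> + 2 * pi) = \<rho> \<phi>"
proof -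
  have "((\<lambda>x. \<Gamma> (x + 2 * pi)) has_vector_derivative \<rho> (\<phi> + 2 * pi) *\<^sub>R cis (\<phi> + 2 * pi)) (at \<phi>)"
  proof -
    have "((\<lambda>x. x + 2 * pi) has_vector_derivative 1) (at \<phi>)"
      by (auto intro!: derivative_eq_intros)
    from vector_diff_chain_at[OF this deriv] show ?thesis by (simp add: o_def)
  qed
  then have "(\<Gamma> has_vector_derivative \<rho> (\<phi> + 2 * pi) *\<^sub>R cis \<phi>) (at \<phi>)"
    by (simp add: per cis_mult[symmetric])
  then have "\<rho> (\<phi> + 2 * pi) *\<^sub>R cis \<phi> = \<rho> \<phi> *\<^sub>R cis \<phi>"
    using deriv vector_derivative_unique_at by blast
  then show ?thesis by simp
qed

text \<open>Signed distance of \<open>\<Gamma> \<psi>\<close> from the oriented line through \<open>\<Gamma> \<phi>\<close> with direction \<open>cis \<theta>\<close>.\<close>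

definition side :: "real \<Rightarrow> real \<Rightarrow> real \<Rightarrow> real" where
  "side \<phi> \<theta> \<psi> = Im (cis (- \<theta>) * (\<Gamma> \<psi> - \<Gamma> \<phi>))"

definition chord :: "real \<Rightarrow> real \<Rightarrow> real \<Rightarrow> real" where
  "chord \<phi> \<theta> \<psi> = Re (cis (- \<theta>) * (\<Gamma> \<psi> - \<Gamma> \<phi>))"

lemma \<Gamma>_diff: "\<Gamma> \<psi> = \<Gamma> \<phi> + Complex (chord \<phi> \<theta> \<psi>) (side \<phi> \<theta> \<psi>) * cis \<theta>"
proof -
  have "Complex (chord \<phi> \<theta> \<psi>) (side \<phi> \<theta> \<psi>) = cis (- \<theta>) * (\<Gamma> \<psi> - \<Gamma> \<phi>)"
    by (simp only: chord_def side_def complex_surj)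
  then show ?thesis by (simp add: mult.commute[of _ "cis \<theta>"] mult.assoc[symmetric] cis_mult)
qed

text \<open>The sign is that of sin (\<psi> - \<theta>): over one turn \<open>side\<close> falls
  from \<theta> - pi to \<theta> and rises from there to \<theta> + pi. This is how convexity
  enters.\<close>

lemma side_deriv: "(side \<phi> \<theta> has_real_derivative \<rho> \<psi> * sin (\<psi> - \<theta>)) (at \<psi>)"
proof -
  have "((\<lambda>\<psi>. cis (- \<theta>) * (\<Gamma> \<psi> - \<Gamma> \<phi>)) has_vector_derivative cis (- \<theta>) * (\<rho> \<psi> *\<^sub>R cis \<psi> - 0)) (at \<psi>)"
    by (intro has_vector_derivative_mult_right has_vector_derivative_diff deriv has_vector_derivative_const)
  from bounded_linear.has_vector_derivative[OF bounded_linear_Im this]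
  show ?thesis
    unfolding side_def has_real_derivative_iff_has_vector_derivative
    by (simp add: cis_mult sin_diff algebra_simps)
qed

lemma continuous_side: "continuous_on S (side \<phi> \<theta>)"
  by (meson DERIV_isCont continuous_at_imp_continuous_on side_deriv)

lemma side_self [simp]: "side \<phi> \<theta> \<phi> = 0" "side \<phi> \<theta> (\<phi> + 2 * pi) = 0"
  by (simp_all add: side_def per)

lemma side_decreasing:
  assumes "\<theta> - pi \<le> a" "a < b" "b \<le> \<theta>"
  shows "side \<phi> \<theta> b < side \<phi> \<theta> a"
proof (rule DERIV_neg_imp_decreasing_open[OF \<open>a < b\<close> _ continuous_side])
  fix x assume x: "a < x" "x < b"
  have "sin (\<theta> - x) > 0" using x assms by (intro sin_gt_zero) auto
  moreover have "sin (x - \<theta>) = - sin (\<theta> - x)" by (metis minus_diff_eq sin_minus)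
  ultimately have "\<rho> x * sin (x - \<theta>) < 0" using pos[of x] by (simp add: mult_pos_neg)
  then show "\<exists>y. (side \<phi> \<theta> has_real_derivative y) (at x) \<and> y < 0"
    using side_deriv by blast
qed

lemma side_increasing:
  assumes "\<theta> \<le> a" "a < b" "b \<le> \<theta> + pi"
  shows "side \<phi> \<theta> a < side \<phi> \<theta> b"
proof (rule DERIV_pos_imp_increasing_open[OF \<open>a < b\<close> _ continuous_side])
  fix x assume x: "a < x" "x < b"
  have "sin (x - \<theta>) > 0" using x assms by (intro sin_gt_zero) auto
  then have "\<rho> x * sin (x - \<theta>) > 0" using pos[of x] by simp
  then show "\<exists>y. (side \<phi> \<theta> has_real_derivative y) (at x) \<and> 0 < y"
    using side_deriv by blast
qed

lemma side_add_2pi: "side \<phi> \<theta> (\<psi> + 2 * pi) = side \<phi> \<theta> \<psi>"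
  by (simp add: side_def per)

lemma side_pos_pi_2pi:
  assumes "\<theta> - pi < \<phi>" "\<phi> < \<theta>" "\<theta> + pi \<le> \<psi>" "\<psi> < \<phi> + 2 * pi"
  shows "side \<phi> \<theta> \<psi> > 0"
  using side_decreasing[of \<theta> "\<psi> - 2 * pi" \<phi> \<phi>] side_add_2pi[of \<phi> \<theta> "\<psi> - 2 * pi"] assms by simp

text \<open>Starting from 0 at \<phi>, \<open>side\<close> falls until \<theta> and then rises; at
  \<theta> + pi it is positive because from there it falls to 0 at \<phi> + 2 pi. So the line meets
  the curve exactly once more.\<close>

lemma ex1_side_zero:
  assumes "\<theta> - pi < \<phi>" "\<phi> < \<theta>"
  shows "\<exists>!\<psi>. \<phi> < \<psi> \<and> \<psi> < \<phi> + 2 * pi \<and> side \<phi> \<theta> \<psi> = 0"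
    and side_zero_bounds: "\<phi> < \<psi> \<Longrightarrow> \<psi> < \<phi> + 2 * pi \<Longrightarrow> side \<phi> \<theta> \<psi> = 0 \<Longrightarrow> \<theta> < \<psi> \<and> \<psi> < \<theta> + pi"
proof -
  have neg: "side \<phi> \<theta> \<theta> < 0" using side_decreasing[of \<theta> \<phi> \<theta> \<phi>] assms by simp
  have posi: "side \<phi> \<theta> (\<theta> + pi) > 0" using side_pos_pi_2pi[of \<theta> \<phi> "\<theta> + pi"] assms by simp
  show *: "\<theta> < \<psi> \<and> \<psi> < \<theta> + pi" if "\<phi> < \<psi>" "\<psi> < \<phi> + 2 * pi" "side \<phi> \<theta> \<psi> = 0" for \<psi>
  proof (rule ccontr)
    assume "\<not> ?thesis"
    then consider "\<psi> \<le> \<theta>" | "\<theta> + pi \<le> \<psi>" by linarith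
    then show False
      using side_decreasing[of \<theta> \<phi> \<psi> \<phi>] side_pos_pi_2pi[of \<theta> \<phi> \<psi>] that assms by cases auto
  qed
  have "\<exists>\<psi>. \<theta> \<le> \<psi> \<and> \<psi> \<le> \<theta> + pi \<and> side \<phi> \<theta> \<psi> = 0"
    using neg posi by (intro IVT') (auto intro: continuous_side)
  then obtain \<psi> where \<psi>: "\<theta> \<le> \<psi>" "\<psi> \<le> \<theta> + pi" "side \<phi> \<theta> \<psi> = 0" by blast
  show "\<exists>!\<psi>. \<phi> < \<psi> \<and> \<psi> < \<phi> + 2 * pi \<and> side \<phi> \<theta> \<psi> = 0"
  proof (intro ex1I[of _ \<psi>])
    show "\<phi> < \<psi> \<and> \<psi> < \<phi> + 2 * pi \<and> side \<phi> \<theta> \<psi> = 0" using \<psi> assms by auto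
    fix \<psi>' assume a: "\<phi> < \<psi>' \<and> \<psi>' < \<phi> + 2 * pi \<and> side \<phi> \<theta> \<psi>' = 0"
    show "\<psi>' = \<psi>"
      using *[of \<psi>'] a \<psi> side_increasing[of \<theta> \<psi> \<psi>' \<phi>] side_increasing[of \<theta> \<psi>' \<psi> \<phi>]
      by (cases \<psi>' \<psi> rule: linorder_cases) auto
  qed
qed

lemma side_tangent_pos:
  assumes "\<phi> < \<psi>" "\<psi> < \<phi> + 2 * pi"
  shows "side \<phi> \<phi> \<psi> > 0"
proof (cases "\<psi> \<le> \<phi> + pi")
  case True
  then show ?thesis using side_increasing[of \<phi> \<phi> \<psi> \<phi>] assms by simp
next
  case False
  then show ?thesis
    using side_decreasing[of \<phi> "\<psi> - 2 * pi" \<phi> \<phi>] side_add_2pi[of \<phi> \<phi> "\<psi> - 2 * pi"] assms by simp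
qed

text \<open>The displacement is \<open>chord\<close> times cis \<theta>. Its component normal to the
  tangent at \<phi> is \<open>chord\<close> times sin (\<theta> - \<phi>), and it is positive
  because the curve lies on one side of that tangent.\<close>

lemma chord_pos:
  assumes "\<theta> - pi < \<phi>" "\<phi> < \<theta>" "\<phi> < \<psi>" "\<psi> < \<phi> + 2 * pi" "side \<phi> \<theta> \<psi> = 0"
  shows "chord \<phi> \<theta> \<psi> > 0"
proof -
  have "0 < Im (cis (- \<phi>) * (\<Gamma> \<psi> - \<Gamma> \<phi>))"
    using side_tangent_pos[OF assms(3,4)] by (simp add: side_def)
  also have "\<Gamma> \<psi> - \<Gamma> \<phi> = chord \<phi> \<theta> \<psi> *\<^sub>R cis \<theta>"
    using \<Gamma>_diff[of \<psi> \<phi> \<theta>] assms(5) by (simp add: complex_eq_iff)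
  also have "cis (- \<phi>) * (chord \<phi> \<theta> \<psi> *\<^sub>R cis \<theta>) = chord \<phi> \<theta> \<psi> *\<^sub>R cis (\<theta> - \<phi>)"
    by (simp add: cis_mult)
  also have "Im \<dots> = chord \<phi> \<theta> \<psi> * sin (\<theta> - \<phi>)" by simp
  finally show ?thesis
    using assms sin_gt_zero[of "\<theta> - \<phi>"] by (simp add: zero_less_mult_iff)
qed

lemma reduce_angle:
  obtains k :: int where "\<phi> \<le> \<psi> + 2 * pi * of_int k" "\<psi> + 2 * pi * of_int k < \<phi> + 2 * pi"
proof -
  define k where "k = - \<lfloor>(\<psi> - \<phi>) / (2 * pi)\<rfloor>"
  have "of_int (- k) \<le> (\<psi> - \<phi>) / (2 * pi)" "(\<psi> - \<phi>) / (2 * pi) < of_int (- k) + 1"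
    by (auto simp: k_def)
  then have "\<phi> \<le> \<psi> + 2 * pi * of_int k" "\<psi> + 2 * pi * of_int k < \<phi> + 2 * pi"
    by (auto simp: field_simps)
  then show thesis using that by blast
qed

section \<open>The next collision as a scalar equation\<close>

lemma reflect_cis: "reflect \<phi> (cis \<theta>) = cis (2 * \<phi> - \<theta>)"
proof -
  have "reflect \<phi> (cis \<theta>) = cos (\<theta> - \<phi>) *\<^sub>R cis \<phi> - sin (\<theta> - \<phi>) *\<^sub>R \<eta> \<phi>"
    by (simp add: reflect_def inner_complex_def \<eta>_def cos_diff sin_diff algebra_simps)
  also have "\<dots> = cis (\<phi> - (\<theta> - \<phi>))"
    unfolding complex_eq_iff cis.sel cos_diff[of \<phi> "\<theta> - \<phi>"] sin_diff[of \<phi> "\<theta> - \<phi>"]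
    by (simp add: \<eta>_def)
  finally show ?thesis by (simp add: algebra_simps)
qed

text \<open>Reflection sends direction \<theta> to 2 \<psi> - \<theta>, which forces the outgoing
  angle \<psi> - \<theta>. The ray is free before it reaches \<psi> since the line meets the curve
  only at \<phi> and \<psi>.\<close>

lemma next_collision_iff:
  assumes x: "x \<in> phase" and lift: "fst x < fst y" "fst y < fst x + 2 * pi"
  shows "next_collision \<Gamma> x y \<longleftrightarrow>
    side (fst x) (fst x + snd x) (fst y) = 0 \<and> snd y = fst y - fst x - snd x"
proof -
  define \<phi> \<theta> \<psi> where "\<phi> = fst x" and "\<theta> = fst x + snd x" and "\<psi> = fst y"
  have \<theta>: "\<theta> - pi < \<phi>" "\<phi> < \<theta>" using x by (auto simp: phase_def \<phi>_def \<theta>_def)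
  have lift': "\<phi> < \<psi>" "\<psi> < \<phi> + 2 * pi" using lift by (auto simp: \<phi>_def \<psi>_def)
  \<comment> \<open>Directions determine angles modulo 2 pi; both candidates lie in (0, pi), so they
    coincide.\<close>
  have uniq: "b = \<psi> - \<theta>"
    if b: "0 < b" "b < pi" and eq: "cis (\<psi> + b) = cis (2 * \<psi> - \<theta>)" and s: "side \<phi> \<theta> \<psi> = 0" for b
  proof -
    have "\<theta> < \<psi>" "\<psi> < \<theta> + pi" using side_zero_bounds[OF \<theta> lift' s] by auto
    have "cis (b - (\<psi> - \<theta>)) = cis (\<psi> + b) * cis (- (2 * \<psi> - \<theta>))"
      by (simp add: cis_mult algebra_simps)
    also have "\<dots> = 1" using eq by (simp add: cis_mult)
    finally have "cos (b - (\<psi> - \<theta>)) = 1" by (simp add: complex_eq_iff)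
    then obtain k :: int where "b - (\<psi> - \<theta>) = k * 2 * pi" by (auto simp: cos_one_2pi_int)
    moreover have "\<bar>b - (\<psi> - \<theta>)\<bar> < pi" using b \<open>\<theta> < \<psi>\<close> \<open>\<psi> < \<theta> + pi\<close> by auto
    ultimately have "\<bar>real_of_int k\<bar> * (2 * pi) < pi" by (simp add: abs_mult)
    then have "\<bar>real_of_int k\<bar> * (2 * pi) < 1 * (2 * pi)" using pi_gt_zero by linarith
    then have "\<bar>real_of_int k\<bar> < 1" by (simp only: mult_less_cancel_right_pos pi_gt_zero mult_pos_pos zero_less_numeral)
    then have "k = 0" by linarith
    then show ?thesis using \<open>b - (\<psi> - \<theta>) = k * 2 * pi\<close> by simp
  qed
  show ?thesis
  proof
    assume nc: "next_collision \<Gamma> x y"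
    then obtain t where t: "t > 0" "\<Gamma> \<psi> = \<Gamma> \<phi> + t *\<^sub>R cis \<theta>"
      and out: "outgoing y = reflect \<psi> (cis \<theta>)" and y: "y \<in> phase"
      by (auto simp: next_collision_def outgoing_def \<phi>_def \<theta>_def \<psi>_def)
    have s: "side \<phi> \<theta> \<psi> = 0" unfolding side_def t(2) by (simp add: cis_mult)
    moreover have "snd y = \<psi> - \<theta>"
      using uniq[of "snd y"] s out y
      by (auto simp: reflect_cis outgoing_def phase_def \<psi>_def)
    ultimately show "side (fst x) (fst x + snd x) (fst y) = 0 \<and> snd y = fst y - fst x - snd x"
      by (simp add: \<phi>_def \<theta>_def \<psi>_def)
  next
    assume a: "side (fst x) (fst x + snd x) (fst y) = 0 \<and> snd y = fst y - fst x - snd x"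
    then have s: "side \<phi> \<theta> \<psi> = 0" and y2: "snd y = \<psi> - \<theta>" by (auto simp: \<phi>_def \<theta>_def \<psi>_def)
    have b: "\<theta> < \<psi>" "\<psi> < \<theta> + pi" using side_zero_bounds[OF \<theta> lift' s] by auto
    define t where "t = chord \<phi> \<theta> \<psi>"
    have "t > 0" unfolding t_def by (rule chord_pos[OF \<theta> lift' s])
    have \<Gamma>\<psi>: "\<Gamma> \<psi> = \<Gamma> \<phi> + t *\<^sub>R cis \<theta>"
      using \<Gamma>_diff[of \<psi> \<phi> \<theta>] s by (simp add: complex_eq_iff t_def)
    have none: "\<Gamma> \<phi> + u *\<^sub>R cis \<theta> \<notin> range \<Gamma>" if u: "0 < u" "u < t" for u
    proof
      assume "\<Gamma> \<phi> + u *\<^sub>R cis \<theta> \<in> range \<Gamma>"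
      then obtain \<xi>0 where "\<Gamma> \<phi> + u *\<^sub>R cis \<theta> = \<Gamma> \<xi>0" by blast
      moreover obtain k :: int where k: "\<phi> \<le> \<xi>0 + 2 * pi * of_int k" "\<xi>0 + 2 * pi * of_int k < \<phi> + 2 * pi"
        using reduce_angle by blast
      ultimately obtain \<xi> where \<xi>: "\<Gamma> \<phi> + u *\<^sub>R cis \<theta> = \<Gamma> \<xi>" "\<phi> \<le> \<xi>" "\<xi> < \<phi> + 2 * pi"
        using per_int by metis
      show False
      proof (cases "\<xi> = \<phi>")
        case True
        then show False using \<xi>(1) u by simp
      next
        case False
        have "side \<phi> \<theta> \<xi> = 0" unfolding side_def \<xi>(1)[symmetric] by (simp add: cis_mult)
        then have "\<xi> = \<psi>" using ex1_side_zero[OF \<theta>] False \<xi> lift' s by (metis order_le_less)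
        then have "u *\<^sub>R cis \<theta> = t *\<^sub>R cis \<theta>" using \<xi>(1) \<Gamma>\<psi> by simp
        then show False using u by simp
      qed
    qed
    have "outgoing y = reflect \<psi> (cis \<theta>)"
      by (simp add: reflect_cis outgoing_def y2 \<psi>_def[symmetric])
    moreover have "y \<in> phase" using b y2 by (cases y) (auto simp: phase_def)
    ultimately show "next_collision \<Gamma> x y"
      unfolding next_collision_def
      using \<open>t > 0\<close> \<Gamma>\<psi> none by (auto simp: outgoing_def \<phi>_def \<theta>_def \<psi>_def)
  qed
qed

lemma T_eq_iff:
  assumes x: "x \<in> phase"
  shows "T x = y \<longleftrightarrow> fst x < fst y \<and> fst y < fst x + 2 * pi \<and>
    side (fst x) (fst x + snd x) (fst y) = 0 \<and> snd y = fst y - fst x - snd x"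
proof -
  let ?P = "\<lambda>y. fst x < fst y \<and> fst y < fst x + 2 * pi \<and>
    side (fst x) (fst x + snd x) (fst y) = 0 \<and> snd y = fst y - fst x - snd x"
  have Tx: "T x = (THE y. ?P y)"
    unfolding billiard_map_def
    by (rule arg_cong[where f = The]) (use next_collision_iff[OF x] in auto)
  have "\<exists>!\<psi>. fst x < \<psi> \<and> \<psi> < fst x + 2 * pi \<and> side (fst x) (fst x + snd x) \<psi> = 0"
    using x by (intro ex1_side_zero) (auto simp: phase_def)
  then obtain \<psi> where \<psi>: "fst x < \<psi>" "\<psi> < fst x + 2 * pi" "side (fst x) (fst x + snd x) \<psi> = 0"
    "\<And>\<psi>'. fst x < \<psi>' \<and> \<psi>' < fst x + 2 * pi \<and> side (fst x) (fst x + snd x) \<psi>' = 0 \<Longrightarrow> \<psi>' = \<psi>"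
    by (elim ex1E) blast
  have ex1: "\<exists>!y. ?P y"
  proof (rule ex1I[of _ "(\<psi>, \<psi> - fst x - snd x)"])
    fix y assume "?P y"
    moreover from this have "fst y = \<psi>" by (intro \<psi>(4)) auto
    ultimately show "y = (\<psi>, \<psi> - fst x - snd x)" by (simp add: prod_eq_iff)
  qed (use \<psi>(1-3) in auto)
  show ?thesis
  proof
    assume "T x = y"
    then show "?P y" using theI'[OF ex1] by (simp only: Tx)
  next
    assume "?P y"
    then show "T x = y" unfolding Tx by (rule the1_equality[OF ex1])
  qed
qed

lemma
  assumes "x \<in> phase"
  shows T_lift: "fst x < fst (T x)" "fst (T x) < fst x + 2 * pi"
    and T_side: "side (fst x) (fst x + snd x) (fst (T x)) = 0"
    and T_snd: "snd (T x) = fst (T x) - fst x - snd x"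
    and T_phase: "T x \<in> phase"
proof -
  show 1: "fst x < fst (T x)" "fst (T x) < fst x + 2 * pi"
    "side (fst x) (fst x + snd x) (fst (T x)) = 0"
    "snd (T x) = fst (T x) - fst x - snd x"
    using T_eq_iff[OF assms, of "T x"] by auto
  have "fst x + snd x < fst (T x) \<and> fst (T x) < fst x + snd x + pi"
    by (rule side_zero_bounds[of _ "fst x"]) (use 1 assms in \<open>auto simp: phase_def\<close>)
  then show "T x \<in> phase" using 1(4) by (cases "T x") (auto simp: phase_def)
qed

text \<open>The incoming direction at (\<phi>, \<alpha>) is cis (\<phi> - \<alpha>), and its
  opposite is cis (\<phi> + pi - \<alpha>): this is time reversal.\<close>

definition rev :: "real \<times> real \<Rightarrow> real \<times> real" where
  "rev x = (fst x, pi - snd x)"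

lemma rev_rev [simp]: "rev (rev x) = x"
  and rev_phase [simp]: "rev x \<in> phase \<longleftrightarrow> x \<in> phase"
  and fst_rev [simp]: "fst (rev x) = fst x" and snd_rev [simp]: "snd (rev x) = pi - snd x"
  by (cases x; auto simp: rev_def phase_def)+

lemma shift_phase [simp]: "x + (a, 0) \<in> phase \<longleftrightarrow> x \<in> phase" "x - (a, 0) \<in> phase \<longleftrightarrow> x \<in> phase"
  by (cases x; simp add: phase_def)+

lemma cis_of_int: "cis (x + 2 * pi * of_int k) = cis x"
  by (simp add: cis_mult[symmetric] cis_multiple_2pi)

lemma T_shift:
  assumes "x \<in> phase"
  shows "T (x + (2 * pi * of_int k, 0)) = T x + (2 * pi * of_int k, 0)"
proof -
  have "side (fst x + 2 * pi * of_int k) (fst x + 2 * pi * of_int k + snd x)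
      (fst (T x) + 2 * pi * of_int k) = side (fst x) (fst x + snd x) (fst (T x))"
  proof -
    have "cis (- (fst x + 2 * pi * of_int k + snd x)) = cis (- (fst x + snd x) + 2 * pi * of_int (- k))"
      by (simp add: algebra_simps)
    also have "\<dots> = cis (- (fst x + snd x))" by (rule cis_of_int)
    finally show ?thesis by (simp add: side_def per_int)
  qed
  then show ?thesis
    using assms T_lift[OF assms] T_side[OF assms] T_snd[OF assms]
    by (subst T_eq_iff) auto
qed

text \<open>The same chord is traversed backwards. The lifted map always increases the angle, by
  less than a full turn, so it reaches the old starting point one turn later: hence the 2
  pi.\<close>

lemma T_rev:
  assumes "x \<in> phase"
  shows "T (rev (T x)) = rev x + (2 * pi, 0)"
proof -
  define y where "y = T x"
  have y: "y \<in> phase" and s: "side (fst x) (fst x + snd x) (fst y) = 0"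
    and sy: "snd y = fst y - fst x - snd x" and l: "fst x < fst y" "fst y < fst x + 2 * pi"
    unfolding y_def using T_phase T_side T_snd T_lift assms by auto
  have "side (fst y) (fst y + (pi - snd y)) (fst x + 2 * pi) = side (fst x) (fst x + snd x) (fst y)"
  proof -
    have "fst y + (pi - snd y) = (fst x + snd x) + pi" by (simp add: sy)
    moreover have "cis (- (t + pi)) = - cis (- t)" for t
      by (simp add: complex_eq_iff)
    ultimately have "cis (- (fst y + (pi - snd y))) = - cis (- (fst x + snd x))" by metis
    then show ?thesis by (simp only: side_def per) (simp add: algebra_simps)
  qed
  then show ?thesis unfolding y_def[symmetric]
    using y s l by (subst T_eq_iff) (auto simp: sy)
qed

definition Ti :: "real \<times> real \<Rightarrow> real \<times> real" where
  "Ti y = rev (T (rev y)) - (2 * pi, 0)"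

lemma Ti_phase: "y \<in> phase \<Longrightarrow> Ti y \<in> phase"
  by (simp add: Ti_def T_phase)

lemma Ti_T: "x \<in> phase \<Longrightarrow> Ti (T x) = x"
  by (simp add: Ti_def T_rev prod_eq_iff)

lemma T_Ti:
  assumes "y \<in> phase"
  shows "T (Ti y) = y"
proof -
  have "T (rev (T (rev y))) = y + (2 * pi, 0)"
    using T_rev[of "rev y"] assms by simp
  moreover have "rev (T (rev y)) = Ti y + (2 * pi * of_int 1, 0)" by (simp add: Ti_def)
  ultimately have "T (Ti y) + (2 * pi * of_int 1, 0) = y + (2 * pi, 0)"
    using T_shift[OF Ti_phase[OF assms], of 1] by metis
  then show ?thesis by simp
qed

lemma billiard_inv_eq: "y \<in> phase \<Longrightarrow> billiard_inv \<Gamma> y = Ti y"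
  unfolding billiard_inv_def
  by (rule inv_into_f_eq) (auto simp: Ti_phase T_Ti intro!: inj_on_inverseI[of _ Ti] Ti_T)

text \<open>Density of the invariant area in the coordinates (\<phi>, \<alpha>); also the width,
  across the outgoing direction, that a beam gains per unit of \<phi>.\<close>

definition jac :: "real \<times> real \<Rightarrow> real" where
  "jac x = \<rho> (fst x) * sin (snd x)"

lemma \<Gamma>_has_derivative: "(\<Gamma> has_derivative (\<lambda>a. a *\<^sub>R (\<rho> \<phi> *\<^sub>R cis \<phi>))) (at \<phi>)"
  using deriv unfolding has_vector_derivative_def .

text \<open>Moving the base point contributes \<open>jac\<close>, turning the line by d\<phi> +
  d\<alpha> contributes minus \<open>chord\<close>, and moving \<psi> along the curve contributes
  the derivative in \<open>side_deriv\<close>.\<close>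

lemma side_has_derivative:
  "((\<lambda>(x, \<psi>). side (fst x) (fst x + snd x) \<psi>) has_derivative
     (\<lambda>(v, s). (jac x * fst v - chord (fst x) (fst x + snd x) \<psi> * (fst v + snd v)) +
        (\<rho> \<psi> * sin (\<psi> - fst x - snd x)) * s)) (at (x, \<psi>))"
proof -
  have 1: "((\<lambda>p. \<Gamma> (snd p)) has_derivative (\<lambda>p. snd p *\<^sub>R (\<rho> \<psi> *\<^sub>R cis \<psi>))) (at (x, \<psi>))"
    using has_derivative_compose[OF has_derivative_snd[OF has_derivative_ident]
        \<Gamma>_has_derivative, of "(x, \<psi>)" UNIV] by simp
  have 2: "((\<lambda>p. \<Gamma> (fst (fst p))) has_derivative (\<lambda>p. fst (fst p) *\<^sub>R (\<rho> (fst x) *\<^sub>R cis (fst x)))) (at (x, \<psi>))"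
    using has_derivative_compose[OF has_derivative_fst[OF has_derivative_fst[OF has_derivative_ident]]
        \<Gamma>_has_derivative, of "(x, \<psi>)" UNIV] by simp
  have 3: "((\<lambda>p. cis (- (fst (fst p) + snd (fst p)))) has_derivative
     (\<lambda>p. - (fst (fst p) + snd (fst p)) *\<^sub>R (\<i> * cis (- (fst x + snd x))))) (at (x, \<psi>))"
    by (auto intro!: derivative_eq_intros)
  have "((\<lambda>p. Im (cis (- (fst (fst p) + snd (fst p))) * (\<Gamma> (snd p) - \<Gamma> (fst (fst p))))) has_derivative
     (\<lambda>p. Im (cis (- (fst x + snd x)) * (snd p *\<^sub>R (\<rho> \<psi> *\<^sub>R cis \<psi>) - fst (fst p) *\<^sub>R (\<rho> (fst x) *\<^sub>R cis (fst x))) +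
      (- (fst (fst p) + snd (fst p)) *\<^sub>R (\<i> * cis (- (fst x + snd x)))) * (\<Gamma> \<psi> - \<Gamma> (fst x))))) (at (x, \<psi>))"
    by (rule has_derivative_eq_rhs[OF has_derivative_Im[OF has_derivative_mult[OF 3 has_derivative_diff[OF 1 2]]]])
      simp
  moreover have "Im (cis (- (fst x + snd x)) * (s *\<^sub>R (\<rho> \<psi> *\<^sub>R cis \<psi>) - a *\<^sub>R (\<rho> (fst x) *\<^sub>R cis (fst x))) +
      (- (a + b) *\<^sub>R (\<i> * cis (- (fst x + snd x)))) * (\<Gamma> \<psi> - \<Gamma> (fst x))) =
      (jac x * a - chord (fst x) (fst x + snd x) \<psi> * (a + b)) +
        (\<rho> \<psi> * sin (\<psi> - fst x - snd x)) * s" for a b s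
  proof -
    define z where "z = cis (- (fst x + snd x)) * (\<Gamma> \<psi> - \<Gamma> (fst x))"
    define E P F where "E = cis (- (fst x + snd x))" and "P = cis \<psi>" and "F = cis (fst x)"
    have "cis (- (fst x + snd x)) * (s *\<^sub>R (\<rho> \<psi> *\<^sub>R cis \<psi>) - a *\<^sub>R (\<rho> (fst x) *\<^sub>R cis (fst x))) +
      (- (a + b) *\<^sub>R (\<i> * cis (- (fst x + snd x)))) * (\<Gamma> \<psi> - \<Gamma> (fst x)) =
      (s * \<rho> \<psi>) *\<^sub>R cis (\<psi> - fst x - snd x) - (a * \<rho> (fst x)) *\<^sub>R cis (- snd x) - (a + b) *\<^sub>R (\<i> * z)"
    proof -
      have "cis (\<psi> - fst x - snd x) = E * P" "cis (- snd x) = E * F"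
        by (simp_all add: E_def P_def F_def cis_mult algebra_simps)
      then show ?thesis unfolding z_def E_def[symmetric] P_def[symmetric] F_def[symmetric]
        by (simp only:) (simp add: scaleR_conv_of_real algebra_simps)
    qed
    then show ?thesis by (simp only:) (simp add: jac_def chord_def z_def)
  qed
  ultimately show ?thesis
    by (simp add: side_def case_prod_beta')
qed

text \<open>A strict sign change of \<open>side\<close> around the impact persists for nearby data,
  and by uniqueness the zero it encloses is the impact of the neighbouring orbit.\<close>

lemma isCont_T_fst:
  assumes x: "x \<in> phase"
  shows "isCont (\<lambda>x. fst (T x)) x"
  unfolding continuous_at_eps_delta
proof (intro allI impI)
  fix e :: real assume "e > 0"
  let ?h = "\<lambda>x \<psi>. side (fst x) (fst x + snd x) \<psi>"
  let ?y = "\<lambda>x. fst (T x)"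
  have ybd: "fst x + snd x < ?y x" "?y x < fst x + snd x + pi"
    using T_phase[OF x] T_snd[OF x] by (auto simp: phase_def mem_Times_iff)
  \<comment> \<open>Besides being below \<open>e\<close>, the radius \<open>d\<close> keeps the
    bracket inside the range where \<open>side\<close> increases and inside the interval that
    selects the lift.\<close>
  obtain d where d0: "d > 0" and dA: "\<And>a. a \<in> {e, ?y x - (fst x + snd x), fst x + snd x + pi - ?y x,
    ?y x - fst x, fst x + 2 * pi - ?y x} \<Longrightarrow> d < a"
    using \<open>e > 0\<close> ybd T_lift[OF x]
    by (elim ex_pos_less_finite[rotated 2, where A = "{e, ?y x - (fst x + snd x), fst x + snd x + pi - ?y x,
    ?y x - fst x, fst x + 2 * pi - ?y x}"]) auto
  have d: "d > 0" "d < e" "fst x + snd x < ?y x - d" "?y x + d < fst x + snd x + pi"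
      "fst x < ?y x - d" "?y x + d < fst x + 2 * pi"
    using d0 dA[of e] dA[of "?y x - (fst x + snd x)"] dA[of "fst x + snd x + pi - ?y x"]
      dA[of "?y x - fst x"] dA[of "fst x + 2 * pi - ?y x"] by simp_all
  have lo: "?h x (?y x - d) < 0" and hi: "?h x (?y x + d) > 0"
    using side_increasing[of "fst x + snd x" "?y x - d" "?y x" "fst x"]
      side_increasing[of "fst x + snd x" "?y x" "?y x + d" "fst x"] d ybd T_side[OF x] by auto
  have ch: "continuous (at x) (\<lambda>x. ?h x \<psi>)" for \<psi>
    using isCont_o2[where f = "\<lambda>z. (z, \<psi>)" and a = x, OF _ has_derivative_continuous[OF side_has_derivative]]
    by simp
  have cn: "((\<lambda>x. ?h x \<psi>) \<longlongrightarrow> ?h x \<psi>) (nhds x)" for \<psi>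
    using tendsto_at_iff_tendsto_nhds[of "\<lambda>x. ?h x \<psi>" x] ch[of \<psi>] by (simp add: continuous_at)
  have ev: "\<forall>\<^sub>F z in nhds x. z \<in> phase \<and> ?h z (?y x - d) < 0 \<and> ?h z (?y x + d) > 0 \<and>
      fst z < ?y x - d \<and> ?y x + d < fst z + 2 * pi"
  proof (intro eventually_conj)
    show "\<forall>\<^sub>F z in nhds x. z \<in> phase"
      using open_phase x by (rule eventually_nhds_in_open)
    show "\<forall>\<^sub>F z in nhds x. ?h z (?y x - d) < 0"
      by (rule order_tendstoD(2)[OF cn lo])
    show "\<forall>\<^sub>F z in nhds x. ?h z (?y x + d) > 0"
      by (rule order_tendstoD(1)[OF cn hi])
    show "\<forall>\<^sub>F z in nhds x. fst z < ?y x - d"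
      using d by (intro order_tendstoD[where y = "fst x"] tendsto_fst filterlim_ident) auto
    show "\<forall>\<^sub>F z in nhds x. ?y x + d < fst z + 2 * pi"
      using d by (intro order_tendstoD[where y = "fst x + 2 * pi"] tendsto_intros tendsto_fst filterlim_ident) auto
  qed
  then obtain r where r: "r > 0" "\<And>z. dist z x < r \<Longrightarrow> z \<in> phase \<and> ?h z (?y x - d) < 0 \<and> ?h z (?y x + d) > 0 \<and>
      fst z < ?y x - d \<and> ?y x + d < fst z + 2 * pi"
    unfolding eventually_nhds_metric by blast
  show "\<exists>r>0. \<forall>z. dist z x < r \<longrightarrow> dist (?y z) (?y x) < e"
  proof (intro exI[of _ r] conjI allI impI)
    fix z assume "dist z x < r"
    note z = r(2)[OF this]
    have "\<exists>\<psi>. ?y x - d \<le> \<psi> \<and> \<psi> \<le> ?y x + d \<and> ?h z \<psi> = 0"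
      using z d by (intro IVT') (auto intro: continuous_side)
    then obtain \<psi> where \<psi>: "?y x - d \<le> \<psi>" "\<psi> \<le> ?y x + d" "?h z \<psi> = 0" by blast
    have "T z = (\<psi>, \<psi> - fst z - snd z)"
      using T_eq_iff[of z "(\<psi>, \<psi> - fst z - snd z)"] z \<psi> by auto
    then show "dist (?y z) (?y x) < e" using \<psi> d by (auto simp: dist_real_def)
  qed (rule r(1))
qed

definition step_chord :: "real \<times> real \<Rightarrow> real" where
  "step_chord x = chord (fst x) (fst x + snd x) (fst (T x))"

text \<open>Here \<open>d\<close> solves the linearized equation of a vanishing \<open>side\<close>
  for d\<psi>; the second component differentiates \<psi> - \<phi> - \<alpha>, the new
  angle.\<close>

definition DT :: "real \<times> real \<Rightarrow> real \<times> real \<Rightarrow> real \<times> real" where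
  "DT x v = (let d = (step_chord x * (fst v + snd v) - jac x * fst v) / jac (T x) in
     (d, d - fst v - snd v))"

lemma jac_pos: "x \<in> phase \<Longrightarrow> jac x > 0"
  by (auto simp: jac_def phase_def mem_Times_iff intro!: mult_pos_pos pos sin_gt_zero)

lemma step_chord_pos: "x \<in> phase \<Longrightarrow> step_chord x > 0"
  unfolding step_chord_def
  by (rule chord_pos) (use T_lift[of x] T_side[of x] in \<open>auto simp: phase_def mem_Times_iff\<close>)

lemma isCont_T:
  assumes "x \<in> phase"
  shows "isCont T x"
proof -
  have "isCont (\<lambda>x. (fst (T x), fst (T x) - fst x - snd x)) x"
    by (intro continuous_intros isCont_T_fst assms)
  moreover have "\<forall>\<^sub>F z in nhds x. (fst (T z), fst (T z) - fst z - snd z) = T z"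
    using eventually_nhds_in_open[OF open_phase assms]
    by eventually_elim (simp add: T_snd prod_eq_iff)
  ultimately show ?thesis
    using isCont_cong[of "\<lambda>x. (fst (T x), fst (T x) - fst x - snd x)" T x] by blast
qed

lemma C1_map_T: "C1_map T DT"
proof -
  have "(T has_derivative DT x) (at x)" if x: "x \<in> phase" for x
  proof -
    have j: "\<rho> (fst (T x)) * sin (fst (T x) - fst x - snd x) = jac (T x)"
      using T_snd[OF x] by (simp add: jac_def)
    have "((\<lambda>x. fst (T x)) has_derivative
        (\<lambda>v. - (jac x * fst v - step_chord x * (fst v + snd v)) / jac (T x))) (at x)"
    proof (rule implicit_function_has_derivative)
      show "((\<lambda>(x, \<psi>). side (fst x) (fst x + snd x) \<psi>) has_derivative
          (\<lambda>(v, s). (jac x * fst v - step_chord x * (fst v + snd v)) + jac (T x) * s)) (at (x, fst (T x)))"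
        using side_has_derivative[of x "fst (T x)"] by (simp only: j step_chord_def)
      show "jac (T x) \<noteq> 0" using jac_pos[OF T_phase[OF x]] by simp
      show "bounded_linear (\<lambda>v. jac x * fst v - step_chord x * (fst v + snd v))"
        by (intro bounded_linear_sub bounded_linear_add bounded_linear_const_mult bounded_linear_fst bounded_linear_snd)
      show "isCont (\<lambda>x. fst (T x)) x" by (rule isCont_T_fst[OF x])
      show "\<forall>\<^sub>F z in nhds x. (case (z, fst (T z)) of (x, \<psi>) \<Rightarrow> side (fst x) (fst x + snd x) \<psi>) = 0"
        using eventually_nhds_in_open[OF open_phase x] by eventually_elim (simp add: T_side)
    qed
    then have d: "((\<lambda>x. fst (T x)) has_derivative (\<lambda>v. fst (DT x v))) (at x)"
      by (simp add: DT_def Let_def)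
    have "((\<lambda>x. (fst (T x), fst (T x) - fst x - snd x)) has_derivative
        (\<lambda>v. (fst (DT x v), fst (DT x v) - fst v - snd v))) (at x)"
      by (intro has_derivative_Pair d derivative_intros has_derivative_diff has_derivative_fst has_derivative_snd has_derivative_ident)
    moreover have "(\<lambda>v. (fst (DT x v), fst (DT x v) - fst v - snd v)) = DT x"
      by (simp add: fun_eq_iff DT_def Let_def)
    ultimately have "((\<lambda>x. (fst (T x), fst (T x) - fst x - snd x)) has_derivative DT x) (at x)" by simp
    then show ?thesis
      by (rule has_derivative_transform_within_open[OF _ open_phase x]) (simp add: T_snd prod_eq_iff)
  qed
  moreover have "continuous_on (phase \<times> UNIV) (\<lambda>(x, v). DT x v)"
  proof -
    have cT: "continuous_on phase T"
      using isCont_T by (simp add: continuous_at_imp_continuous_on)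
    have cj: "continuous_on S jac" for S
      unfolding jac_def
      by (intro continuous_intros continuous_on_compose2[OF cont]) auto
    have cG: "continuous_on S f \<Longrightarrow> continuous_on S (\<lambda>x. \<Gamma> (f x))" for S :: "((real \<times> real) \<times> real \<times> real) set" and f
      by (rule continuous_on_compose2[OF continuous_\<Gamma>[of UNIV]]) auto
    have cT': "continuous_on (phase \<times> (UNIV :: (real \<times> real) set)) (\<lambda>p. T (fst p))"
      by (rule continuous_on_compose2[OF cT]) (auto intro!: continuous_intros)
    have cs: "continuous_on (phase \<times> (UNIV :: (real \<times> real) set)) (\<lambda>p. step_chord (fst p))"
      unfolding step_chord_def chord_def
      by (intro continuous_intros cG[of _ "\<lambda>x. fst (T (fst x))"] cG[of _ "\<lambda>x. fst (fst x)"] cT')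
    have cj1: "continuous_on (phase \<times> (UNIV :: (real \<times> real) set)) (\<lambda>p. jac (fst p))"
      by (rule continuous_on_compose2[OF cj[of UNIV]]) (auto intro!: continuous_intros)
    have cj2: "continuous_on (phase \<times> (UNIV :: (real \<times> real) set)) (\<lambda>p. jac (T (fst p)))"
      by (rule continuous_on_compose2[OF cj[of UNIV] cT']) auto
    have "\<forall>p\<in>phase \<times> UNIV. jac (T (fst p)) \<noteq> 0"
      by (metis T_phase jac_pos less_irrefl mem_Times_iff)
    then show ?thesis
      unfolding DT_def Let_def case_prod_beta'
      by (intro continuous_intros cs cj1 cj2)
  qed
  ultimately show ?thesis by (simp add: C1_map_def T_phase)
qed

text \<open>In the coordinates \<open>J = jac x * d\<phi>\<close> and \<open>w = d\<phi> + d\<alpha>\<close> (width and direction of a beam) the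
  curvature at the impact point enters only through a shear.\<close>

definition beam :: "real \<times> real \<Rightarrow> real \<times> real \<Rightarrow> real \<times> real" where
  "beam x v = (jac x * fst v, fst v + snd v)"

text \<open>The new direction angle is 2 \<psi> - \<theta>, so its differential is 2 d\<psi> - w,
  where d\<psi> is the new width divided by \<open>jac (T x)\<close>. This is the mirror equation:
  the radius of curvature at the new impact occurs in the coefficient \<open>2 / jac (T x)\<close>
  alone.\<close>

lemma beam_DT:
  assumes "x \<in> phase" "beam x v = (J, w)"
  shows "beam (T x) (DT x v) = (step_chord x * w - J, 2 / jac (T x) * (step_chord x * w - J) - w)"
  using assms jac_pos[OF T_phase[OF assms(1)]]
  by (auto simp: beam_def DT_def Let_def field_simps)

lemma linear_beam: "linear (beam x)"
  by (rule linearI) (auto simp: beam_def algebra_simps)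

end

context angle_curve begin

lemma billiard_inv_inverse: "x \<in> phase \<Longrightarrow> billiard_inv \<Gamma> (T x) = x"
  "x \<in> phase \<Longrightarrow> T (billiard_inv \<Gamma> x) = x"
  "x \<in> phase \<Longrightarrow> billiard_inv \<Gamma> x \<in> phase"
  by (simp_all add: billiard_inv_eq T_phase Ti_T T_Ti Ti_phase)

text \<open>Conjugation of \<open>DT\<close> by the derivative of time reversal.\<close>

definition DTi :: "real \<times> real \<Rightarrow> real \<times> real \<Rightarrow> real \<times> real" where
  "DTi y v = (let u = DT (rev y) (fst v, - snd v) in (fst u, - snd u))"

lemma C1_map_billiard_inv: "C1_map (billiard_inv \<Gamma>) DTi"
proof -
  have "(billiard_inv \<Gamma> has_derivative DTi y) (at y)" if y: "y \<in> phase" for y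
  proof -
    have r: "(rev has_derivative (\<lambda>v. (fst v, - snd v))) (at x)" for x
      unfolding rev_def by (auto intro!: derivative_eq_intros)
    have "(T has_derivative DT (rev y)) (at (rev y))"
      using C1_map_T y by (simp add: C1_map_def)
    from has_derivative_compose[OF has_derivative_compose[OF r this] r]
    have "((\<lambda>x. rev (T (rev x)) - (2 * pi, 0)) has_derivative DTi y) (at y)"
      unfolding DTi_def Let_def by (auto intro!: derivative_eq_intros)
    then show ?thesis
      by (rule has_derivative_transform_within_open[OF _ open_phase y])
        (simp add: billiard_inv_eq Ti_def)
  qed
  moreover have "continuous_on (phase \<times> UNIV) (\<lambda>(x, v). DTi x v)"
  proof -
    have c: "continuous_on (phase \<times> UNIV) (\<lambda>p. DT (fst p) (snd p))"
      using C1_map_T by (simp add: C1_map_def case_prod_beta')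
    have "continuous_on (phase \<times> UNIV) (\<lambda>p. DT (fst (rev (fst p), (fst (snd p), - snd (snd p))))
        (snd (rev (fst p), (fst (snd p), - snd (snd p)))))"
      by (rule continuous_on_compose2[OF c, where f = "\<lambda>p. (rev (fst p), (fst (snd p), - snd (snd p)))"])
        (auto simp: rev_def phase_def intro!: continuous_intros)
    then show ?thesis
      unfolding DTi_def Let_def case_prod_beta'
      by (intro continuous_intros) simp_all
  qed
  ultimately show ?thesis by (simp add: C1_map_def billiard_inv_inverse)
qed

text \<open>In beam coordinates the area form jac d\<phi> d\<alpha> is dJ dw, and both the free
  flight and the shear have determinant 1.\<close>

lemma DT_area:
  assumes "x \<in> phase"
  shows "jac (T x) * (fst (DT x u) * snd (DT x v) - snd (DT x u) * fst (DT x v)) =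
    jac x * (fst u * snd v - snd u * fst v)"
proof -
  have d: "jac (T x) * fst (DT x w) = step_chord x * (fst w + snd w) - jac x * fst w"
    and s: "snd (DT x w) = fst (DT x w) - fst w - snd w" for w
    using jac_pos[OF T_phase[OF assms]] by (simp_all add: DT_def Let_def)
  have "jac (T x) * (fst (DT x u) * snd (DT x v) - snd (DT x u) * fst (DT x v)) =
    (fst u + snd u) * (jac (T x) * fst (DT x v)) - (jac (T x) * fst (DT x u)) * (fst v + snd v)"
    unfolding s by (simp add: algebra_simps)
  also have "\<dots> = jac x * (fst u * snd v - snd u * fst v)"
    unfolding d by (simp add: algebra_simps)
  finally show ?thesis .
qed

end

section \<open>Iterates and tangent spaces of asymptotic sets\<close>

fun Diter :: "('a \<Rightarrow> 'a) \<Rightarrow> ('a \<Rightarrow> 'b \<Rightarrow> 'b) \<Rightarrow> nat \<Rightarrow> 'a \<Rightarrow> 'b \<Rightarrow> 'b" where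
  "Diter f D 0 x v = v"
| "Diter f D (Suc k) x v = D ((f ^^ k) x) (Diter f D k x v)"

lemma C1_map_compose:
  assumes f: "C1_map f D" and g: "C1_map g E"
  shows "C1_map (\<lambda>x. g (f x)) (\<lambda>x v. E (f x) (D x v))"
proof -
  have "((\<lambda>x. g (f x)) has_derivative (\<lambda>v. E (f x) (D x v))) (at x)" if "x \<in> phase" for x
    using assms that has_derivative_compose[of f "D x" x UNIV g "E (f x)"] by (simp add: C1_map_def)
  moreover have "continuous_on (phase \<times> UNIV) (\<lambda>p. E (f (fst p)) (D (fst p) (snd p)))"
  proof -
    have cE: "continuous_on (phase \<times> UNIV) (\<lambda>p. E (fst p) (snd p))"
      and cD: "continuous_on (phase \<times> UNIV) (\<lambda>p. D (fst p) (snd p))"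
      using f g by (simp_all add: C1_map_def case_prod_beta')
    have "continuous_on phase f"
      using f by (auto simp: C1_map_def intro!: continuous_at_imp_continuous_on has_derivative_continuous)
    then have cf: "continuous_on (phase \<times> UNIV) (\<lambda>p. f (fst p))"
      by (rule continuous_on_compose2) (auto intro!: continuous_intros)
    have "continuous_on (phase \<times> UNIV) (\<lambda>p. E (fst (f (fst p), D (fst p) (snd p))) (snd (f (fst p), D (fst p) (snd p))))"
      by (rule continuous_on_compose2[OF cE, where f = "\<lambda>p. (f (fst p), D (fst p) (snd p))"])
        (use f in \<open>auto simp: C1_map_def intro!: continuous_on_Pair cf cD\<close>)
    then show ?thesis by simp
  qed
  ultimately show ?thesis
    using f g by (auto simp: C1_map_def case_prod_beta')
qed

lemma C1_map_iter:
  assumes "C1_map f D"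
  shows "C1_map (f ^^ k) (Diter f D k)"
proof (induction k)
  case 0
  show ?case by (simp add: C1_map_def id_def case_prod_beta' continuous_on_snd has_derivative_ident)
next
  case (Suc k)
  show ?case using C1_map_compose[OF Suc assms] by (simp add: o_def Diter.simps(2)[abs_def])
qed

lemma C1_map_phase: "C1_map f D \<Longrightarrow> x \<in> phase \<Longrightarrow> f x \<in> phase"
  and C1_map_deriv: "C1_map f D \<Longrightarrow> x \<in> phase \<Longrightarrow> (f has_derivative D x) (at x)"
  and C1_map_linear: "C1_map f D \<Longrightarrow> x \<in> phase \<Longrightarrow> linear (D x)"
  by (auto simp: C1_map_def dest: has_derivative_linear)

lemma iter_phase: "C1_map f D \<Longrightarrow> x \<in> phase \<Longrightarrow> (f ^^ k) x \<in> phase"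
  using C1_map_phase[OF C1_map_iter] .

lemma C1_map_continuous_on: "C1_map f D \<Longrightarrow> continuous_on phase f"
  by (auto simp: C1_map_def intro!: continuous_at_imp_continuous_on has_derivative_continuous)

lemma C1_map_inverse:
  assumes f: "C1_map f D" and g: "C1_map g E" and gf: "\<And>x. x \<in> phase \<Longrightarrow> g (f x) = x" and x: "x \<in> phase"
  shows "E (f x) (D x v) = v"
proof -
  have "((\<lambda>x. g (f x)) has_derivative (\<lambda>v. E (f x) (D x v))) (at x)"
    using C1_map_deriv[OF C1_map_compose[OF f g] x] .
  moreover have "((\<lambda>x. g (f x)) has_derivative (\<lambda>v. v)) (at x)"
    by (rule has_derivative_transform_within_open[OF has_derivative_ident open_phase x]) (simp add: gf)
  ultimately show ?thesis by (metis has_derivative_unique)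
qed

lemma iter_inverse:
  assumes f: "C1_map f D" and gf: "\<And>x. x \<in> phase \<Longrightarrow> g (f x) = x" and x: "x \<in> phase"
  shows "(g ^^ k) ((f ^^ k) x) = x"
proof (induction k)
  case (Suc k)
  then show ?case using gf[OF iter_phase[OF f x, of k]] funpow_swap1[of g k "f ((f ^^ k) x)"] by simp
qed simp

lemma Diter_inverse:
  assumes f: "C1_map f D" and g: "C1_map g E" and gf: "\<And>x. x \<in> phase \<Longrightarrow> g (f x) = x" and x: "x \<in> phase"
  shows "Diter g E k ((f ^^ k) x) (Diter f D k x v) = v"
  using C1_map_inverse[OF C1_map_iter[OF f] C1_map_iter[OF g]] iter_inverse[OF f gf] x by blast

lemma Diter_add: "Diter f D (k + j) x v = Diter f D k ((f ^^ j) x) (Diter f D j x v)"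
  by (induction k) (simp_all add: funpow_add)

lemma has_vector_derivative_C1_map:
  assumes "C1_map f D" "c t \<in> phase" "(c has_vector_derivative v) (at t)"
  shows "((\<lambda>t. f (c t)) has_vector_derivative D (c t) v) (at t)"
  using vector_derivative_diff_chain_within[OF assms(3), of f "D (c t)"] C1_map_deriv[OF assms(1,2)]
  by (auto simp: o_def intro: has_derivative_at_withinI)

lemma C1_differentiable_on_C1_map:
  assumes f: "C1_map f D" and c: "c C1_differentiable_on S" "c ` S \<subseteq> phase"
  shows "(\<lambda>t. f (c t)) C1_differentiable_on S"
proof -
  obtain c' where c': "\<And>t. t \<in> S \<Longrightarrow> (c has_vector_derivative c' t) (at t)" "continuous_on S c'"
    using c by (auto simp: C1_differentiable_on_def)
  have "continuous_on S c"
    using c' by (meson continuous_at_imp_continuous_on has_vector_derivative_continuous)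
  then have "continuous_on S (\<lambda>t. (c t, c' t))"
    by (intro continuous_on_Pair c')
  then have "continuous_on S (\<lambda>t. (\<lambda>(x, v). D x v) (c t, c' t))"
    using f c by (intro continuous_on_compose2[of "phase \<times> UNIV" "\<lambda>(x, v). D x v" S "\<lambda>t. (c t, c' t)"])
      (auto simp: C1_map_def)
  then show ?thesis
    unfolding C1_differentiable_on_def
    using has_vector_derivative_C1_map[OF f _ c'(1)] c(2)
    by (intro exI[of _ "\<lambda>t. D (c t) (c' t)"]) auto
qed

lemma C1_differentiable_on_compose_real:
  fixes h :: "real \<Rightarrow> real"
  assumes c: "c C1_differentiable_on S" and h: "h C1_differentiable_on R" "h ` R \<subseteq> S"
  shows "(\<lambda>t. c (h t)) C1_differentiable_on R"
proof -
  obtain c' where c': "\<And>t. t \<in> S \<Longrightarrow> (c has_vector_derivative c' t) (at t)" "continuous_on S c'"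
    using c by (auto simp: C1_differentiable_on_def)
  obtain h' where h': "\<And>t. t \<in> R \<Longrightarrow> (h has_vector_derivative h' t) (at t)" "continuous_on R h'"
    using h by (auto simp: C1_differentiable_on_def)
  have "continuous_on R h"
    using h' by (meson continuous_at_imp_continuous_on has_vector_derivative_continuous)
  then have "continuous_on R (\<lambda>t. h' t *\<^sub>R c' (h t))"
    using h h' by (intro continuous_on_scaleR continuous_on_compose2[OF c'(2)]) auto
  moreover have "((\<lambda>t. c (h t)) has_vector_derivative h' t *\<^sub>R c' (h t)) (at t)" if "t \<in> R" for t
    using vector_diff_chain_at[OF h'(1)[OF that] c'(1)] that h by (auto simp: o_def)
  ultimately show ?thesis
    unfolding C1_differentiable_on_def by (intro exI[of _ "\<lambda>t. h' t *\<^sub>R c' (h t)"]) auto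
qed

lemma continuous_on_cyl: "continuous_on S cyl"
  unfolding cyl_def cis_conv_exp by (intro continuous_intros)

text \<open>If \<open>f\<close> and \<open>g\<close> agree near the tails of the orbits of \<open>x\<close> and \<open>z\<close>, then an asymptotic arc of
  \<open>f\<close>, shortened so that it follows the orbit of \<open>x\<close> from time \<open>N\<close> on, is carried to one of \<open>g\<close> by
  \<open>gi ^^ N \<circ> f ^^ N\<close>. The substitution \<open>h t = s * sin (t / s)\<close> shortens the arc without changing its
  velocity at \<open>0\<close>.\<close>

lemma asymptotic_tangent_space_transport:
  assumes f: "C1_map f Df" and g: "C1_map g Dg" and gi: "C1_map gi Dgi"
    and gi_g: "\<And>x. x \<in> phase \<Longrightarrow> gi (g x) = x" and g_gi: "\<And>x. x \<in> phase \<Longrightarrow> g (gi x) = x"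
    and x: "x \<in> phase"
    and z_orbit: "\<And>k. (g ^^ k) z = (f ^^ k) z" and x_orbit: "(g ^^ N) x = (f ^^ N) x"
    and near: "\<And>k. k \<ge> N \<Longrightarrow> dist (cyl ((f ^^ k) x)) (cyl ((f ^^ k) z)) < r"
    and agree: "\<And>y k. y \<in> phase \<Longrightarrow> k \<ge> N \<Longrightarrow> dist (cyl y) (cyl ((f ^^ k) z)) < r \<Longrightarrow>
      dist (cyl (f y)) (cyl ((f ^^ Suc k) z)) < r \<Longrightarrow> g y = f y"
    and v: "v \<in> asymptotic_tangent_space f z x"
  shows "Diter gi Dgi N ((f ^^ N) x) (Diter f Df N x v) \<in> asymptotic_tangent_space g z x"
proof -
  obtain c where c: "asymptotic_arc f z c" "c 0 = x" "(c has_vector_derivative v) (at 0)"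
    using v by (auto simp: asymptotic_tangent_space_def)
  have cC1: "c C1_differentiable_on {-1<..<1}" and cphase: "\<And>t. t \<in> {-1<..<1} \<Longrightarrow> c t \<in> phase"
    and ul: "uniform_limit {-1<..<1} (\<lambda>k t. dist (cyl ((f ^^ k) (c t))) (cyl ((f ^^ k) z))) (\<lambda>_. 0) sequentially"
    using c(1) unfolding asymptotic_arc_def asymptotic_set_def image_subset_iff by blast+
  have "r > 0" using le_less_trans[OF zero_le_dist near[of N]] by simp
  then obtain k0 where k0: "\<And>k t. k \<ge> k0 \<Longrightarrow> t \<in> {-1<..<1} \<Longrightarrow> dist (cyl ((f ^^ k) (c t))) (cyl ((f ^^ k) z)) < r"
    using uniform_limitD[OF ul \<open>r > 0\<close>] unfolding eventually_sequentially dist_real_def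
    by (simp only: diff_0_right abs_of_nonneg zero_le_dist) blast
  have cont_c: "isCont (\<lambda>t. dist (cyl ((f ^^ k) (c t))) (cyl ((f ^^ k) z))) 0" for k
  proof -
    have "continuous_on {-1<..<1} c"
      using C1_differentiable_imp_continuous_on[OF cC1] .
    then have "continuous_on {-1<..<1} (\<lambda>t. (f ^^ k) (c t))"
      using cphase by (intro continuous_on_compose2[OF C1_map_continuous_on[OF C1_map_iter[OF f]]]) auto
    then have "continuous_on {-1<..<1} (\<lambda>t. dist (cyl ((f ^^ k) (c t))) (cyl ((f ^^ k) z)))"
      by (intro continuous_intros continuous_on_compose2[OF continuous_on_cyl]) auto
    then show ?thesis by (rule continuous_on_interior) (simp add: interior_open)
  qed
  \<comment> \<open>Uniform convergence controls all times from \<open>k0\<close> on; the finitely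
    many times between \<open>N\<close> and \<open>k0\<close> are controlled by continuity at 0,
    where \<open>near\<close> provides the strict bound.\<close>
  have "\<forall>\<^sub>F t in nhds 0. \<forall>k\<in>{N..k0}. dist (cyl ((f ^^ k) (c t))) (cyl ((f ^^ k) z)) < r"
  proof (rule eventually_ball_finite)
    show "\<forall>k\<in>{N..k0}. \<forall>\<^sub>F t in nhds 0. dist (cyl ((f ^^ k) (c t))) (cyl ((f ^^ k) z)) < r"
    proof
      fix k assume "k \<in> {N..k0}"
      then have "dist (cyl ((f ^^ k) (c 0))) (cyl ((f ^^ k) z)) < r" using near c by simp
      moreover have "((\<lambda>t. dist (cyl ((f ^^ k) (c t))) (cyl ((f ^^ k) z))) \<longlongrightarrow>
          dist (cyl ((f ^^ k) (c 0))) (cyl ((f ^^ k) z))) (nhds 0)"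
        using tendsto_at_iff_tendsto_nhds[of "\<lambda>t. dist (cyl ((f ^^ k) (c t))) (cyl ((f ^^ k) z))" 0]
          cont_c[of k] by (simp add: continuous_at)
      ultimately show "\<forall>\<^sub>F t in nhds 0. dist (cyl ((f ^^ k) (c t))) (cyl ((f ^^ k) z)) < r"
        by (rule order_tendstoD(2)[rotated])
    qed
  qed simp
  then obtain \<tau>0 where \<tau>0: "\<tau>0 > 0" "\<And>t k. \<bar>t\<bar> < \<tau>0 \<Longrightarrow> N \<le> k \<Longrightarrow> k \<le> k0 \<Longrightarrow>
      dist (cyl ((f ^^ k) (c t))) (cyl ((f ^^ k) z)) < r"
    unfolding eventually_nhds_metric by (auto simp: dist_real_def)
  define s where "s = min \<tau>0 1 / 2"
  have s: "s > 0" "s < \<tau>0" "s < 1" using \<tau>0(1) by (auto simp: s_def)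
  define h where "h t = s * sin (t / s)" for t
  have h_bd: "\<bar>h t\<bar> \<le> s" for t
    using s(1) abs_sin_le_one[of "t / s"] by (simp add: h_def abs_mult mult_le_cancel_left1)
  have h_in: "h t \<in> {-1<..<1}" and h_\<tau>0: "\<bar>h t\<bar> < \<tau>0" for t
    using h_bd[of t] s by auto
  have h': "(h has_vector_derivative cos (t / s)) (at t)" for t
    unfolding h_def has_real_derivative_iff_has_vector_derivative[symmetric]
    using s(1) by (auto intro!: derivative_eq_intros)
  have hC1: "h C1_differentiable_on {-1<..<1}"
    unfolding C1_differentiable_on_def
    using h' s(1) by (intro exI[of _ "\<lambda>t. cos (t / s)"]) (auto intro!: continuous_intros)
  have tail: "dist (cyl ((f ^^ k) (c (h t)))) (cyl ((f ^^ k) z)) < r" if "k \<ge> N" for k t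
    using k0[of k "h t"] \<tau>0(2)[of "h t" k] h_in h_\<tau>0 that by (cases "k \<le> k0") auto
  define e where "e t = (gi ^^ N) ((f ^^ N) (c (h t)))" for t
  have ch_phase: "c (h t) \<in> phase" for t using cphase h_in by blast
  have fch: "(f ^^ k) (c (h t)) \<in> phase" for k t by (rule iter_phase[OF f ch_phase])
  have e_phase: "e t \<in> phase" for t
    unfolding e_def by (rule iter_phase[OF gi fch])
  \<comment> \<open>From time \<open>N\<close> on the shortened arc stays where \<open>f\<close> and
    \<open>g\<close> agree, so both produce the same orbits and \<open>e\<close> inherits the
    uniform convergence.\<close>
  have ge: "(g ^^ (N + j)) (e t) = (f ^^ (N + j)) (c (h t))" for j t
  proof (induction j)
    case 0
    show ?case unfolding e_def using iter_inverse[OF gi g_gi fch] by simp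
  next
    case (Suc j)
    have "g ((f ^^ (N + j)) (c (h t))) = f ((f ^^ (N + j)) (c (h t)))"
      using tail[of "N + j" t] tail[of "N + Suc j" t] by (intro agree[of _ "N + j"] fch) auto
    then show ?case using Suc by simp
  qed
  have "uniform_limit {-1<..<1} (\<lambda>k t. dist (cyl ((f ^^ k) (c (h t)))) (cyl ((f ^^ k) z))) (\<lambda>_. 0) sequentially"
    unfolding uniform_limit_iff
  proof (intro allI impI)
    fix eps :: real assume "eps > 0"
    from uniform_limitD[OF ul this]
    show "\<forall>\<^sub>F k in sequentially. \<forall>t\<in>{-1<..<1}. dist (dist (cyl ((f ^^ k) (c (h t)))) (cyl ((f ^^ k) z))) 0 < eps"
      by eventually_elim (use h_in in blast)
  qed
  moreover have "\<forall>\<^sub>F k in sequentially. \<forall>t\<in>{-1<..<1}.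
      dist (cyl ((g ^^ k) (e t))) (cyl ((g ^^ k) z)) = dist (cyl ((f ^^ k) (c (h t)))) (cyl ((f ^^ k) z))"
    unfolding eventually_sequentially
    by (intro exI[of _ N]) (metis ge z_orbit le_Suc_ex)
  ultimately have ule: "uniform_limit {-1<..<1} (\<lambda>k t. dist (cyl ((g ^^ k) (e t))) (cyl ((g ^^ k) z))) (\<lambda>_. 0) sequentially"
    by (subst uniform_limit_cong) auto
  have "e t \<in> asymptotic_set g z" if "t \<in> {-1<..<1}" for t
    using e_phase tendsto_uniform_limitI[OF ule that] by (simp add: asymptotic_set_def)
  moreover have "e C1_differentiable_on {-1<..<1}"
    unfolding e_def
    by (intro C1_differentiable_on_C1_map[OF C1_map_iter[OF gi]] C1_differentiable_on_C1_map[OF C1_map_iter[OF f]]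
        C1_differentiable_on_compose_real[OF cC1 hC1]) (use h_in ch_phase fch in auto)
  ultimately have arc: "asymptotic_arc g z e"
    using ule by (auto simp: asymptotic_arc_def)
  have h0: "h 0 = 0" by (simp add: h_def)
  have "e 0 = x"
    unfolding e_def h0 c(2) x_orbit[symmetric] by (rule iter_inverse[OF g gi_g x])
  moreover have "(e has_vector_derivative Diter gi Dgi N ((f ^^ N) x) (Diter f Df N x v)) (at 0)"
  proof -
    have "((\<lambda>t. c (h t)) has_vector_derivative v) (at 0)"
      using vector_diff_chain_at[OF h'[of 0], of c v] c(3) h0 by (simp add: o_def)
    from has_vector_derivative_C1_map[OF C1_map_iter[OF gi, of N] _ has_vector_derivative_C1_map[OF C1_map_iter[OF f, of N] _ this]]
    show ?thesis unfolding e_def using iter_phase[OF f x, of N] x h0 c(2) by simp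
  qed
  ultimately show ?thesis
    unfolding asymptotic_tangent_space_def using arc by blast
qed

text \<open>Transport works in both directions and the transport back undoes the first, so a line
  goes to a line. The last conclusion, that the two velocities have equal images after
  \<open>N\<close> steps, is what later compares the old and the new tangent vector.\<close>

lemma asymptotic_tangent_space_span:
  assumes f: "C1_map f Df" and g: "C1_map g Dg" and gi: "C1_map gi Dgi" and fi: "C1_map fi Dfi"
    and gi_g: "\<And>x. x \<in> phase \<Longrightarrow> gi (g x) = x" and g_gi: "\<And>x. x \<in> phase \<Longrightarrow> g (gi x) = x"
    and fi_f: "\<And>x. x \<in> phase \<Longrightarrow> fi (f x) = x" and f_fi: "\<And>x. x \<in> phase \<Longrightarrow> f (fi x) = x"
    and x: "x \<in> phase"
    and z_orbit: "\<And>k. (g ^^ k) z = (f ^^ k) z" and x_orbit: "\<And>k. (g ^^ k) x = (f ^^ k) x"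
    and near: "\<And>k. k \<ge> N \<Longrightarrow> dist (cyl ((f ^^ k) x)) (cyl ((f ^^ k) z)) < r"
    and agree: "\<And>y k. y \<in> phase \<Longrightarrow> k \<ge> N \<Longrightarrow> dist (cyl y) (cyl ((f ^^ k) z)) < r \<Longrightarrow>
      dist (cyl (f y)) (cyl ((f ^^ Suc k) z)) < r \<Longrightarrow> g y = f y"
    and agree': "\<And>y k. y \<in> phase \<Longrightarrow> k \<ge> N \<Longrightarrow> dist (cyl y) (cyl ((f ^^ k) z)) < r \<Longrightarrow>
      dist (cyl (g y)) (cyl ((f ^^ Suc k) z)) < r \<Longrightarrow> f y = g y"
    and v: "v \<noteq> 0" "asymptotic_tangent_space f z x = span {v}"
  obtains u where "u \<noteq> 0" "asymptotic_tangent_space g z x = span {u}"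
    "Diter g Dg N x u = Diter f Df N x v"
proof -
  define B where "B w = Diter gi Dgi N ((f ^^ N) x) (Diter f Df N x w)" for w
  define B' where "B' w = Diter fi Dfi N ((f ^^ N) x) (Diter g Dg N x w)" for w
  have gB: "Diter g Dg N x (B w) = Diter f Df N x w" for w
  proof -
    have xN: "(gi ^^ N) ((f ^^ N) x) = x" using iter_inverse[OF g gi_g x] x_orbit by simp
    show ?thesis
      unfolding B_def using Diter_inverse[OF gi g g_gi iter_phase[OF f x], of N N] xN by metis
  qed
  have fB': "Diter f Df N x (B' w) = Diter g Dg N x w" for w
    unfolding B'_def using Diter_inverse[OF fi f f_fi iter_phase[OF f x], of N N] iter_inverse[OF f fi_f x] by metis
  have BB': "B (B' w) = w" for w
    unfolding B_def fB' x_orbit[symmetric] by (rule Diter_inverse[OF g gi gi_g x])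
  have lin: "linear B"
    unfolding B_def[abs_def]
    using linear_compose[OF C1_map_linear[OF C1_map_iter[OF f] x] C1_map_linear[OF C1_map_iter[OF gi] iter_phase[OF f x]]]
    by (simp add: o_def)
  have img: "asymptotic_tangent_space g z x = B ` asymptotic_tangent_space f z x"
  proof
    show "B ` asymptotic_tangent_space f z x \<subseteq> asymptotic_tangent_space g z x"
      unfolding B_def
      by (intro image_subsetI asymptotic_tangent_space_transport[OF f g gi gi_g g_gi x z_orbit x_orbit near agree])
    show "asymptotic_tangent_space g z x \<subseteq> B ` asymptotic_tangent_space f z x"
    proof
      fix w assume "w \<in> asymptotic_tangent_space g z x"
      then have "Diter fi Dfi N ((g ^^ N) x) (Diter g Dg N x w) \<in> asymptotic_tangent_space f z x"
        by (intro asymptotic_tangent_space_transport[OF g f fi fi_f f_fi x, where r = r])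
          (use z_orbit x_orbit near agree' in \<open>simp_all only:\<close>)
      then show "w \<in> B ` asymptotic_tangent_space f z x"
        using BB'[of w] by (metis B'_def x_orbit image_eqI)
    qed
  qed
  show thesis
  proof
    show "B v \<noteq> 0"
    proof
      assume "B v = 0"
      then have "Diter f Df N x v = 0"
        using gB[of v] linear_0[OF C1_map_linear[OF C1_map_iter[OF g] x]] by metis
      then have "v = 0"
        using Diter_inverse[OF f fi fi_f x, of N v] linear_0[OF C1_map_linear[OF C1_map_iter[OF fi] iter_phase[OF f x]]]
        by metis
      then show False using v by simp
    qed
    show "asymptotic_tangent_space g z x = span {B v}"
      unfolding img v(2) using linear_span_image[OF lin, of "{v}"] by simp
    show "Diter g Dg N x (B v) = Diter f Df N x v" by (rule gB)
  qed
qed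

section \<open>Beams under an increase of all radii of curvature\<close>

text \<open>\<open>\<kappa>\<close> collects the shears at the impact points. The determinant of the perturbed against the
  unperturbed beam is a sum of terms of the same sign, so multiple visits to the perturbed arc cannot
  cancel.\<close>

fun beam_seq :: "(nat \<Rightarrow> real) \<Rightarrow> (nat \<Rightarrow> real) \<Rightarrow> real \<times> real \<Rightarrow> nat \<Rightarrow> real \<times> real" where
  "beam_seq l \<kappa> p 0 = p"
| "beam_seq l \<kappa> p (Suc k) = (let J = l k * snd (beam_seq l \<kappa> p k) - fst (beam_seq l \<kappa> p k) in
     (J, \<kappa> (Suc k) * J - snd (beam_seq l \<kappa> p k)))"

text \<open>The free flight reverses the sign of the determinant and so does the -w in the
  reflection, hence a step changes it only by the shear term. It starts at zero because both
  sequences start at \<open>p\<close>.\<close>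

lemma beam_seq_det:
  "fst (beam_seq l \<kappa>' p k) * snd (beam_seq l \<kappa> p k) - snd (beam_seq l \<kappa>' p k) * fst (beam_seq l \<kappa> p k) =
    (\<Sum>i=1..k. (\<kappa> i - \<kappa>' i) * (fst (beam_seq l \<kappa>' p i) * fst (beam_seq l \<kappa> p i)))"
  by (induction k) (simp_all add: Let_def algebra_simps)

lemma beam_seq_tendsto:
  assumes "\<And>i. ((\<lambda>e. \<kappa>' e i) \<longlongrightarrow> \<kappa> i) F"
  shows "((\<lambda>e. beam_seq l (\<kappa>' e) p k) \<longlongrightarrow> beam_seq l \<kappa> p k) F"
  by (induction k) (auto simp: Let_def intro!: tendsto_intros assms)

text \<open>Close to the unperturbed coefficients the perturbed width has the sign of the
  unperturbed one wherever the latter is nonzero, and elsewhere the term vanishes. All terms of the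
  sum in \<open>beam_seq_det\<close> are thus nonnegative, and the one at \<open>m\<close> is
  positive.\<close>

lemma beam_seq_transversal:
  assumes lim: "\<And>i. ((\<lambda>e. \<kappa>' e i) \<longlongrightarrow> \<kappa> i) F"
    and le: "\<forall>\<^sub>F e in F. \<forall>i. \<kappa>' e i \<le> \<kappa> i" and less: "\<forall>\<^sub>F e in F. \<kappa>' e m < \<kappa> m"
    and m: "1 \<le> m" "m \<le> k" "fst (beam_seq l \<kappa> p m) \<noteq> 0"
  shows "\<forall>\<^sub>F e in F. fst (beam_seq l (\<kappa>' e) p k) * snd (beam_seq l \<kappa> p k) -
    snd (beam_seq l (\<kappa>' e) p k) * fst (beam_seq l \<kappa> p k) > 0"
proof -
  let ?J = "\<lambda>i. fst (beam_seq l \<kappa> p i)" and ?J' = "\<lambda>e i. fst (beam_seq l (\<kappa>' e) p i)"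
  have "\<forall>\<^sub>F e in F. \<forall>i\<in>{1..k}. ?J i \<noteq> 0 \<longrightarrow> ?J' e i * ?J i > 0"
  proof (rule eventually_ball_finite, simp, intro ballI)
    fix i assume "i \<in> {1..k}"
    show "\<forall>\<^sub>F e in F. ?J i \<noteq> 0 \<longrightarrow> ?J' e i * ?J i > 0"
    proof (cases "?J i = 0")
      case False
      have "((\<lambda>e. ?J' e i * ?J i) \<longlongrightarrow> ?J i * ?J i) F"
        by (intro tendsto_intros beam_seq_tendsto lim)
      moreover have "?J i * ?J i > 0" using False by (metis not_real_square_gt_zero)
      ultimately show ?thesis using order_tendstoD(1) by (fastforce elim: eventually_mono)
    qed simp
  qed
  then show ?thesis using le less
  proof eventually_elim
    case (elim e)
    have "0 < (\<kappa> m - \<kappa>' e m) * (?J' e m * ?J m)"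
      using elim m by (intro mult_pos_pos[of "\<kappa> m - \<kappa>' e m"]) auto
    also have "\<dots> \<le> (\<Sum>i=1..k. (\<kappa> i - \<kappa>' e i) * (?J' e i * ?J i))"
    proof (rule member_le_sum)
      fix i assume "i \<in> {1..k} - {m}"
      then show "0 \<le> (\<kappa> i - \<kappa>' e i) * (?J' e i * ?J i)"
        using elim by (cases "?J i = 0") (auto intro!: mult_nonneg_nonneg[of "\<kappa> i - \<kappa>' e i"] intro: less_imp_le)
    qed (use m in auto)
    finally show ?case by (simp add: beam_seq_det)
  qed
qed

section \<open>Lifts\<close>

lemma cyl_shift [simp]: "cyl (x + (2 * pi * of_int j, 0)) = cyl x"
  by (simp add: cyl_def cis_mult[symmetric] cis_multiple_2pi)

lemma cis_eq_iff_int: "cis a = cis b \<longleftrightarrow> (\<exists>j::int. a = b + 2 * pi * of_int j)"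
proof
  assume "cis a = cis b"
  then have "cis (a - b) = 1" by (simp add: cis_divide[symmetric])
  then have "cos (a - b) = 1" by (simp add: complex_eq_iff)
  then obtain j :: int where "a - b = j * 2 * pi" by (auto simp: cos_one_2pi_int)
  then show "\<exists>j::int. a = b + 2 * pi * of_int j" by (intro exI[of _ j]) (simp add: algebra_simps)
qed (auto simp: cis_mult[symmetric] cis_multiple_2pi)

lemma cyl_eq_iff: "cyl a = cyl b \<longleftrightarrow> (\<exists>j::int. a = b + (2 * pi * of_int j, 0))"
  by (auto simp: cyl_def cis_eq_iff_int prod_eq_iff)

text \<open>\<open>Arg\<close> takes values in (-pi, pi], so this is the representative of
  \<open>y\<close> modulo 2 pi whose angle is nearest to that of \<zeta>.\<close>

definition lift :: "real \<times> real \<Rightarrow> real \<times> real \<Rightarrow> real \<times> real" where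
  "lift \<zeta> y = (fst \<zeta> + Arg (cis (fst y - fst \<zeta>)), snd y)"

lemma cyl_lift [simp]: "cyl (lift \<zeta> y) = cyl y"
proof -
  have "cis (fst \<zeta> + Arg (cis (fst y - fst \<zeta>))) = cis (fst \<zeta>) * cis (fst y - fst \<zeta>)"
    by (simp add: cis_mult[symmetric] cis_Arg sgn_div_norm)
  then show ?thesis by (simp add: cyl_def lift_def cis_mult)
qed

lemma lift_eq: "\<bar>fst y - fst \<zeta>\<bar> < 1 \<Longrightarrow> lift \<zeta> y = y"
  using pi_gt3 by (subst lift_def, subst Arg_cis) (auto simp: prod_eq_iff)

lemma lift_shift: obtains j :: int where "lift \<zeta> y = y + (2 * pi * of_int j, 0)"
  using cyl_eq_iff[of "lift \<zeta> y" y] by auto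

lemma dist_le_abs: "dist y \<zeta> \<le> \<bar>fst y - fst \<zeta>\<bar> + \<bar>snd y - snd \<zeta>\<bar>" for y \<zeta> :: "real \<times> real"
  by (cases y; cases \<zeta>) (simp add: dist_Pair_Pair dist_real_def sqrt_sum_squares_le_sum_abs)

lemma dist_cis_le_dist_cyl: "dist (cis (fst y)) (cis (fst \<zeta>)) \<le> dist (cyl y) (cyl \<zeta>)"
  and abs_snd_le_dist_cyl: "\<bar>snd y - snd \<zeta>\<bar> \<le> dist (cyl y) (cyl \<zeta>)"
  using dist_fst_le[of "cyl y" "cyl \<zeta>"] dist_snd_le[of "cyl y" "cyl \<zeta>"]
  by (simp_all add: cyl_def dist_real_def)

lemma lift_near:
  assumes "r > 0"
  obtains r1 where "r1 > 0" "\<And>y. dist (cyl y) (cyl \<zeta>) < r1 \<Longrightarrow> dist (lift \<zeta> y) \<zeta> < r"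
proof -
  have "isCont Arg 1" by (intro continuous_at_Arg) auto
  then obtain d where d: "d > 0" "\<And>w. dist w 1 < d \<Longrightarrow> dist (Arg w) (Arg 1) < r / 2"
    using assms unfolding continuous_at_eps_delta by (metis half_gt_zero)
  show thesis
  proof (rule that[of "min d (r / 2)"])
    fix y assume y: "dist (cyl y) (cyl \<zeta>) < min d (r / 2)"
    have "cis (fst y) - cis (fst \<zeta>) = cis (fst \<zeta>) * (cis (fst y - fst \<zeta>) - 1)"
      by (simp add: right_diff_distrib cis_mult)
    then have "dist (cis (fst y - fst \<zeta>)) 1 = dist (cis (fst y)) (cis (fst \<zeta>))"
      by (simp add: dist_norm norm_mult)
    then have "dist (cis (fst y - fst \<zeta>)) 1 < d" using y dist_cis_le_dist_cyl[of y \<zeta>] by simp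
    from d(2)[OF this] have "\<bar>Arg (cis (fst y - fst \<zeta>))\<bar> < r / 2" by (simp add: dist_real_def)
    then show "dist (lift \<zeta> y) \<zeta> < r"
      using dist_le_abs[of "lift \<zeta> y" \<zeta>] y abs_snd_le_dist_cyl[of y \<zeta>] by (simp add: lift_def)
  qed (use d assms in auto)
qed

lemma lift_tendsto:
  assumes "(\<lambda>k. dist (cyl (a k)) (cyl \<zeta>)) \<longlonglongrightarrow> 0"
  shows "(\<lambda>k. lift \<zeta> (a k)) \<longlonglongrightarrow> \<zeta>"
proof (rule metric_LIMSEQ_I)
  fix r :: real assume "r > 0"
  then obtain r1 where r1: "r1 > 0" "\<And>y. dist (cyl y) (cyl \<zeta>) < r1 \<Longrightarrow> dist (lift \<zeta> y) \<zeta> < r"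
    using lift_near by metis
  have "\<forall>\<^sub>F k in sequentially. dist (cyl (a k)) (cyl \<zeta>) < r1"
    using order_tendstoD(2)[OF assms r1(1)] .
  then show "\<exists>N. \<forall>k\<ge>N. dist (lift \<zeta> (a k)) \<zeta> < r"
    unfolding eventually_sequentially using r1(2) by blast
qed

section \<open>Expansion transversally to a stable line\<close>

text \<open>Here \<open>(a, b) \<mapsto> (a / \<mu>, c * a + \<mu> * b)\<close> is the derivative of \<open>F\<close> at the fixed point; differences in a
  thin cone around its unstable direction \<open>(0, 1)\<close> stay in the cone and grow.\<close>

lemma expanding_cone:
  fixes F :: "real \<times> real \<Rightarrow> real \<times> real"
  assumes \<mu>: "\<bar>\<mu>\<bar> > 1"
    and strict: "\<And>e. e > 0 \<Longrightarrow> \<exists>r>0. \<forall>y y'. dist y \<zeta> < r \<longrightarrow> dist y' \<zeta> < r \<longrightarrow>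
      norm (F y - F y' - (fst (y - y') / \<mu>, c * fst (y - y') + \<mu> * snd (y - y'))) \<le> e * norm (y - y')"
  obtains r \<kappa> where "r > 0" "\<kappa> > 0"
    "\<And>y y'. (\<And>i. dist ((F ^^ i) y) \<zeta> < r) \<Longrightarrow> (\<And>i. dist ((F ^^ i) y') \<zeta> < r) \<Longrightarrow>
       \<bar>fst (y - y')\<bar> \<le> \<kappa> * \<bar>snd (y - y')\<bar> \<Longrightarrow> snd y = snd y'"
proof -
  define m where "m = \<bar>\<mu>\<bar>"
  have m: "m > 1" using \<mu> by (simp add: m_def)
  \<comment> \<open>This aperture lets the off-diagonal entry \<open>c\<close> consume at most a
    quarter of the excess m - 1 of the expansion.\<close>
  define \<kappa> where "\<kappa> = min 1 ((m - 1) / (4 * (\<bar>c\<bar> + 1)))"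
  have \<kappa>: "\<kappa> > 0" "\<kappa> \<le> 1" "\<bar>c\<bar> * \<kappa> \<le> (m - 1) / 4"
  proof -
    show "\<kappa> > 0" "\<kappa> \<le> 1" using m by (auto simp: \<kappa>_def)
    have "\<bar>c\<bar> * \<kappa> \<le> (\<bar>c\<bar> + 1) * ((m - 1) / (4 * (\<bar>c\<bar> + 1)))"
      using \<open>\<kappa> > 0\<close> by (intro mult_mono) (auto simp: \<kappa>_def)
    also have "\<dots> = (m - 1) / 4" using abs_ge_zero[of c] by (simp add: field_simps)
    finally show "\<bar>c\<bar> * \<kappa> \<le> (m - 1) / 4" .
  qed
  \<comment> \<open>In the cone a difference has norm at most twice its second component. So the
    error is 2e relative to that component: at most another quarter of the excess, and small enough
    for the cone to map into itself.\<close>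
  define e where "e = min ((m - 1) / 8) (\<kappa> * (1 - 1 / m) / 2)"
  have e: "e > 0" "2 * e \<le> (m - 1) / 4" "\<kappa> / m + 2 * e \<le> \<kappa>"
  proof -
    show "e > 0" using m \<kappa> by (simp add: e_def)
    have "e \<le> (m - 1) / 8" by (simp only: e_def min.cobounded1)
    then show "2 * e \<le> (m - 1) / 4" by simp
    have "e \<le> \<kappa> * (1 - 1 / m) / 2" by (simp only: e_def min.cobounded2)
    then show "\<kappa> / m + 2 * e \<le> \<kappa>" by (simp add: algebra_simps)
  qed
  obtain r where r: "r > 0" "\<And>y y'. dist y \<zeta> < r \<Longrightarrow> dist y' \<zeta> < r \<Longrightarrow>
      norm (F y - F y' - (fst (y - y') / \<mu>, c * fst (y - y') + \<mu> * snd (y - y'))) \<le> e * norm (y - y')"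
    using strict[OF e(1)] by blast
  \<comment> \<open>The rate left over from m after two losses of (m - 1) / 4.\<close>
  define l where "l = 1 + (m - 1) / 2"
  have l: "l > 1" using m by (simp add: l_def)
  have step: "\<bar>fst (F y - F y')\<bar> \<le> \<kappa> * \<bar>snd (F y - F y')\<bar> \<and> \<bar>snd (F y - F y')\<bar> \<ge> l * \<bar>snd (y - y')\<bar>"
    if "dist y \<zeta> < r" "dist y' \<zeta> < r" and cone: "\<bar>fst (y - y')\<bar> \<le> \<kappa> * \<bar>snd (y - y')\<bar>" for y y'
  proof -
    define p s P S where "p = fst (y - y')" and "s = snd (y - y')" and "P = fst (F y - F y')" and "S = snd (F y - F y')"
    have ps: "\<bar>p\<bar> \<le> \<kappa> * \<bar>s\<bar>" using cone by (simp add: p_def s_def)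
    also have "\<dots> \<le> \<bar>s\<bar>" using \<kappa>(2) by (simp add: mult_left_le_one_le \<kappa>(1) less_imp_le)
    finally have ps1: "\<bar>p\<bar> \<le> \<bar>s\<bar>" .
    have "norm (y - y') \<le> \<bar>p\<bar> + \<bar>s\<bar>" using dist_le_abs[of y y'] by (simp add: p_def s_def dist_norm)
    then have "e * norm (y - y') \<le> e * (2 * \<bar>s\<bar>)" using e(1) ps1 by (intro mult_left_mono) auto
    then have n: "norm (F y - F y' - (p / \<mu>, c * p + \<mu> * s)) \<le> 2 * e * \<bar>s\<bar>"
      using r(2)[OF that(1,2)] by (simp add: p_def s_def)
    have "\<bar>P - p / \<mu>\<bar> \<le> 2 * e * \<bar>s\<bar>" "\<bar>S - (c * p + \<mu> * s)\<bar> \<le> 2 * e * \<bar>s\<bar>"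
      using n dist_fst_le[of "F y - F y'" "(p / \<mu>, c * p + \<mu> * s)"]
        dist_snd_le[of "F y - F y'" "(p / \<mu>, c * p + \<mu> * s)"]
      by (simp_all add: P_def S_def dist_norm)
    moreover have "\<bar>p / \<mu>\<bar> \<le> \<kappa> * \<bar>s\<bar> / m"
      using ps m by (simp add: m_def divide_right_mono)
    moreover have "\<bar>c * p\<bar> \<le> (m - 1) / 4 * \<bar>s\<bar>"
    proof -
      have "\<bar>c * p\<bar> \<le> \<bar>c\<bar> * (\<kappa> * \<bar>s\<bar>)" using ps by (simp add: abs_mult mult_left_mono)
      also have "\<dots> \<le> (m - 1) / 4 * \<bar>s\<bar>" using mult_right_mono[OF \<kappa>(3), of "\<bar>s\<bar>"] by (simp add: mult.assoc)
      finally show ?thesis .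
    qed
    moreover have "\<bar>\<mu> * s\<bar> = m * \<bar>s\<bar>" by (simp add: m_def abs_mult)
    moreover have "2 * e * \<bar>s\<bar> \<le> (m - 1) / 4 * \<bar>s\<bar>" using e(2) by (intro mult_right_mono) auto
    ultimately have P: "\<bar>P\<bar> \<le> \<kappa> * \<bar>s\<bar> / m + 2 * e * \<bar>s\<bar>"
      and S: "\<bar>S\<bar> \<ge> m * \<bar>s\<bar> - (m - 1) / 4 * \<bar>s\<bar> - (m - 1) / 4 * \<bar>s\<bar>" by linarith+
    have S': "\<bar>S\<bar> \<ge> l * \<bar>s\<bar>" using S by (simp add: l_def field_simps)
    have "\<bar>P\<bar> \<le> (\<kappa> / m + 2 * e) * \<bar>s\<bar>" using P by (simp add: algebra_simps)
    also have "\<dots> \<le> \<kappa> * \<bar>s\<bar>" using e(3) by (intro mult_right_mono) auto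
    also have "\<dots> \<le> \<kappa> * \<bar>S\<bar>"
      using \<kappa>(1) S' mult_right_mono[of 1 l "\<bar>s\<bar>"] l by (intro mult_left_mono) auto
    finally show ?thesis using S' by (simp add: P_def S_def s_def)
  qed
  show thesis
  proof (rule that[OF r(1) \<kappa>(1)])
    fix y y' assume y: "\<And>i. dist ((F ^^ i) y) \<zeta> < r" "\<And>i. dist ((F ^^ i) y') \<zeta> < r"
      and cone: "\<bar>fst (y - y')\<bar> \<le> \<kappa> * \<bar>snd (y - y')\<bar>"
    define d where "d i = (F ^^ i) y - (F ^^ i) y'" for i
    have grow: "\<bar>fst (d i)\<bar> \<le> \<kappa> * \<bar>snd (d i)\<bar> \<and> \<bar>snd (d i)\<bar> \<ge> l ^ i * \<bar>snd (d 0)\<bar>" for i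
    proof (induction i)
      case (Suc i)
      then have "\<bar>fst (d (Suc i))\<bar> \<le> \<kappa> * \<bar>snd (d (Suc i))\<bar>" "\<bar>snd (d (Suc i))\<bar> \<ge> l * \<bar>snd (d i)\<bar>"
        using step[OF y(1)[of i] y(2)[of i]] by (simp_all add: d_def)
      moreover have "l * \<bar>snd (d i)\<bar> \<ge> l * (l ^ i * \<bar>snd (d 0)\<bar>)"
        using Suc l by (intro mult_left_mono) auto
      ultimately show ?case by simp
    qed (use cone in \<open>simp add: d_def\<close>)
    have "\<bar>snd (d i)\<bar> \<le> 2 * r" for i
    proof -
      have "\<bar>snd (d i)\<bar> \<le> dist ((F ^^ i) y) ((F ^^ i) y')"
        using dist_snd_le[of "(F ^^ i) y" "(F ^^ i) y'"] by (simp add: d_def dist_real_def)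
      also have "\<dots> \<le> dist ((F ^^ i) y) \<zeta> + dist ((F ^^ i) y') \<zeta>" by (rule dist_triangle2)
      finally show ?thesis using y(1)[of i] y(2)[of i] by linarith
    qed
    then have bd: "l ^ i * \<bar>snd (d 0)\<bar> \<le> 2 * r" for i using grow[of i] by (meson order_trans)
    show "snd y = snd y'"
    proof (rule ccontr)
      assume "snd y \<noteq> snd y'"
      then have p: "\<bar>snd (d 0)\<bar> > 0" by (simp add: d_def)
      obtain i where "2 * r / \<bar>snd (d 0)\<bar> < l ^ i" using real_arch_pow[OF l] by blast
      then show False using bd[of i] p by (simp add: field_simps)
    qed
  qed
qed

lemma linear_prod_expand:
  fixes L :: "real \<times> real \<Rightarrow> 'a::real_vector"
  assumes "linear L"
  shows "L w = fst w *\<^sub>R L (1, 0) + snd w *\<^sub>R L (0, 1)"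
proof -
  have "L (fst w *\<^sub>R (1, 0) + snd w *\<^sub>R (0, 1)) = fst w *\<^sub>R L (1, 0) + snd w *\<^sub>R L (0, 1)"
    by (simp only: linear_add[OF assms] linear_scale[OF assms])
  then show ?thesis by simp
qed

text \<open>Joint continuity makes the derivative near \<zeta> uniformly close to
  \<open>D \<zeta>\<close>, as two basis vectors control the operator norm; the mean value
  inequality on a ball, which is convex, then compares arbitrary pairs of points.\<close>

lemma C1_map_strict:
  assumes f: "C1_map f D" and z: "\<zeta> \<in> phase" and "e > 0"
  shows "\<exists>r>0. \<forall>y y'. dist y \<zeta> < r \<longrightarrow> dist y' \<zeta> < r \<longrightarrow>
    norm (f y - f y' - D \<zeta> (y - y')) \<le> e * norm (y - y')"
proof -
  have c: "continuous_on (phase \<times> UNIV) (\<lambda>p. D (fst p) (snd p))"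
    using f by (simp add: C1_map_def case_prod_beta')
  have lim: "\<forall>\<^sub>F y in nhds \<zeta>. norm (D y w - D \<zeta> w) < e / 2" for w
  proof -
    have "continuous_on phase (\<lambda>y. D y w)"
    proof -
      have "continuous_on phase (\<lambda>y. (y, w))" by (intro continuous_intros)
      from continuous_on_compose2[OF c this] show ?thesis by auto
    qed
    then have "isCont (\<lambda>y. D y w) \<zeta>"
      using z open_phase by (simp add: continuous_on_eq_continuous_at)
    then have "((\<lambda>y. D y w) \<longlongrightarrow> D \<zeta> w) (nhds \<zeta>)"
      using tendsto_at_iff_tendsto_nhds[of "\<lambda>y. D y w" \<zeta>] by (simp add: continuous_at)
    then show ?thesis using tendstoD[of _ "D \<zeta> w" _ "e / 2"] \<open>e > 0\<close> by (simp add: dist_norm)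
  qed
  have "\<forall>\<^sub>F y in nhds \<zeta>. y \<in> phase \<and> norm (D y (1, 0) - D \<zeta> (1, 0)) < e / 2 \<and> norm (D y (0, 1) - D \<zeta> (0, 1)) < e / 2"
    using eventually_nhds_in_open[OF open_phase z] lim by (intro eventually_conj) auto
  then obtain r where r: "r > 0" "\<And>y. dist y \<zeta> < r \<Longrightarrow> y \<in> phase \<and> norm (D y (1, 0) - D \<zeta> (1, 0)) < e / 2 \<and>
      norm (D y (0, 1) - D \<zeta> (0, 1)) < e / 2"
    unfolding eventually_nhds_metric by blast
  have on: "onorm (D y - D \<zeta>) \<le> e" if y: "y \<in> ball \<zeta> r" for y
  proof (rule onorm_le)
    fix w :: "real \<times> real"
    note y = r(2)[of y] y
    then have "linear (D y)" "linear (D \<zeta>)" using f z by (auto intro: C1_map_linear simp: dist_commute)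
    then have "(D y - D \<zeta>) w = fst w *\<^sub>R (D y (1, 0) - D \<zeta> (1, 0)) + snd w *\<^sub>R (D y (0, 1) - D \<zeta> (0, 1))"
      using linear_prod_expand[of "D y" w] linear_prod_expand[of "D \<zeta>" w]
      by (simp add: scaleR_diff_right)
    then have "norm ((D y - D \<zeta>) w) \<le> \<bar>fst w\<bar> * norm (D y (1, 0) - D \<zeta> (1, 0)) + \<bar>snd w\<bar> * norm (D y (0, 1) - D \<zeta> (0, 1))"
      by (metis norm_scaleR norm_triangle_ineq)
    also have "\<dots> \<le> norm w * (e / 2) + norm w * (e / 2)"
      using y norm_fst_le[of "fst w" "snd w"] norm_snd_le[of "snd w" "fst w"]
      by (intro add_mono mult_mono) (auto simp: dist_commute intro: less_imp_le)
    finally show "norm ((D y - D \<zeta>) w) \<le> e * norm w" by (simp add: algebra_simps)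
  qed
  have seg: "y' + t *\<^sub>R (y - y') \<in> ball \<zeta> r"
    if "dist y \<zeta> < r" "dist y' \<zeta> < r" "t \<in> {0..1}" for y y' and t :: real
  proof -
    have "closed_segment y' y \<subseteq> ball \<zeta> r"
      using that by (intro closed_segment_subset) (auto simp: dist_commute)
    moreover have "y' + t *\<^sub>R (y - y') \<in> closed_segment y' y"
      using that by (auto simp: closed_segment_def algebra_simps intro!: exI[of _ t])
    ultimately show ?thesis by blast
  qed
  have der: "(f has_derivative D x) (at x within ball \<zeta> r)" if "x \<in> ball \<zeta> r" for x
    using C1_map_deriv[OF f, of x] r(2)[of x] that by (simp add: dist_commute has_derivative_at_withinI)
  have "norm (f y - f y' - D \<zeta> (y - y')) \<le> norm (y - y') * e" if "dist y \<zeta> < r" "dist y' \<zeta> < r" for y y'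
    by (rule differentiable_bound_linearization[OF seg[OF that] der on]) (use r(1) in auto)
  then show ?thesis using r(1) by (intro exI[of _ r]) (auto simp: mult.commute)
qed

section \<open>Non-focused impacts at non-periodic angles\<close>

lemma tendsto_0_along_multiples:
  fixes a :: "nat \<Rightarrow> real"
  assumes "a \<longlonglongrightarrow> 0" "q > 0"
  shows "(\<lambda>i. a (k + q * i)) \<longlonglongrightarrow> 0"
proof (rule LIMSEQ_subseq_LIMSEQ[OF assms(1), of "\<lambda>i. k + q * i", unfolded o_def])
  show "strict_mono (\<lambda>i. k + q * i)" using assms(2) by (intro strict_monoI) simp
qed

context angle_curve begin

lemma T_iter_shift:
  "x \<in> phase \<Longrightarrow> (T ^^ k) (x + (2 * pi * of_int j, 0)) = (T ^^ k) x + (2 * pi * of_int j, 0)"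
  by (induction k) (simp_all add: T_shift iter_phase[OF C1_map_T])

text \<open>\<open>T ^^ k\<close> commutes with the translation, whose derivative is the identity.
  Derivatives therefore depend only on the point of the cylinder.\<close>

lemma Diter_shift:
  assumes x: "x \<in> phase"
  shows "Diter T DT k (x + (2 * pi * of_int j, 0)) = Diter T DT k x"
proof -
  let ?s = "(2 * pi * of_int j, 0) :: real \<times> real"
  have "(T ^^ k has_derivative Diter T DT k (x + ?s)) (at (x + ?s))"
    using C1_map_deriv[OF C1_map_iter[OF C1_map_T], of "x + ?s" k] x by simp
  moreover have "((\<lambda>y. y + ?s) has_derivative (\<lambda>v. v)) (at x)"
    by (auto intro!: derivative_eq_intros)
  ultimately have "((\<lambda>y. (T ^^ k) (y + ?s)) has_derivative (\<lambda>v. Diter T DT k (x + ?s) v)) (at x)"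
    using has_derivative_compose[of "\<lambda>y. y + ?s" "\<lambda>v. v" x UNIV "T ^^ k" "Diter T DT k (x + ?s)"] by simp
  then have "((\<lambda>y. (T ^^ k) (y + ?s) - ?s) has_derivative (\<lambda>v. Diter T DT k (x + ?s) v)) (at x)"
    by (auto intro!: derivative_eq_intros)
  then have "(T ^^ k has_derivative (\<lambda>v. Diter T DT k (x + ?s) v)) (at x)"
    by (rule has_derivative_transform_within_open[OF _ open_phase x]) (simp add: T_iter_shift)
  then show ?thesis
    using has_derivative_unique[OF _ C1_map_deriv[OF C1_map_iter[OF C1_map_T] x]] by blast
qed

lemma Diter_cyl: "x \<in> phase \<Longrightarrow> cyl y = cyl x \<Longrightarrow> Diter T DT k y = Diter T DT k x"
  using Diter_shift[of x k] by (metis cyl_eq_iff)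

lemma cyl_iter: "x \<in> phase \<Longrightarrow> cyl y = cyl x \<Longrightarrow> cyl ((T ^^ k) y) = cyl ((T ^^ k) x)"
  by (auto simp: cyl_eq_iff T_iter_shift)

lemma phase_cyl: "x \<in> phase \<Longrightarrow> cyl y = cyl x \<Longrightarrow> y \<in> phase"
  by (auto simp: cyl_eq_iff)

lemma cyl_iter_inject:
  assumes "x \<in> phase" "y \<in> phase" "cyl ((T ^^ k) x) = cyl ((T ^^ k) y)"
  shows "cyl x = cyl y"
proof -
  obtain j :: int where "(T ^^ k) x = (T ^^ k) y + (2 * pi * of_int j, 0)"
    using assms(3) by (auto simp: cyl_eq_iff)
  then have "(T ^^ k) x = (T ^^ k) (y + (2 * pi * of_int j, 0))"
    using assms by (simp add: T_iter_shift)
  moreover have "y + (2 * pi * of_int j, 0) \<in> phase" using assms by simp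
  ultimately have "x = y + (2 * pi * of_int j, 0)"
    using iter_inverse[OF C1_map_T, of "billiard_inv \<Gamma>"] billiard_inv_inverse(1) assms by metis
  then show ?thesis by simp
qed

lemma jac_cyl: "cyl y = cyl x \<Longrightarrow> jac y = jac x"
proof -
  assume "cyl y = cyl x"
  then obtain j :: int where j: "y = x + (2 * pi * of_int j, 0)" by (auto simp: cyl_eq_iff)
  have "\<rho> (\<phi> + 2 * pi * of_int j) = \<rho> \<phi>" for \<phi>
  proof (induction j rule: int_induct[of _ 0])
    case (step1 i)
    then show ?case using per_\<rho>[of "\<phi> + 2 * pi * of_int i"] by (simp add: algebra_simps)
  next
    case (step2 i)
    then show ?case using per_\<rho>[of "\<phi> + 2 * pi * of_int i - 2 * pi"] by (simp add: algebra_simps)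
  qed simp
  then show ?thesis by (simp add: jac_def j)
qed

lemma Diter_area:
  assumes "x \<in> phase"
  shows "jac ((T ^^ k) x) * (fst (Diter T DT k x u) * snd (Diter T DT k x v) - snd (Diter T DT k x u) * fst (Diter T DT k x v)) =
    jac x * (fst u * snd v - snd u * fst v)"
  by (induction k) (simp_all add: DT_area iter_phase[OF C1_map_T assms])

text \<open>A vertical vector is a beam of zero width with changing direction; the free flight over
  a chord of positive length opens it up.\<close>

lemma twist:
  assumes "x \<in> phase" "fst v = 0" "v \<noteq> 0"
  shows "fst (DT x v) \<noteq> 0"
  using assms step_chord_pos[of x] jac_pos[OF T_phase[of x]]
  by (auto simp: DT_def Let_def prod_eq_iff)

lemma Diter_nonzero:
  assumes "x \<in> phase" "v \<noteq> 0"
  shows "Diter T DT k x v \<noteq> 0"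
proof
  assume "Diter T DT k x v = 0"
  then have "v = 0"
    using Diter_inverse[OF C1_map_T C1_map_billiard_inv billiard_inv_inverse(1) assms(1), of k v]
      linear_0[OF C1_map_linear[OF C1_map_iter[OF C1_map_billiard_inv] iter_phase[OF C1_map_T assms(1)]]] by metis
  then show False using assms(2) by simp
qed

text \<open>Two consecutive impact points determine the chord, hence the outgoing angle.\<close>

lemma cyl_eq_if_consecutive:
  assumes x: "x \<in> phase" and y: "y \<in> phase"
    and "cis (fst x) = cis (fst y)" "cis (fst (T x)) = cis (fst (T y))"
  shows "cyl x = cyl y"
proof -
  have \<Gamma>_cis: "\<Gamma> a = \<Gamma> b" if "cis a = cis b" for a b
    using that per_int by (auto simp: cis_eq_iff_int)
  have ch: "\<Gamma> (fst (T x)) - \<Gamma> (fst x) = step_chord x *\<^sub>R (cis (fst x) * cis (snd x))" if "x \<in> phase" for x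
  proof -
    have "Complex (step_chord x) 0 = of_real (step_chord x)" by (simp add: complex_eq_iff)
    then show ?thesis
      using \<Gamma>_diff[of "fst (T x)" "fst x" "fst x + snd x"] T_side[OF that]
      by (simp add: step_chord_def scaleR_conv_of_real cis_mult)
  qed
  have "step_chord x *\<^sub>R (cis (fst x) * cis (snd x)) = step_chord y *\<^sub>R (cis (fst x) * cis (snd y))"
    using ch[OF x] ch[OF y] \<Gamma>_cis assms by metis
  then have "sgn (step_chord x *\<^sub>R cis (snd x)) = sgn (step_chord y *\<^sub>R cis (snd y))"
    by (simp add: mult_scaleR_right[symmetric] del: mult_scaleR_right)
  then have "cis (snd x) = cis (snd y)"
    using step_chord_pos[OF x] step_chord_pos[OF y] by (simp add: sgn_scaleR)
  then have "cos (snd x) = cos (snd y)" by (simp add: complex_eq_iff)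
  moreover have "0 \<le> snd x" "snd x \<le> pi" "0 \<le> snd y" "snd y \<le> pi"
    using x y by (auto simp: phase_def)
  ultimately have "snd x = snd y" using cos_inj_pi by blast
  then show ?thesis using assms by (simp add: cyl_def)
qed

text \<open>Points of the finite set \<open>P\<close> have a minimal gap, so convergence eventually
  makes the n-th powers equal. The quotient of the two directions is then an n-th root of unity
  close to 1, hence 1.\<close>

lemma eventually_same_angle:
  fixes P :: "complex set"
  assumes "n > 0" "finite P" and zP: "\<And>k. cis (fst (b k)) ^ n \<in> P"
    and lim: "(\<lambda>k. dist (cyl (a k)) (cyl (b k))) \<longlonglongrightarrow> 0"
  obtains K where "\<And>k. k \<ge> K \<Longrightarrow> cis (fst (a k)) ^ n \<in> P \<Longrightarrow> cis (fst (a k)) = cis (fst (b k))"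
proof -
  have gap: "\<exists>d>0. \<forall>u\<in>S. \<forall>w\<in>S. u \<noteq> w \<longrightarrow> d < dist u w" if "finite S" for S :: "complex set"
  proof -
    have "finite ((\<lambda>(u, w). dist u w) ` {p \<in> S \<times> S. fst p \<noteq> snd p})" using that by simp
    then obtain d where "d > 0" "\<And>a. a \<in> (\<lambda>(u, w). dist u w) ` {p \<in> S \<times> S. fst p \<noteq> snd p} \<Longrightarrow> d < a"
      by (rule ex_pos_less_finite) auto
    then show ?thesis by (intro exI[of _ d]) force
  qed
  obtain d1 where d1: "d1 > 0" "\<And>u w. u \<in> P \<Longrightarrow> w \<in> P \<Longrightarrow> u \<noteq> w \<Longrightarrow> d1 < dist u w"
    using gap[OF assms(2)] by blast
  have "finite {w::complex. w ^ n = 1}" using finite_roots_unity[of n] assms(1) by simp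
  from gap[OF this] obtain d2 where d2: "d2 > 0" "\<And>w::complex. w ^ n = 1 \<Longrightarrow> w \<noteq> 1 \<Longrightarrow> d2 < dist w 1"
    by auto
  have l: "(\<lambda>k. dist (cis (fst (a k))) (cis (fst (b k)))) \<longlonglongrightarrow> 0"
    by (rule tendsto_sandwich[OF _ _ tendsto_const lim]) (auto simp: dist_cis_le_dist_cyl)
  have pow: "dist (u ^ n) (w ^ n) \<le> real n * dist u w" if "norm u = 1" "norm w = 1" for u w :: complex
    using norm_power_diff[of u w n] that by (simp add: dist_norm)
  have "\<forall>\<^sub>F k in sequentially. dist (cis (fst (a k))) (cis (fst (b k))) < min d2 (d1 / real n)"
    using order_tendstoD(2)[OF l, of "min d2 (d1 / real n)"] d1 d2 assms(1) by simp
  then obtain K where K: "\<And>k. k \<ge> K \<Longrightarrow> dist (cis (fst (a k))) (cis (fst (b k))) < min d2 (d1 / real n)"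
    unfolding eventually_sequentially by blast
  show thesis
  proof (rule that[of K])
    fix k assume k: "k \<ge> K" and inP: "cis (fst (a k)) ^ n \<in> P"
    have "dist (cis (fst (a k)) ^ n) (cis (fst (b k)) ^ n) \<le> real n * dist (cis (fst (a k))) (cis (fst (b k)))"
      by (rule pow) auto
    also have "\<dots> < d1" using K[OF k] assms(1) by (simp add: field_simps)
    finally have eq: "cis (fst (a k)) ^ n = cis (fst (b k)) ^ n"
      using d1(2)[OF inP zP[of k]] by fastforce
    define w where "w = cis (fst (a k)) / cis (fst (b k))"
    have "w ^ n = 1" using eq by (simp add: w_def power_divide)
    moreover have "dist w 1 < d2"
    proof -
      have "w - 1 = (cis (fst (a k)) - cis (fst (b k))) / cis (fst (b k))" by (simp add: w_def diff_divide_distrib)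
      then have "dist w 1 = dist (cis (fst (a k))) (cis (fst (b k)))" by (simp add: dist_norm norm_divide)
      then show ?thesis using K[OF k] by simp
    qed
    ultimately have "w = 1" using d2(2) by fastforce
    then show "cis (fst (a k)) = cis (fst (b k))" by (simp add: w_def)
  qed
qed

end

section \<open>Multipliers along the vertical fibre\<close>

lemma iter_iter: "(f ^^ m) ((f ^^ n) x) = (f ^^ (n + m)) x"
  by (simp add: add.commute[of n] funpow_add)

lemma has_vector_derivative_quotient:
  assumes "(c has_vector_derivative v) (at 0)"
  shows "((\<lambda>t. (c t - c 0) /\<^sub>R t) \<longlongrightarrow> v) (at 0)"
proof -
  have "((\<lambda>t. norm (c t - c 0 - t *\<^sub>R v) / norm t) \<longlongrightarrow> 0) (at 0)"
    using assms unfolding has_vector_derivative_def has_derivative_at by simp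
  moreover have "\<forall>\<^sub>F t in at 0. norm (c t - c 0 - t *\<^sub>R v) / norm t = norm ((c t - c 0) /\<^sub>R t - v)"
  proof -
    have "norm (c t - c 0 - t *\<^sub>R v) / norm t = norm ((c t - c 0) /\<^sub>R t - v)" if "t \<noteq> 0" for t
    proof -
      have "(c t - c 0 - t *\<^sub>R v) /\<^sub>R t = (c t - c 0) /\<^sub>R t - (t *\<^sub>R v) /\<^sub>R t" by (rule scaleR_diff_right)
      then have "(c t - c 0) /\<^sub>R t - v = (c t - c 0 - t *\<^sub>R v) /\<^sub>R t" using that by simp
      then show ?thesis by (simp add: divide_inverse mult.commute)
    qed
    then show ?thesis by (simp add: eventually_at_filter)
  qed
  ultimately have "((\<lambda>t. norm ((c t - c 0) /\<^sub>R t - v)) \<longlongrightarrow> 0) (at 0)"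
    by (rule Lim_transform_eventually)
  from tendsto_norm_zero_cancel[OF this] show ?thesis by (rule LIM_zero_cancel)
qed

text \<open>The difference quotients of \<open>F\<close> along the sequence are (0, h(i+1) / h(i))
  and converge to the image of (0, 1). A limit ratio of modulus above 1 would make |h| eventually
  increasing, against its convergence to 0.\<close>

lemma fibre_multiplier:
  assumes F: "C1_map F DF" and \<zeta>: "\<zeta> \<in> phase"
    and h: "h \<longlonglongrightarrow> 0" "\<And>i. h i \<noteq> 0"
    and step: "\<forall>\<^sub>F i in sequentially. F (\<zeta> + (0, h i)) = F \<zeta> + (0, h (Suc i))"
  shows "fst (DF \<zeta> (0, 1)) = 0" "\<bar>snd (DF \<zeta> (0, 1))\<bar> \<le> 1"
proof -
  have "((\<lambda>t. \<zeta> + (0, t)) has_vector_derivative (0, 1)) (at 0)"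
    by (auto intro!: derivative_eq_intros)
  from has_vector_derivative_C1_map[OF F _ this] \<zeta>
  have "((\<lambda>t. F (\<zeta> + (0, t))) has_vector_derivative DF \<zeta> (0, 1)) (at 0)"
    by (simp add: zero_prod_def[symmetric])
  from has_vector_derivative_quotient[OF this]
  have "((\<lambda>t. (F (\<zeta> + (0, t)) - F \<zeta>) /\<^sub>R t) \<longlongrightarrow> DF \<zeta> (0, 1)) (at 0)"
    by (simp add: zero_prod_def[symmetric])
  then have "(\<lambda>i. (F (\<zeta> + (0, h i)) - F \<zeta>) /\<^sub>R h i) \<longlonglongrightarrow> DF \<zeta> (0, 1)"
    by (rule filterlim_compose) (use h in \<open>auto simp: filterlim_at\<close>)
  then have lim: "(\<lambda>i. (0, h (Suc i) / h i)) \<longlonglongrightarrow> DF \<zeta> (0, 1)"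
    by (rule Lim_transform_eventually) (use step in \<open>auto elim!: eventually_mono simp: divide_inverse_commute\<close>)
  show "fst (DF \<zeta> (0, 1)) = 0"
    using tendsto_fst[OF lim] by (simp add: LIMSEQ_const_iff)
  have l: "(\<lambda>i. \<bar>h (Suc i) / h i\<bar>) \<longlonglongrightarrow> \<bar>snd (DF \<zeta> (0, 1))\<bar>"
    using tendsto_rabs[OF tendsto_snd[OF lim]] by simp
  show "\<bar>snd (DF \<zeta> (0, 1))\<bar> \<le> 1"
  proof (rule ccontr)
    assume "\<not> ?thesis"
    then have "\<forall>\<^sub>F i in sequentially. 1 < \<bar>h (Suc i) / h i\<bar>"
      by (intro order_tendstoD(1)[OF l]) simp
    then obtain I where I: "\<And>i. i \<ge> I \<Longrightarrow> 1 < \<bar>h (Suc i) / h i\<bar>"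
      unfolding eventually_sequentially by blast
    have "\<bar>h (I + i)\<bar> \<ge> \<bar>h I\<bar>" for i
    proof (induction i)
      case (Suc i)
      have "\<bar>h (I + i)\<bar> < \<bar>h (Suc (I + i))\<bar>"
        using I[of "I + i"] h(2)[of "I + i"] by (simp add: abs_divide field_simps)
      then show ?case using Suc by simp
    qed simp
    moreover have "(\<lambda>i. \<bar>h (I + i)\<bar>) \<longlonglongrightarrow> 0"
      using tendsto_rabs[OF LIMSEQ_ignore_initial_segment[OF h(1), of I]] by (simp add: add.commute)
    ultimately have "\<bar>h I\<bar> \<le> 0" by (intro LIMSEQ_le_const) auto
    then show False using h(2) by simp
  qed
qed

text \<open>If M M u = u, then u is an eigenvector for -1 or M u + u is one for 1; if M M u = - u,
  then u - i M u is a complex eigenvector for i. Hyperbolicity of the return map thus passes to its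
  square.\<close>

lemma hyperbolic_square_multiplier:
  assumes M: "linear M" and hyp: "\<And>\<mu>. complex_eigenvalue M \<mu> \<Longrightarrow> cmod \<mu> \<noteq> 1"
    and u: "M (M u) = \<mu> *\<^sub>R u" "u \<noteq> 0"
  shows "\<bar>\<mu>\<bar> \<noteq> 1"
proof
  assume "\<bar>\<mu>\<bar> = 1"
  then consider "\<mu> = 1" | "\<mu> = -1" by linarith
  then show False
  proof cases
    case 1
    show False
    proof (cases "M u = - u")
      case True
      then have "complex_eigenvalue M (- 1)"
        unfolding complex_eigenvalue_def using u linear_0[OF M] by (intro exI[of _ u] exI[of _ 0]) auto
      then show False using hyp by fastforce
    next
      case False
      then have "M u + u \<noteq> 0" by (simp add: eq_neg_iff_add_eq_0)
      moreover have "M (M u + u) = M u + u" using u 1 linear_add[OF M] by (simp add: add.commute)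
      ultimately have "complex_eigenvalue M 1"
        unfolding complex_eigenvalue_def using linear_0[OF M] by (intro exI[of _ "M u + u"] exI[of _ 0]) auto
      then show False using hyp by fastforce
    qed
  next
    case 2
    have "complex_eigenvalue M \<i>"
      unfolding complex_eigenvalue_def using u 2 linear_neg[OF M]
      by (intro exI[of _ u] exI[of _ "- M u"]) auto
    then show False using hyp by fastforce
  qed
qed

context angle_curve begin

lemma cyl_periodic:
  assumes "z \<in> phase" "cyl ((T ^^ q) z) = cyl z"
  shows "cyl ((T ^^ (k + q * i)) z) = cyl ((T ^^ k) z)"
proof (induction i)
  case (Suc i)
  have "cyl ((T ^^ (k + q * i + q)) z) = cyl ((T ^^ (k + q * i)) z)"
    using cyl_iter[OF assms, of "k + q * i"] by (simp add: funpow_add)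
  then show ?case using Suc by (simp add: algebra_simps)
qed simp

text \<open>The derivative of \<open>T ^^ k\<close> conjugates the doubled return map at
  \<open>z\<close> to the one at the k-th point of the orbit, so multipliers are the same along the
  orbit.\<close>

lemma double_period_multiplier:
  assumes z: "z \<in> phase" and q: "cyl ((T ^^ q) z) = cyl z"
    and hyp: "\<And>\<mu>. complex_eigenvalue (Diter T DT q z) \<mu> \<Longrightarrow> cmod \<mu> \<noteq> 1"
    and u: "Diter T DT (2 * q) ((T ^^ k) z) u = \<mu> *\<^sub>R u" "u \<noteq> 0"
  shows "\<bar>\<mu>\<bar> \<noteq> 1"
proof -
  let ?zk = "(T ^^ k) z" and ?M = "Diter T DT q z"
  note Tm = C1_map_T C1_map_billiard_inv
  define B where "B = Diter (billiard_inv \<Gamma>) DTi k ?zk"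
  have zk: "?zk \<in> phase" by (rule iter_phase[OF C1_map_T z])
  have linB: "linear B" unfolding B_def by (rule C1_map_linear[OF C1_map_iter[OF Tm(2)] zk])
  have inv2: "B (Diter T DT k z w) = w" for w
    unfolding B_def by (rule Diter_inverse[OF Tm billiard_inv_inverse(1) z])
  have inv1: "Diter T DT k z (B w) = w" for w
    unfolding B_def using Diter_inverse[OF Tm(2,1) billiard_inv_inverse(2) zk, of k w]
      iter_inverse[OF C1_map_T billiard_inv_inverse(1) z, of k] by simp
  have q2: "cyl ((T ^^ (2 * q)) z) = cyl z"
    using cyl_periodic[OF z q, of 0 2] by (simp add: mult.commute)
  have "Diter T DT k z (Diter T DT (2 * q) z (B u)) = Diter T DT (2 * q) ?zk (Diter T DT k z (B u))"
    using Diter_add[of T DT k "2 * q" z "B u"] Diter_add[of T DT "2 * q" k z "B u"] Diter_cyl[OF z q2, of k]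
    by (simp add: add.commute)
  also have "\<dots> = \<mu> *\<^sub>R u" using u inv1 by simp
  finally have "Diter T DT (2 * q) z (B u) = \<mu> *\<^sub>R B u"
    using inv2 linear_scale[OF linB] by metis
  moreover have "Diter T DT (2 * q) z (B u) = ?M (?M (B u))"
    using Diter_add[of T DT q q z "B u"] Diter_cyl[OF z q, of q] by (simp add: mult_2)
  ultimately have "?M (?M (B u)) = \<mu> *\<^sub>R B u" by simp
  moreover have "B u \<noteq> 0" using inv1[of u] u(2) linear_0[OF C1_map_linear[OF C1_map_iter[OF C1_map_T] z]] by metis
  ultimately show ?thesis
    using hyperbolic_square_multiplier[OF C1_map_linear[OF C1_map_iter[OF C1_map_T] z] hyp] by blast
qed

text \<open>Orbit points lying exactly over the angle of \<open>z\<close> lift to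
  \<open>z + (0, h i)\<close>, so along this sequence \<open>T ^^ q\<close> acts inside the fibre
  and \<open>fibre_multiplier\<close> applies.\<close>

lemma contracting_fibre:
  assumes z: "z \<in> phase" and q: "q > 0" "cyl ((T ^^ q) z) = cyl z"
    and a: "\<And>i. a i \<in> phase" "\<And>i. a (Suc i) = (T ^^ q) (a i)" "\<And>i. cis (fst (a i)) = cis (fst z)"
      "\<And>i. cyl (a i) \<noteq> cyl z" "(\<lambda>i. dist (cyl (a i)) (cyl z)) \<longlonglongrightarrow> 0"
  shows "fst (Diter T DT q z (0, 1)) = 0" "\<bar>snd (Diter T DT q z (0, 1))\<bar> \<le> 1"
proof -
  define h where "h i = snd (a i) - snd z" for i
  define y where "y i = z + (0, h i)" for i
  have cy: "cyl (y i) = cyl (a i)" for i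
    using a(3) by (simp add: cyl_def y_def h_def)
  have yph: "y i \<in> phase" for i using phase_cyl[OF a(1) cy] .
  have h0: "h i \<noteq> 0" for i
    using a(3,4)[of i] by (auto simp: h_def cyl_def)
  have hl: "h \<longlonglongrightarrow> 0"
    by (rule Lim_null_comparison[OF _ a(5)]) (simp add: h_def abs_snd_le_dist_cyl)
  have yl: "y \<longlonglongrightarrow> z"
  proof -
    have "(\<lambda>i. z + (0, h i)) \<longlonglongrightarrow> z + (0, 0)" by (intro tendsto_intros hl)
    then show ?thesis by (simp add: y_def[abs_def] zero_prod_def[symmetric])
  qed
  obtain j :: int where j: "(T ^^ q) z = z + (2 * pi * of_int j, 0)" using q(2) by (auto simp: cyl_eq_iff)
  have "(\<lambda>i. (T ^^ q) (y i)) \<longlonglongrightarrow> (T ^^ q) z"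
    using has_derivative_continuous[OF C1_map_deriv[OF C1_map_iter[OF C1_map_T] z]] yl
    by (rule isCont_tendsto_compose)
  then have yd: "(\<lambda>i. (T ^^ q) (y i) - y (Suc i)) \<longlonglongrightarrow> (2 * pi * of_int j, 0)"
    using tendsto_diff[OF _ LIMSEQ_Suc[OF yl], of "\<lambda>i. (T ^^ q) (y i)" "(T ^^ q) z"] j by simp
  \<comment> \<open>The image of a lift and the next lift differ by an integer multiple of 2 pi;
    convergence makes this integer equal to the one of the periodic point.\<close>
  have "\<forall>\<^sub>F i in sequentially. dist (fst ((T ^^ q) (y i) - y (Suc i))) (2 * pi * of_int j) < 1"
    using tendstoD[OF tendsto_fst[OF yd], of 1] by simp
  then have "\<forall>\<^sub>F i in sequentially. (T ^^ q) (z + (0, h i)) = (T ^^ q) z + (0, h (Suc i))"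
  proof eventually_elim
    case (elim i)
    have "cyl ((T ^^ q) (y i)) = cyl (y (Suc i))"
      using cyl_iter[OF a(1) cy, of q i] by (simp add: cy a(2))
    then obtain j' :: int where j': "(T ^^ q) (y i) = y (Suc i) + (2 * pi * of_int j', 0)"
      by (auto simp: cyl_eq_iff)
    have "2 * pi * \<bar>real_of_int (j' - j)\<bar> < 1"
      using elim by (simp add: j' dist_real_def right_diff_distrib[symmetric] abs_mult)
    moreover have "2 * pi * 1 \<le> 2 * pi * \<bar>real_of_int (j' - j)\<bar>" if "j' \<noteq> j"
      using that by (intro mult_left_mono) auto
    moreover have "\<not> 2 * pi * 1 < (1::real)" using pi_gt3 by simp
    ultimately have "j' = j" by (meson order_le_less_trans)
    then show ?case using j j' by (simp add: y_def)
  qed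
  from fibre_multiplier[OF C1_map_iter[OF C1_map_T] z hl h0 this]
  show "fst (Diter T DT q z (0, 1)) = 0" "\<bar>snd (Diter T DT q z (0, 1))\<bar> \<le> 1" by auto
qed

text \<open>If the tangent vector were vertical at every impact at a non-periodic angle, then, by the twist property,
  late impacts alternate between such impacts and impacts at exactly the angle of the periodic orbit. The
  latter make the vertical direction at every other periodic point an eigenvector, contracted because they
  converge along the fibre. Area preservation and the twist make the vertical direction expanding at the
  remaining periodic points, and there it is tangent to the stable manifold.\<close>

lemma exists_nonfocused_impact:
  fixes P :: "complex set"
  assumes n: "n > 0" and x: "x \<in> phase" and z: "z \<in> phase"
    and q: "q > 0" "cyl ((T ^^ q) z) = cyl z"
    and hyp: "\<And>\<mu>. complex_eigenvalue (Diter T DT q z) \<mu> \<Longrightarrow> cmod \<mu> \<noteq> 1"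
    and lim: "(\<lambda>k. dist (cyl ((T ^^ k) x)) (cyl ((T ^^ k) z))) \<longlonglongrightarrow> 0"
    and ne: "cyl x \<noteq> cyl z"
    and P: "finite P" "\<And>k. cis (fst ((T ^^ k) z)) ^ n \<in> P"
    and v: "v \<noteq> 0" "v \<in> asymptotic_tangent_space T z x"
  obtains m where "cis (fst ((T ^^ m) x)) ^ n \<notin> P" "fst (Diter T DT m x v) \<noteq> 0"
proof (rule ccontr)
  assume "\<not> thesis"
  then have nob: "cis (fst ((T ^^ m) x)) ^ n \<notin> P \<Longrightarrow> fst (Diter T DT m x v) \<noteq> 0 \<Longrightarrow> False" for m
    using that by blast
  define X Z V where "X k = (T ^^ k) x" and "Z k = (T ^^ k) z" and "V k = Diter T DT k x v" for k
  have bad: "fst (V m) = 0" if "cis (fst (X m)) ^ n \<notin> P" for m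
    using nob[of m] that unfolding X_def V_def by blast
  have X_phase: "X k \<in> phase" and Z_phase: "Z k \<in> phase" and V0: "V k \<noteq> 0" for k
    unfolding X_def Z_def V_def using iter_phase[OF C1_map_T] Diter_nonzero x z v by auto
  have lim': "(\<lambda>k. dist (cyl (X k)) (cyl (Z k))) \<longlonglongrightarrow> 0" using lim by (simp add: X_def Z_def)
  have XZ: "cyl (X k) \<noteq> cyl (Z k)" for k
    unfolding X_def Z_def using cyl_iter_inject[OF x z] ne by blast
  obtain K where K: "\<And>k. k \<ge> K \<Longrightarrow> cis (fst (X k)) ^ n \<in> P \<Longrightarrow> cis (fst (X k)) = cis (fst (Z k))"
    using eventually_same_angle[OF n P(1) _ lim'] P(2) unfolding Z_def by metis
  \<comment> \<open>Two consecutive impacts off \<open>P\<close> would both carry a vertical vector,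
    which the twist forbids.\<close>
  have to_per: "cis (fst (X (Suc k))) ^ n \<in> P" if "cis (fst (X k)) ^ n \<notin> P" for k
  proof (rule ccontr)
    assume "cis (fst (X (Suc k))) ^ n \<notin> P"
    then have "fst (V (Suc k)) = 0" by (rule bad)
    moreover have "V (Suc k) = DT (X k) (V k)" by (simp add: V_def X_def)
    ultimately show False using twist[OF X_phase bad[OF that] V0] by simp
  qed
  \<comment> \<open>Two consecutive late impacts on \<open>P\<close> would share a chord with the
    periodic orbit, and \<open>x\<close> would lie on that orbit.\<close>
  have from_per: "cis (fst (X (Suc k))) ^ n \<notin> P" if "k \<ge> K" "cis (fst (X k)) ^ n \<in> P" for k
  proof
    assume "cis (fst (X (Suc k))) ^ n \<in> P"
    then have "cis (fst (T (X k))) = cis (fst (T (Z k)))"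
      using K[of "Suc k"] that by (simp add: X_def Z_def)
    then show False using cyl_eq_if_consecutive[OF X_phase Z_phase K[OF that]] XZ by blast
  qed
  obtain k0 where k0: "k0 \<ge> K" "cis (fst (X k0)) ^ n \<notin> P"
    using from_per[of K] by (metis le_Suc_eq order_refl)
  have nonper: "cis (fst (X (k0 + 2 * i))) ^ n \<notin> P" for i
  proof (induction i)
    case (Suc i)
    then show ?case using from_per[of "Suc (k0 + 2 * i)"] to_per[of "k0 + 2 * i"] k0 by simp
  qed (use k0 in simp)
  have vert: "fst (V (k0 + 2 * i)) = 0" for i using bad[OF nonper] .
  have same: "cis (fst (X (Suc k0 + 2 * i))) = cis (fst (Z (Suc k0 + 2 * i)))" for i
    using K[of "Suc k0 + 2 * i"] to_per[OF nonper[of i]] k0 by simp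
  \<comment> \<open>The alternation has period 2 and \<open>q\<close> may be odd; twice the period
    respects both.\<close>
  define Q where "Q = 2 * q"
  have Q: "Q > 0" using q by (simp add: Q_def)
  have Zper: "cyl (Z (k + Q * i)) = cyl (Z k)" for k i
    unfolding Z_def Q_def using cyl_periodic[OF z q(2), of k "2 * i"] by (simp add: mult.assoc mult.left_commute)
  have ZQ: "cyl ((T ^^ Q) (Z k)) = cyl (Z k)" for k
    using Zper[of k 1] by (simp add: Z_def iter_iter)
  have XQ: "(T ^^ Q) (X k) = X (k + Q)" for k
    by (simp add: X_def iter_iter)
  define D where "D = Diter T DT Q"
  have limQ: "(\<lambda>i. dist (cyl (X (k + Q * i))) (cyl (Z k))) \<longlonglongrightarrow> 0" for k
    using tendsto_0_along_multiples[OF lim' Q, of k] by (simp add: Zper)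
  define \<zeta> \<zeta>1 where "\<zeta> = Z k0" and "\<zeta>1 = Z (Suc k0)"
  have \<zeta>: "\<zeta> \<in> phase" "\<zeta>1 \<in> phase" "\<zeta>1 = T \<zeta>" by (simp_all add: \<zeta>_def \<zeta>1_def Z_phase) (simp add: Z_def)
  have \<zeta>Q: "cyl ((T ^^ Q) \<zeta>) = cyl \<zeta>" "cyl ((T ^^ Q) \<zeta>1) = cyl \<zeta>1" unfolding \<zeta>_def \<zeta>1_def by (rule ZQ)+
  have linD: "linear (D y)" if "y \<in> phase" for y
    unfolding D_def using C1_map_linear[OF C1_map_iter[OF C1_map_T] that] .
  note fibre = contracting_fibre[OF \<zeta>(2) Q \<zeta>Q(2), of "\<lambda>i. X (Suc k0 + Q * i)", folded D_def]
  have fib: "fst (D \<zeta>1 (0, 1)) = 0" "\<bar>snd (D \<zeta>1 (0, 1))\<bar> \<le> 1"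
  proof -
    have c: "cis (fst (X (Suc k0 + Q * i))) = cis (fst \<zeta>1)" for i
    proof -
      have "cis (fst (Z (Suc k0 + Q * i))) = cis (fst \<zeta>1)"
        using Zper[of "Suc k0" i] by (simp add: \<zeta>1_def cyl_def)
      then show ?thesis using same[of "q * i"] by (simp add: Q_def mult.assoc)
    qed
    have ne: "cyl (X (Suc k0 + Q * i)) \<noteq> cyl \<zeta>1" for i
      using XZ[of "Suc k0 + Q * i"] Zper[of "Suc k0" i] by (simp add: \<zeta>1_def)
    have st: "X (Suc k0 + Q * Suc i) = (T ^^ Q) (X (Suc k0 + Q * i))" for i
      by (simp add: XQ algebra_simps)
    show "fst (D \<zeta>1 (0, 1)) = 0" "\<bar>snd (D \<zeta>1 (0, 1))\<bar> \<le> 1"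
      using fibre[OF X_phase st c ne] limQ[of "Suc k0"] by (simp_all add: \<zeta>1_def)
  qed
  define \<mu>1 where "\<mu>1 = snd (D \<zeta>1 (0, 1))"
  have D1: "D \<zeta>1 (0, 1) = (0, \<mu>1)" using fib by (simp add: \<mu>1_def prod_eq_iff)
  have "\<bar>\<mu>1\<bar> \<noteq> 1"
    using double_period_multiplier[OF z q(2) hyp, of "Suc k0" "(0, 1)" \<mu>1] D1
    by (simp add: D_def Q_def \<zeta>1_def Z_def zero_prod_def)
  then have \<mu>1: "\<bar>\<mu>1\<bar> < 1" using fib by (simp add: \<mu>1_def)
  \<comment> \<open>Along the orbit of \<open>x\<close> the derivative of \<open>T ^^ Q\<close> maps
    vertical vectors to vertical ones; lifting near \<zeta> and passing to the limit gives the same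
    at \<zeta>.\<close>
  have "fst (D \<zeta> (0, 1)) = 0"
  proof -
    have "fst (D (X (k0 + Q * i)) (0, 1)) = 0" for i
    proof -
      have "V (k0 + Q * Suc i) = D (X (k0 + Q * i)) (V (k0 + Q * i))"
        using Diter_add[of T DT Q "k0 + Q * i" x v] by (simp add: V_def D_def X_def algebra_simps)
      moreover have "fst (V (k0 + Q * i)) = 0" for i using vert[of "q * i"] by (simp add: Q_def mult.assoc)
      moreover from this have w: "V (k0 + Q * i) = snd (V (k0 + Q * i)) *\<^sub>R (0, 1)" "snd (V (k0 + Q * i)) \<noteq> 0"
        using V0[of "k0 + Q * i"] by (auto simp: prod_eq_iff)
      ultimately have "fst (snd (V (k0 + Q * i)) *\<^sub>R D (X (k0 + Q * i)) (0, 1)) = 0"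
        using linear_scale[OF linD[OF X_phase]] by metis
      then show ?thesis using w(2) by simp
    qed
    then have f0: "fst (D (lift \<zeta> (X (k0 + Q * i))) (0, 1)) = 0" for i
      unfolding D_def using Diter_cyl[OF X_phase cyl_lift] by simp
    have "(\<lambda>i. D (lift \<zeta> (X (k0 + Q * i))) (0, 1)) \<longlonglongrightarrow> D \<zeta> (0, 1)"
    proof -
      have c: "continuous_on (phase \<times> UNIV) (\<lambda>p. D (fst p) (snd p))"
        using C1_map_iter[OF C1_map_T, of Q] by (simp add: C1_map_def case_prod_beta' D_def)
      have "continuous_on phase (\<lambda>y. (y, (0, 1) :: real \<times> real))" by (intro continuous_intros)
      from continuous_on_compose2[OF c this] have "continuous_on phase (\<lambda>y. D y (0, 1))" by auto
      then have "isCont (\<lambda>y. D y (0, 1)) \<zeta>" using \<zeta>(1) open_phase by (simp add: continuous_on_eq_continuous_at)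
      then show ?thesis
        using lift_tendsto[of "\<lambda>i. X (k0 + Q * i)" \<zeta>] limQ[of k0] isCont_tendsto_compose by (fastforce simp: \<zeta>_def)
    qed
    from tendsto_fst[OF this] show ?thesis by (simp add: f0 LIMSEQ_const_iff)
  qed
  then obtain \<mu> where D0: "D \<zeta> (0, 1) = (0, \<mu>)" by (metis prod.collapse)
  define f where "f = DT \<zeta> (0, 1)"
  have f: "fst f \<noteq> 0" unfolding f_def by (rule twist[OF \<zeta>(1)]) (auto simp: zero_prod_def)
  have "D \<zeta>1 f = \<mu> *\<^sub>R f"
  proof -
    have "D \<zeta>1 f = DT ((T ^^ Q) \<zeta>) (D \<zeta> (0, 1))"
      using Diter_add[of T DT Q 1 \<zeta> "(0, 1)"] Diter_add[of T DT 1 Q \<zeta> "(0, 1)"]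
      by (simp add: D_def f_def \<zeta>(3))
    also have "DT ((T ^^ Q) \<zeta>) = DT \<zeta>"
      using Diter_cyl[OF \<zeta>(1) \<zeta>Q(1), of 1] by (simp add: fun_eq_iff)
    also have "DT \<zeta> (D \<zeta> (0, 1)) = DT \<zeta> (\<mu> *\<^sub>R (0, 1))" by (simp add: D0)
    also have "\<dots> = \<mu> *\<^sub>R f" unfolding f_def by (rule linear_scale[OF C1_map_linear[OF C1_map_T \<zeta>(1)]])
    finally show ?thesis .
  qed
  \<comment> \<open>Both \<open>f\<close>, the image of the vertical vector at \<zeta>, and the
    vertical vector at \<open>\<zeta>1\<close> are eigenvectors there. They are independent by the
    twist, so area preservation makes the product of their multipliers 1.\<close>
  then have "fst f * (\<mu> * \<mu>1 - 1) = 0"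
    using Diter_area[OF \<zeta>(2), of Q f "(0, 1)", folded D_def] jac_cyl[OF \<zeta>Q(2)] jac_pos[OF \<zeta>(2)]
    by (simp add: D1 algebra_simps)
  then have "\<mu> * \<mu>1 = 1" using f by simp
  then have \<mu>\<mu>1: "\<bar>\<mu>\<bar> * \<bar>\<mu>1\<bar> = 1" "\<mu> \<noteq> 0" by (auto simp: abs_mult[symmetric])
  have "\<bar>\<mu>\<bar> > 1"
  proof (rule ccontr)
    assume "\<not> \<bar>\<mu>\<bar> > 1"
    then have "\<bar>\<mu>\<bar> * \<bar>\<mu>1\<bar> \<le> 1 * \<bar>\<mu>1\<bar>" by (intro mult_right_mono) auto
    then show False using \<mu>\<mu>1 \<mu>1 by simp
  qed
  note \<mu> = this \<mu>\<mu>1(2)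
  define c where "c = snd (D \<zeta> (1, 0))"
  have Dform: "D \<zeta> u = (fst u / \<mu>, c * fst u + \<mu> * snd u)" for u
  proof -
    have "fst (D \<zeta> u) * \<mu> = fst u"
      using Diter_area[OF \<zeta>(1), of Q u "(0, 1)", folded D_def] jac_cyl[OF \<zeta>Q(1)] jac_pos[OF \<zeta>(1)]
      by (simp add: D0)
    moreover have "snd (D \<zeta> u) = c * fst u + \<mu> * snd u"
      using linear_prod_expand[OF linD[OF \<zeta>(1)], of u] by (simp add: D0 c_def)
    ultimately show ?thesis using \<mu> by (simp add: prod_eq_iff field_simps)
  qed
  obtain j :: int where j: "(T ^^ Q) \<zeta> = \<zeta> + (2 * pi * of_int j, 0)" using \<zeta>Q(1) by (auto simp: cyl_eq_iff)
  \<comment> \<open>The lift of \<open>T ^^ Q\<close> that fixes \<zeta>.\<close>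
  define F where "F = (\<lambda>y. (T ^^ Q) y - (2 * pi * of_int j, 0))"
  have F: "F w = (T ^^ Q) w - (2 * pi * of_int j, 0)" for w by (simp add: F_def)
  have strict: "\<exists>r>0. \<forall>y y'. dist y \<zeta> < r \<longrightarrow> dist y' \<zeta> < r \<longrightarrow>
      norm (F y - F y' - (fst (y - y') / \<mu>, c * fst (y - y') + \<mu> * snd (y - y'))) \<le> e * norm (y - y')" if "e > 0" for e
    using C1_map_strict[OF C1_map_iter[OF C1_map_T] \<zeta>(1) that, of Q, folded D_def] by (simp add: Dform F_def)
  obtain r \<kappa> where r: "r > 0" "\<kappa> > 0" and
    cone: "\<And>y y'. (\<And>i. dist ((F ^^ i) y) \<zeta> < r) \<Longrightarrow> (\<And>i. dist ((F ^^ i) y') \<zeta> < r) \<Longrightarrow>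
       \<bar>fst (y - y')\<bar> \<le> \<kappa> * \<bar>snd (y - y')\<bar> \<Longrightarrow> snd y = snd y'"
    by (rule expanding_cone[OF \<mu>(1) strict]) (blast intro: that)+
  have "isCont F \<zeta>"
    unfolding F_def
    by (intro continuous_intros has_derivative_continuous[OF C1_map_deriv[OF C1_map_iter[OF C1_map_T] \<zeta>(1)]])
  moreover have "F \<zeta> = \<zeta>" by (simp add: F_def j)
  \<comment> \<open>Images at distance below 1 from \<zeta> are their own nearest lifts, so
    closeness on the cylinder yields closeness in the cover at every step.\<close>
  ultimately obtain r' where r': "r' > 0" "\<And>y. dist y \<zeta> < r' \<Longrightarrow> dist (F y) \<zeta> < 1"
    unfolding continuous_at_eps_delta by (metis zero_less_one)
  obtain r1 where r1: "r1 > 0" "\<And>y. dist (cyl y) (cyl \<zeta>) < r1 \<Longrightarrow> dist (lift \<zeta> y) \<zeta> < min r r'"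
    using lift_near[of "min r r'"] r r' by (metis min_less_iff_conj)
  have cylF: "cyl ((F ^^ i) y) = cyl ((T ^^ (Q * i)) y) \<and> (F ^^ i) y \<in> phase" if "y \<in> phase" for y i
  proof (induction i)
    case (Suc i)
    have "cyl ((F ^^ Suc i) y) = cyl ((T ^^ Q) ((F ^^ i) y))"
      using cyl_shift[of "(T ^^ Q) ((F ^^ i) y) - (2 * pi * of_int j, 0)" j] by (simp add: F)
    also have "\<dots> = cyl ((T ^^ Q) ((T ^^ (Q * i)) y))"
      using Suc cyl_iter[OF iter_phase[OF C1_map_T that]] by blast
    also have "\<dots> = cyl ((T ^^ (Q * Suc i)) y)"
      by (simp only: iter_iter mult_Suc_right add.commute)
    finally have 1: "cyl ((F ^^ Suc i) y) = cyl ((T ^^ (Q * Suc i)) y)" .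
    have "(T ^^ Q) ((F ^^ i) y) \<in> phase" using Suc iter_phase[OF C1_map_T] by blast
    then have "F ((F ^^ i) y) \<in> phase" unfolding F[of "(F ^^ i) y"] by (simp only: shift_phase)
    then show ?case using 1 by simp
  qed (use that in simp)
  have stay: "dist ((F ^^ i) y) \<zeta> < min r r'"
    if "dist y \<zeta> < min r r'" "\<And>i. dist (cyl ((F ^^ i) y)) (cyl \<zeta>) < r1" for y i
  proof (induction i)
    case (Suc i)
    then have "dist ((F ^^ Suc i) y) \<zeta> < 1" using r'(2)[of "(F ^^ i) y"] by simp
    then have "\<bar>fst ((F ^^ Suc i) y) - fst \<zeta>\<bar> < 1"
      using dist_fst_le[of "(F ^^ Suc i) y" \<zeta>] by (simp add: dist_real_def)
    from lift_eq[OF this] show ?case using r1(2)[OF that(2)[of "Suc i"]] by simp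
  qed (use that in simp)
  obtain a where a: "asymptotic_arc T z a" "a 0 = x" "(a has_vector_derivative v) (at 0)"
    using v(2) by (auto simp: asymptotic_tangent_space_def)
  have a_phase: "\<And>t. t \<in> {-1<..<1} \<Longrightarrow> a t \<in> phase"
    and ul: "uniform_limit {-1<..<1} (\<lambda>k t. dist (cyl ((T ^^ k) (a t))) (cyl ((T ^^ k) z))) (\<lambda>_. 0) sequentially"
    using a(1) unfolding asymptotic_arc_def asymptotic_set_def image_subset_iff by blast+
  obtain K2 where K2: "\<And>k t. k \<ge> K2 \<Longrightarrow> t \<in> {-1<..<1} \<Longrightarrow> dist (cyl ((T ^^ k) (a t))) (cyl (Z k)) < r1"
    using uniform_limitD[OF ul r1(1)] unfolding eventually_sequentially dist_real_def Z_def
    by (simp only: diff_0_right abs_of_nonneg zero_le_dist) blast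
  define k1 where "k1 = k0 + Q * K2"
  have k1: "k1 \<ge> K2" using Q by (simp add: k1_def trans_le_add2)
  obtain J :: int where J: "lift \<zeta> (X k1) = X k1 + (2 * pi * of_int J, 0)" using lift_shift by blast
  define y where "y t = (T ^^ k1) (a t) + (2 * pi * of_int J, 0)" for t
  have y_phase: "y t \<in> phase" if "t \<in> {-1<..<1}" for t
    using iter_phase[OF C1_map_T a_phase[OF that]] by (simp add: y_def)
  have y_near: "dist (cyl ((F ^^ i) (y t))) (cyl \<zeta>) < r1" if t: "t \<in> {-1<..<1}" for t i
  proof -
    have "cyl ((F ^^ i) (y t)) = cyl ((T ^^ (Q * i)) ((T ^^ k1) (a t)))"
      using cylF[OF y_phase[OF t], of i] cyl_iter[OF iter_phase[OF C1_map_T a_phase[OF t]], of "y t" k1 "Q * i"]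
      by (simp add: y_def)
    also have "\<dots> = cyl ((T ^^ (k1 + Q * i)) (a t))" by (simp add: iter_iter)
    finally show ?thesis
      using K2[of "k1 + Q * i" t] k1 t Zper[of k0 "K2 + i"] by (simp add: k1_def \<zeta>_def algebra_simps)
  qed
  have y0: "y 0 = lift \<zeta> (X k1)" unfolding J by (simp add: y_def a(2) X_def)
  then have y0_near: "dist (y 0) \<zeta> < min r r'"
    using r1(2)[of "X k1"] y_near[of 0 0] cyl_lift[of \<zeta> "X k1"] by simp
  have y': "(y has_vector_derivative V k1) (at 0)"
    unfolding y_def V_def
    using has_vector_derivative_C1_map[OF C1_map_iter[OF C1_map_T] _ a(3), of k1] x a(2)
    by (auto intro!: derivative_eq_intros)
  have "fst (V k1) = 0" using vert[of "q * K2"] by (simp add: k1_def Q_def mult.assoc)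
  then have sV: "snd (V k1) \<noteq> 0" using V0[of k1] by (auto simp: prod_eq_iff)
  \<comment> \<open>Difference quotients of the arc at 0 tend to a vertical vector and so enter the
    cone. Both points stay near \<zeta> forever, so \<open>cone\<close> equates their second
    components, which contradicts strict membership in the cone.\<close>
  have "((\<lambda>t. \<kappa> * \<bar>snd ((y t - y 0) /\<^sub>R t)\<bar> - \<bar>fst ((y t - y 0) /\<^sub>R t)\<bar>) \<longlongrightarrow> \<kappa> * \<bar>snd (V k1)\<bar> - \<bar>fst (V k1)\<bar>) (at 0)"
    by (intro tendsto_intros has_vector_derivative_quotient y')
  then have "\<forall>\<^sub>F t in at 0. \<kappa> * \<bar>snd ((y t - y 0) /\<^sub>R t)\<bar> - \<bar>fst ((y t - y 0) /\<^sub>R t)\<bar> > 0"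
    by (rule order_tendstoD(1)) (use r(2) sV \<open>fst (V k1) = 0\<close> in simp)
  moreover have "\<forall>\<^sub>F t in at 0. dist (y t) \<zeta> < min r r'"
  proof -
    have "((\<lambda>t. dist (y t) \<zeta>) \<longlongrightarrow> dist (y 0) \<zeta>) (at 0)"
      using has_vector_derivative_continuous[OF y'] by (intro tendsto_intros) (simp add: continuous_at)
    then show ?thesis by (rule order_tendstoD(2)) (rule y0_near)
  qed
  moreover have "\<forall>\<^sub>F t in at 0. t \<in> {-1<..<1::real}"
    by (rule eventually_at_in_open') auto
  moreover have "\<forall>\<^sub>F t in at (0::real). t \<noteq> 0" by (simp add: eventually_at_filter)
  ultimately have "\<forall>\<^sub>F t in at (0::real). False"
  proof eventually_elim
    case (elim t)
    have "\<bar>fst (y t - y 0)\<bar> < \<kappa> * \<bar>snd (y t - y 0)\<bar>"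
      using elim(1,4) by (simp add: abs_mult mult.left_commute[of \<kappa>])
    moreover from this have "snd (y t) = snd (y 0)"
      using stay[OF elim(2) y_near[OF elim(3)]] stay[OF y0_near y_near[of 0]] by (intro cone) auto
    ultimately show False by simp
  qed
  then show False by simp
qed

end

section \<open>Comparison of two ovals\<close>

locale angle_curve_pair = G: angle_curve \<Gamma> \<rho> + G': angle_curve \<Gamma>' \<rho>' for \<Gamma> \<rho> \<Gamma>' \<rho>'
begin

lemma side_agree: "\<Gamma>' \<phi> = \<Gamma> \<phi> \<Longrightarrow> \<Gamma>' \<psi> = \<Gamma> \<psi> \<Longrightarrow> G'.side \<phi> \<theta> \<psi> = G.side \<phi> \<theta> \<psi>"
  by (simp add: G.side_def G'.side_def)

text \<open>By \<open>T_eq_iff\<close> the next collision depends on the curve through its two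
  impact points alone; it does not see the arcs between them.\<close>

lemma T_agree:
  assumes "y \<in> phase" "\<Gamma>' (fst y) = \<Gamma> (fst y)" "\<Gamma>' (fst (G.T y)) = \<Gamma> (fst (G.T y))"
  shows "G'.T y = G.T y"
  using G'.T_eq_iff[OF assms(1), of "G.T y"] G.T_lift[OF assms(1)] G.T_side[OF assms(1)] G.T_snd[OF assms(1)]
    side_agree assms by simp

lemma inv_agree:
  assumes y: "y \<in> phase" and "\<Gamma>' (fst y) = \<Gamma> (fst y)"
    "\<Gamma>' (fst (billiard_inv \<Gamma> y)) = \<Gamma> (fst (billiard_inv \<Gamma> y))"
  shows "billiard_inv \<Gamma>' y = billiard_inv \<Gamma> y"
proof -
  have w: "billiard_inv \<Gamma> y \<in> phase" "G.T (billiard_inv \<Gamma> y) = y"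
    using G.billiard_inv_inverse y by auto
  then have "G'.T (billiard_inv \<Gamma> y) = y" using T_agree[OF w(1)] assms by simp
  then show ?thesis using G'.billiard_inv_inverse(1)[OF w(1)] by simp
qed

lemma T_iter_agree:
  assumes x: "x \<in> phase" and "\<And>k. \<Gamma>' (fst ((G.T ^^ k) x)) = \<Gamma> (fst ((G.T ^^ k) x))"
  shows "(G'.T ^^ k) x = (G.T ^^ k) x"
proof (induction k)
  case (Suc k)
  then show ?case
    using T_agree[OF iter_phase[OF G.C1_map_T x], of k] assms(2)[of k] assms(2)[of "Suc k"] by simp
qed simp

lemma inv_iter_agree:
  assumes x: "x \<in> phase"
    and "\<And>k. \<Gamma>' (fst ((billiard_inv \<Gamma> ^^ k) x)) = \<Gamma> (fst ((billiard_inv \<Gamma> ^^ k) x))"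
  shows "(billiard_inv \<Gamma>' ^^ k) x = (billiard_inv \<Gamma> ^^ k) x"
proof (induction k)
  case (Suc k)
  then show ?case
    using inv_agree[OF iter_phase[OF G.C1_map_billiard_inv x], of k] assms(2)[of k] assms(2)[of "Suc k"] by simp
qed simp

lemma step_chord_agree:
  assumes "y \<in> phase" "\<Gamma>' (fst y) = \<Gamma> (fst y)" "\<Gamma>' (fst (G.T y)) = \<Gamma> (fst (G.T y))"
  shows "G'.step_chord y = G.step_chord y"
  using T_agree[OF assms] assms by (simp add: G.step_chord_def G'.step_chord_def G.chord_def G'.chord_def)

text \<open>Equal impact points fix the orbit and the chord lengths; equal radii of curvature at the
  impacts then fix every \<open>DT\<close> along it, hence the derivative of the return map.\<close>

lemma hyperbolic_agree:
  assumes hyp: "hyperbolic_periodic \<Gamma> z"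
    and \<Gamma>: "\<And>k. \<Gamma>' (fst ((G.T ^^ k) z)) = \<Gamma> (fst ((G.T ^^ k) z))"
    and \<rho>: "\<And>k. \<rho>' (fst ((G.T ^^ k) z)) = \<rho> (fst ((G.T ^^ k) z))"
  shows "hyperbolic_periodic \<Gamma>' z"
proof -
  obtain q D where z: "z \<in> phase" and q: "q > 0" "cyl ((G.T ^^ q) z) = cyl z"
    and D: "(G.T ^^ q has_derivative D) (at z)" "\<And>\<mu>. complex_eigenvalue D \<mu> \<Longrightarrow> cmod \<mu> \<noteq> 1"
    using hyp by (auto simp: hyperbolic_periodic_def)
  note orb = T_iter_agree[OF z \<Gamma>]
  have "Diter G'.T G'.DT k z u = Diter G.T G.DT k z u" for k u
  proof (induction k)
    case (Suc k)
    let ?y = "(G.T ^^ k) z"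
    have y: "?y \<in> phase" using iter_phase[OF G.C1_map_T z] .
    have a: "\<Gamma>' (fst ?y) = \<Gamma> (fst ?y)" "\<Gamma>' (fst (G.T ?y)) = \<Gamma> (fst (G.T ?y))"
      "\<rho>' (fst ?y) = \<rho> (fst ?y)" "\<rho>' (fst (G.T ?y)) = \<rho> (fst (G.T ?y))"
      using \<Gamma>[of k] \<Gamma>[of "Suc k"] \<rho>[of k] \<rho>[of "Suc k"] by simp_all
    have "G'.DT ?y = G.DT ?y"
      using step_chord_agree[OF y a(1,2)] T_agree[OF y a(1,2)] a(3,4)
      by (simp add: fun_eq_iff G.DT_def G'.DT_def G.jac_def G'.jac_def)
    then show ?case using Suc orb by simp
  qed simp
  then have "Diter G'.T G'.DT q z = D"
    using has_derivative_unique[OF D(1) C1_map_deriv[OF C1_map_iter[OF G.C1_map_T] z]] by (simp add: fun_eq_iff)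
  then have "(G'.T ^^ q has_derivative D) (at z)"
    using C1_map_deriv[OF C1_map_iter[OF G'.C1_map_T] z, of q] by simp
  then show ?thesis
    unfolding hyperbolic_periodic_def using z q D orb by auto
qed

text \<open>Both curves share the orbit of \<open>a\<close>, hence the chord lengths, and
  \<open>start\<close> makes the initial beams equal; the two sequences differ in their shear
  coefficients alone.\<close>

lemma beam_iter:
  assumes "a \<in> phase" and same: "\<And>k. \<Gamma>' (fst ((G.T ^^ k) a)) = \<Gamma> (fst ((G.T ^^ k) a))"
    and start: "\<rho>' (fst a) = \<rho> (fst a)"
  shows "G.beam ((G.T ^^ k) a) (Diter G.T G.DT k a w) =
      beam_seq (\<lambda>k. G.step_chord ((G.T ^^ k) a)) (\<lambda>k. 2 / G.jac ((G.T ^^ k) a)) (G.beam a w) k" (is "?th1 k")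
    and "G'.beam ((G.T ^^ k) a) (Diter G'.T G'.DT k a w) =
      beam_seq (\<lambda>k. G.step_chord ((G.T ^^ k) a)) (\<lambda>k. 2 / G'.jac ((G.T ^^ k) a)) (G.beam a w) k" (is "?th2 k")
proof -
  note ph = iter_phase[OF G.C1_map_T assms(1)]
  note orb = T_iter_agree[OF assms(1) same]
  show "?th1 k"
  proof (induction k)
    case (Suc k)
    then show ?case
      using G.beam_DT[OF ph[of k], of "Diter G.T G.DT k a w"] by (simp add: Let_def prod_eq_iff)
  qed simp
  show "?th2 k"
  proof (induction k)
    case 0
    show ?case using start by (simp add: G.beam_def G'.beam_def G.jac_def G'.jac_def)
  next
    case (Suc k)
    have agree: "\<Gamma>' (fst ((G.T ^^ k) a)) = \<Gamma> (fst ((G.T ^^ k) a))"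
      "\<Gamma>' (fst (G.T ((G.T ^^ k) a))) = \<Gamma> (fst (G.T ((G.T ^^ k) a)))"
      using same[of k] same[of "Suc k"] by simp_all
    note step = G'.beam_DT[OF ph[of k] surjective_pairing, of "Diter G'.T G'.DT k a w",
        unfolded T_agree[OF ph[of k] agree] step_chord_agree[OF ph[of k] agree]]
    show ?case
      by (simp add: Let_def orb step Suc.IH)
  qed
qed

text \<open>The new stable vector has the old image \<open>N\<close> steps ahead, and the new
  unstable vector has the old image \<open>M\<close> steps back, at \<open>a\<close>. Were they
  parallel, both maps would carry the same beam from \<open>a\<close> through N + M impacts to
  proportional beams, and the determinant in \<open>det\<close> would vanish.\<close>

lemma transversal_connecting_pointI:
  assumes x: "x \<in> phase" and z0: "z0 \<in> phase" and z1: "z1 \<in> phase"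
    and conn: "connecting_point \<Gamma> z0 z1 x"
    and v: "v \<noteq> 0" "asymptotic_tangent_space (billiard_map \<Gamma>) z0 x = span {v}"
      "asymptotic_tangent_space (billiard_inv \<Gamma>) z1 x = span {v}"
    and x_fwd: "\<And>k. \<Gamma>' (fst ((G.T ^^ k) x)) = \<Gamma> (fst ((G.T ^^ k) x))"
    and x_bwd: "\<And>k. \<Gamma>' (fst ((billiard_inv \<Gamma> ^^ k) x)) = \<Gamma> (fst ((billiard_inv \<Gamma> ^^ k) x))"
    and near0: "\<And>k. k \<ge> N \<Longrightarrow> dist (cyl ((G.T ^^ k) x)) (cyl ((G.T ^^ k) z0)) < r"
    and near1: "\<And>k. k \<ge> M \<Longrightarrow> dist (cyl ((billiard_inv \<Gamma> ^^ k) x)) (cyl ((billiard_inv \<Gamma> ^^ k) z1)) < r"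
    and safe0: "\<And>y k. dist (cyl y) (cyl ((G.T ^^ k) z0)) < r \<Longrightarrow> \<Gamma>' (fst y) = \<Gamma> (fst y) \<and> \<rho>' (fst y) = \<rho> (fst y)"
    and safe1: "\<And>y k. dist (cyl y) (cyl ((billiard_inv \<Gamma> ^^ k) z1)) < r \<Longrightarrow> \<Gamma>' (fst y) = \<Gamma> (fst y) \<and> \<rho>' (fst y) = \<rho> (fst y)"
    and det: "\<And>a p l \<kappa> \<kappa>'. a = (billiard_inv \<Gamma> ^^ M) x \<Longrightarrow>
      p = G.beam a (Diter (billiard_inv \<Gamma>) G.DTi M x v) \<Longrightarrow> l = (\<lambda>k. G.step_chord ((G.T ^^ k) a)) \<Longrightarrow>
      \<kappa> = (\<lambda>k. 2 / G.jac ((G.T ^^ k) a)) \<Longrightarrow> \<kappa>' = (\<lambda>k. 2 / G'.jac ((G.T ^^ k) a)) \<Longrightarrow>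
      fst (beam_seq l \<kappa>' p (N + M)) * snd (beam_seq l \<kappa> p (N + M)) -
      snd (beam_seq l \<kappa>' p (N + M)) * fst (beam_seq l \<kappa> p (N + M)) \<noteq> 0"
  shows "transversal_connecting_point \<Gamma>' z0 z1 x"
proof -
  note mapsG = G.C1_map_T G.C1_map_billiard_inv and mapsG' = G'.C1_map_T G'.C1_map_billiard_inv
  have "r > 0" using le_less_trans[OF zero_le_dist near0[of N]] by simp
  then have z0_fwd: "\<Gamma>' (fst ((G.T ^^ k) z0)) = \<Gamma> (fst ((G.T ^^ k) z0))"
    and z1_bwd: "\<Gamma>' (fst ((billiard_inv \<Gamma> ^^ k) z1)) = \<Gamma> (fst ((billiard_inv \<Gamma> ^^ k) z1))" for k
    using safe0[of "(G.T ^^ k) z0" k] safe1[of "(billiard_inv \<Gamma> ^^ k) z1" k] by auto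
  note xo = T_iter_agree[OF x x_fwd] and zo = T_iter_agree[OF z0 z0_fwd]
    and xo' = inv_iter_agree[OF x x_bwd] and zo' = inv_iter_agree[OF z1 z1_bwd]
  interpret S: angle_curve_pair \<Gamma>' \<rho>' \<Gamma> \<rho> by unfold_locales
  obtain us where us: "us \<noteq> 0" "asymptotic_tangent_space G'.T z0 x = span {us}"
    "Diter G'.T G'.DT N x us = Diter G.T G.DT N x v"
  proof (rule asymptotic_tangent_space_span[OF mapsG(1) mapsG'(1) mapsG'(2) mapsG(2)
        G'.billiard_inv_inverse(1,2) G.billiard_inv_inverse(1,2) x zo xo near0 _ _ v(1,2)])
    fix y k assume y: "y \<in> phase" "dist (cyl y) (cyl ((G.T ^^ k) z0)) < r"
    then have y1: "\<Gamma>' (fst y) = \<Gamma> (fst y)" using safe0 by blast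
    show "G'.T y = G.T y" if "dist (cyl (G.T y)) (cyl ((G.T ^^ Suc k) z0)) < r"
      using T_agree[OF y(1) y1] safe0[OF that] by blast
    show "G.T y = G'.T y" if "dist (cyl (G'.T y)) (cyl ((G.T ^^ Suc k) z0)) < r"
      using S.T_agree[OF y(1) y1[symmetric]] safe0[OF that] by metis
  qed
  obtain uu where uu: "uu \<noteq> 0" "asymptotic_tangent_space (billiard_inv \<Gamma>') z1 x = span {uu}"
    "Diter (billiard_inv \<Gamma>') G'.DTi M x uu = Diter (billiard_inv \<Gamma>) G.DTi M x v"
  proof (rule asymptotic_tangent_space_span[OF mapsG(2) mapsG'(2) mapsG'(1) mapsG(1)
        G'.billiard_inv_inverse(2,1) G.billiard_inv_inverse(2,1) x zo' xo' near1 _ _ v(1,3)])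
    fix y k assume y: "y \<in> phase" "dist (cyl y) (cyl ((billiard_inv \<Gamma> ^^ k) z1)) < r"
    then have y1: "\<Gamma>' (fst y) = \<Gamma> (fst y)" using safe1 by blast
    show "billiard_inv \<Gamma>' y = billiard_inv \<Gamma> y" if "dist (cyl (billiard_inv \<Gamma> y)) (cyl ((billiard_inv \<Gamma> ^^ Suc k) z1)) < r"
      using inv_agree[OF y(1) y1] safe1[OF that] by blast
    show "billiard_inv \<Gamma> y = billiard_inv \<Gamma>' y" if "dist (cyl (billiard_inv \<Gamma>' y)) (cyl ((billiard_inv \<Gamma> ^^ Suc k) z1)) < r"
      using S.inv_agree[OF y(1) y1[symmetric]] safe1[OF that] by metis
  qed
  have "span {us} \<noteq> span {uu}"
  proof
    assume "span {us} = span {uu}"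
    then have "uu \<in> span {us}" using span_base[of uu "{uu}"] by simp
    then obtain t where t: "uu = t *\<^sub>R us" by (auto simp: span_singleton)
    define a w where "a = (billiard_inv \<Gamma> ^^ M) x" and "w = Diter (billiard_inv \<Gamma>) G.DTi M x v"
    have a: "a \<in> phase" unfolding a_def by (rule iter_phase[OF mapsG(2) x])
    have ax: "(G.T ^^ M) a = x" unfolding a_def by (rule iter_inverse[OF mapsG(2) G.billiard_inv_inverse(2) x])
    have a_orb: "\<Gamma>' (fst ((G.T ^^ k) a)) = \<Gamma> (fst ((G.T ^^ k) a))" for k
    proof (cases "k \<le> M")
      case True
      have "(G.T ^^ k) a = (billiard_inv \<Gamma> ^^ (M - k)) x"
      proof -
        have "a = (billiard_inv \<Gamma> ^^ k) ((billiard_inv \<Gamma> ^^ (M - k)) x)"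
          using True by (simp add: a_def iter_iter)
        then show ?thesis
          using iter_inverse[OF mapsG(2) G.billiard_inv_inverse(2) iter_phase[OF mapsG(2) x]] by simp
      qed
      then show ?thesis using x_bwd by simp
    next
      case False
      then have "(G.T ^^ k) a = (G.T ^^ (k - M)) x"
        using iter_iter[where f = G.T and m = "k - M" and n = M and x = a] by (simp add: ax)
      then show ?thesis using x_fwd by simp
    qed
    have \<rho>a: "\<rho>' (fst a) = \<rho> (fst a)" unfolding a_def using safe1[OF near1[of M]] by simp
    have xN: "(G.T ^^ (N + M)) a = (G.T ^^ N) x"
      using iter_iter[where f = G.T and m = N and n = M and x = a] by (simp add: ax add.commute)
    have \<rho>N: "\<rho>' (fst ((G.T ^^ (N + M)) a)) = \<rho> (fst ((G.T ^^ (N + M)) a))"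
      unfolding xN using safe0[OF near0[of N]] by simp
    have Tw: "Diter G.T G.DT M a w = v"
      unfolding a_def w_def by (rule Diter_inverse[OF mapsG(2,1) G.billiard_inv_inverse(2) x])
    have T'w: "Diter G'.T G'.DT M a w = uu"
      unfolding a_def w_def uu(3)[symmetric] xo'[symmetric]
      by (rule Diter_inverse[OF mapsG'(2,1) G'.billiard_inv_inverse(2) x])
    have ax': "(G'.T ^^ M) a = x" using T_iter_agree[OF a a_orb] ax by simp
    \<comment> \<open>Under the new map \<open>w\<close> becomes \<open>uu\<close>, that is t times
      \<open>us\<close>, after M steps, and N further steps give t times the old image of
      \<open>v\<close>, which is the old image of \<open>w\<close> after N + M steps.\<close>
    have "Diter G'.T G'.DT (N + M) a w = t *\<^sub>R Diter G.T G.DT (N + M) a w"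
      unfolding Diter_add Tw T'w ax ax' t us(3)[symmetric]
      by (rule linear_scale[OF C1_map_linear[OF C1_map_iter[OF mapsG'(1)] x]])
    moreover have "G'.beam ((G.T ^^ (N + M)) a) = G.beam ((G.T ^^ (N + M)) a)"
      using \<rho>N by (simp add: fun_eq_iff G.beam_def G'.beam_def G.jac_def G'.jac_def)
    ultimately have "G'.beam ((G.T ^^ (N + M)) a) (Diter G'.T G'.DT (N + M) a w) =
        t *\<^sub>R G.beam ((G.T ^^ (N + M)) a) (Diter G.T G.DT (N + M) a w)"
      using linear_scale[OF G.linear_beam] by simp
    then show False
      using det[OF a_def _ refl refl refl, folded w_def, OF refl]
      unfolding beam_iter[OF a a_orb \<rho>a] by simp
  qed
  moreover have "connecting_point \<Gamma>' z0 z1 x"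
    using conn x by (simp add: connecting_point_def W_s_def W_u_def asymptotic_set_def xo zo xo' zo')
  ultimately show ?thesis
    unfolding transversal_connecting_point_def tangent_line_s_def tangent_line_u_def
    using us uu by blast
qed

end

section \<open>Ovals and their perturbations\<close>

lemma smooth_radius:
  assumes "smooth \<Gamma>" "\<And>\<phi>. (\<Gamma> has_vector_derivative \<rho> \<phi> *\<^sub>R cis \<phi>) (at \<phi>)"
  shows "smooth \<rho>"
proof -
  have "smooth (\<lambda>\<phi>. \<rho> \<phi> *\<^sub>R cis \<phi>)" by (rule smooth_deriv[OF assms])
  then have "smooth (\<lambda>\<phi>. Re (cnj (cis \<phi>) * (\<rho> \<phi> *\<^sub>R cis \<phi>)))"
    by (intro smooth_bounded_linear[OF bounded_linear_Re] smooth_mult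
        smooth_bounded_linear[OF bounded_linear_cnj] smooth_cis)
  moreover have "Re (cnj (cis \<phi>) * (\<rho> \<phi> *\<^sub>R cis \<phi>)) = \<rho> \<phi>" for \<phi>
    by (simp add: cis_cnj cis_mult)
  ultimately show ?thesis by simp
qed

lemma oval_imp_angle_curve:
  assumes "oval \<Gamma>"
  obtains \<rho> where "angle_curve \<Gamma> \<rho>"
proof
  define \<rho> where "\<rho> \<phi> = norm (velocity \<Gamma> \<phi>)" for \<phi>
  have sm: "smooth \<Gamma>" using assms by (simp add: oval_def)
  have v: "velocity \<Gamma> \<phi> = \<rho> \<phi> *\<^sub>R cis \<phi>" for \<phi>
  proof -
    have "cis \<phi> = velocity \<Gamma> \<phi> /\<^sub>R \<rho> \<phi>" "\<rho> \<phi> \<noteq> 0"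
      using assms by (simp_all add: oval_def \<rho>_def sgn_div_norm[symmetric])
    then show ?thesis by simp
  qed
  have d: "(\<Gamma> has_vector_derivative \<rho> \<phi> *\<^sub>R cis \<phi>) (at \<phi>)" for \<phi>
    using smooth_differentiable[OF sm, of \<phi>] by (simp add: v[symmetric] velocity_def vector_derivative_works)
  show "angle_curve \<Gamma> \<rho>"
    by unfold_locales
      (use assms d smooth_continuous[OF smooth_radius[OF sm d]] in \<open>auto simp: \<rho>_def oval_def\<close>)
qed

context angle_curve begin

text \<open>The curvature is 1 / \<rho>: in the second derivative the term with \<rho>' is parallel
  to the velocity and drops out.\<close>

lemma oval_if_smooth:
  assumes "smooth \<Gamma>"
  shows "oval \<Gamma>"
proof -
  have v: "velocity \<Gamma> = (\<lambda>\<phi>. \<rho> \<phi> *\<^sub>R cis \<phi>)"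
    unfolding velocity_def using deriv vector_derivative_at by blast
  have "curvature \<Gamma> \<phi> > 0" for \<phi>
  proof -
    obtain \<rho>' where "\<And>\<phi>. (\<rho> has_vector_derivative \<rho>' \<phi>) (at \<phi>)"
      using smooth_obtain_deriv[OF smooth_radius[OF assms deriv]] by blast
    then have "(\<rho> has_real_derivative \<rho>' \<phi>) (at \<phi>)"
      by (simp add: has_real_derivative_iff_has_vector_derivative)
    from has_vector_derivative_scaleR[OF this cis_has_vector_derivative]
    have "velocity (velocity \<Gamma>) \<phi> = \<rho> \<phi> *\<^sub>R (\<i> * cis \<phi>) + \<rho>' \<phi> *\<^sub>R cis \<phi>"
      unfolding v velocity_def by (rule vector_derivative_at)
    then have "cnj (velocity \<Gamma> \<phi>) * velocity (velocity \<Gamma>) \<phi> =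
        (cnj (cis \<phi>) * cis \<phi>) * (\<rho> \<phi> *\<^sub>R (\<rho> \<phi> *\<^sub>R \<i> + complex_of_real (\<rho>' \<phi>)))"
      by (simp add: v scaleR_conv_of_real algebra_simps)
    also have "cnj (cis \<phi>) * cis \<phi> = 1" by (simp add: cis_cnj cis_mult)
    finally have "curvature \<Gamma> \<phi> = \<rho> \<phi> * \<rho> \<phi> / \<rho> \<phi> ^ 3"
      using pos[of \<phi>] by (simp add: curvature_def v)
    then show ?thesis using pos[of \<phi>] by simp
  qed
  moreover have "sgn (velocity \<Gamma> \<phi>) = cis \<phi>" "velocity \<Gamma> \<phi> \<noteq> 0" for \<phi>
    using pos[of \<phi>] by (simp_all add: v sgn_scaleR)
  ultimately show ?thesis
    using assms per by (simp add: oval_def)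
qed

lemma tangent_side_pos:
  assumes "\<Gamma> \<psi> \<noteq> \<Gamma> \<phi>"
  shows "Im (cis (- \<phi>) * (\<Gamma> \<psi> - \<Gamma> \<phi>)) > 0"
proof -
  obtain k :: int where k: "\<phi> \<le> \<psi> + 2 * pi * of_int k" "\<psi> + 2 * pi * of_int k < \<phi> + 2 * pi"
    using reduce_angle by blast
  moreover have "\<phi> \<noteq> \<psi> + 2 * pi * of_int k" using assms per_int[of \<psi> k] by metis
  ultimately show ?thesis
    using side_tangent_pos[of \<phi> "\<psi> + 2 * pi * of_int k"] by (simp add: side_def per_int)
qed

text \<open>Rotating the curve moves the unique point touching a supporting line to the unique point
  touching the rotated line.\<close>

lemma rotation_equivariant:
  assumes "(\<lambda>z. cis a * z) ` range \<Gamma> = range \<Gamma>"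
  shows "\<Gamma> (\<phi> + a) = cis a * \<Gamma> \<phi>"
proof (rule ccontr)
  assume ne: "\<Gamma> (\<phi> + a) \<noteq> cis a * \<Gamma> \<phi>"
  obtain \<psi> where \<psi>: "cis a * \<Gamma> \<phi> = \<Gamma> \<psi>" using assms by blast
  have "\<Gamma> (\<phi> + a) \<in> (\<lambda>z. cis a * z) ` range \<Gamma>" using assms by simp
  then obtain \<xi> where \<xi>: "\<Gamma> (\<phi> + a) = cis a * \<Gamma> \<xi>" by blast
  have "Im (cis (- (\<phi> + a)) * (\<Gamma> \<psi> - \<Gamma> (\<phi> + a))) > 0"
    using ne \<psi> by (intro tangent_side_pos) simp
  also have "cis (- (\<phi> + a)) * (\<Gamma> \<psi> - \<Gamma> (\<phi> + a)) = (cis (- (\<phi> + a)) * cis a) * (\<Gamma> \<phi> - \<Gamma> \<xi>)"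
    by (simp add: \<psi>[symmetric] \<xi> algebra_simps)
  also have "cis (- (\<phi> + a)) * cis a = cis (- \<phi>)" by (simp add: cis_mult)
  finally have "Im (cis (- \<phi>) * (\<Gamma> \<phi> - \<Gamma> \<xi>)) > 0" .
  moreover have "Im (cis (- \<phi>) * (\<Gamma> \<xi> - \<Gamma> \<phi>)) > 0"
    using ne \<xi> by (intro tangent_side_pos) auto
  moreover have "cis (- \<phi>) * (\<Gamma> \<phi> - \<Gamma> \<xi>) = - (cis (- \<phi>) * (\<Gamma> \<xi> - \<Gamma> \<phi>))" by (simp add: algebra_simps)
  ultimately show False by simp
qed

lemma radius_lower_bound:
  obtains m where "m > 0" "\<And>\<phi>. m \<le> \<rho> \<phi>"
proof -
  have "continuous_on {0..2 * pi} \<rho>" using cont continuous_on_subset by blast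
  then have "\<exists>x\<in>{0..2 * pi}. \<forall>y\<in>{0..2 * pi}. \<rho> x \<le> \<rho> y"
    by (intro continuous_attains_inf) auto
  then obtain x where x: "\<And>y. y \<in> {0..2 * pi} \<Longrightarrow> \<rho> x \<le> \<rho> y" by blast
  have "\<rho> x \<le> \<rho> \<phi>" for \<phi>
  proof -
    obtain k :: int where k: "0 \<le> \<phi> + 2 * pi * of_int k" "\<phi> + 2 * pi * of_int k < 0 + 2 * pi"
      using reduce_angle by blast
    \<comment> \<open>At \<alpha> = pi / 2 the function \<open>jac\<close> is \<rho> itself, so its
      invariance on the cylinder is the periodicity.\<close>
    have "\<rho> (\<phi> + 2 * pi * of_int k) = \<rho> \<phi>"
      using jac_cyl[of "(\<phi> + 2 * pi * of_int k, pi / 2)" "(\<phi>, pi / 2)"]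
      by (simp add: jac_def cyl_eq_iff)
    then show ?thesis using x[of "\<phi> + 2 * pi * of_int k"] k by simp
  qed
  then show thesis using that pos by blast
qed

end

text \<open>Since \<open>\<Gamma> = g' cis - g \<eta>\<close> for the support function \<open>g\<close>, this is the curve with support function \<open>g + e b\<close>.\<close>

definition bumped :: "(real \<Rightarrow> complex) \<Rightarrow> (real \<Rightarrow> real) \<Rightarrow> (real \<Rightarrow> real) \<Rightarrow> real \<Rightarrow> real \<Rightarrow> complex" where
  "bumped \<Gamma> b b1 e \<phi> = \<Gamma> \<phi> + of_real e * (of_real (b1 \<phi>) * cis \<phi> - of_real (b \<phi>) * (\<i> * cis \<phi>))"

text \<open>The radius of curvature belonging to a support function g is g + g'', so adding e b adds
  e (b + b'').\<close>

lemma bumped_deriv: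
  assumes "(\<Gamma> has_vector_derivative \<rho> \<phi> *\<^sub>R cis \<phi>) (at \<phi>)"
    and b: "(b has_real_derivative b1 \<phi>) (at \<phi>)" "(b1 has_real_derivative b2 \<phi>) (at \<phi>)"
  shows "(bumped \<Gamma> b b1 e has_vector_derivative (\<rho> \<phi> + e * (b \<phi> + b2 \<phi>)) *\<^sub>R cis \<phi>) (at \<phi>)"
proof -
  have c: "((\<lambda>x. complex_of_real (f x)) has_vector_derivative complex_of_real f') (at \<phi>)"
    if "(f has_real_derivative f') (at \<phi>)" for f f'
    using that has_vector_derivative_of_real by blast
  have "(bumped \<Gamma> b b1 e has_vector_derivative
     \<rho> \<phi> *\<^sub>R cis \<phi> + of_real e * ((of_real (b1 \<phi>) * (\<i> * cis \<phi>) + of_real (b2 \<phi>) * cis \<phi>) -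
       (of_real (b \<phi>) * (\<i> * (\<i> * cis \<phi>)) + of_real (b1 \<phi>) * (\<i> * cis \<phi>)))) (at \<phi>)"
    unfolding bumped_def[abs_def]
    by (intro has_vector_derivative_add has_vector_derivative_diff has_vector_derivative_mult_right
        has_vector_derivative_mult assms(1) c b cis_has_vector_derivative)
  moreover have "\<rho> \<phi> *\<^sub>R cis \<phi> + of_real e * ((of_real (b1 \<phi>) * (\<i> * cis \<phi>) + of_real (b2 \<phi>) * cis \<phi>) -
       (of_real (b \<phi>) * (\<i> * (\<i> * cis \<phi>)) + of_real (b1 \<phi>) * (\<i> * cis \<phi>))) =
       (\<rho> \<phi> + e * (b \<phi> + b2 \<phi>)) *\<^sub>R cis \<phi>"
    by (simp add: scaleR_conv_of_real mult.assoc[symmetric]) (simp add: algebra_simps)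
  ultimately show ?thesis by simp
qed

lemma smooth_bumped:
  assumes "smooth \<Gamma>" "smooth b" "smooth b1"
  shows "smooth (bumped \<Gamma> b b1 e)"
proof -
  have "smooth (\<lambda>\<phi>. \<Gamma> \<phi> + of_real e * (of_real (b1 \<phi>) * cis \<phi> + (- \<i>) * (of_real (b \<phi>) * cis \<phi>)))"
    by (intro smooth_add smooth_mult smooth_const smooth_cis assms smooth_bounded_linear[OF bounded_linear_of_real])
  then show ?thesis by (simp add: bumped_def[abs_def] algebra_simps)
qed

lemma support_fun_bumped: "support_fun (bumped \<Gamma> b b1 e) \<phi> - support_fun \<Gamma> \<phi> = e * b \<phi>"
proof -
  have s: "(sin \<phi>)\<^sup>2 + (cos \<phi>)\<^sup>2 = 1" by simp
  have "support_fun (bumped \<Gamma> b b1 e) \<phi> - support_fun \<Gamma> \<phi> = e * b \<phi> * ((sin \<phi>)\<^sup>2 + (cos \<phi>)\<^sup>2)"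
    by (simp add: support_fun_def bumped_def inner_complex_def \<eta>_def power2_eq_square algebra_simps del: sin_cos_squared_add sin_cos_squared_add2 sin_cos_squared_add3)
  then show ?thesis by simp
qed

lemma C2_norm_le:
  assumes g: "\<And>x. (g has_real_derivative g1 x) (at x)" "\<And>x. (g1 has_real_derivative g2 x) (at x)"
    and "\<And>x. \<bar>g x\<bar> \<le> A" "\<And>x. \<bar>g1 x\<bar> \<le> B" "\<And>x. \<bar>g2 x\<bar> \<le> C"
  shows "C2_norm g \<le> A + B + C"
proof -
  have "deriv g = g1" "deriv g1 = g2" using g by (auto simp: DERIV_imp_deriv)
  then show ?thesis
    unfolding C2_norm_def using assms by (intro add_mono cSUP_least) auto
qed

lemma bumped_symmetric_oval:
  assumes \<Gamma>: "\<Gamma> \<in> symmetric_ovals n" and n: "n > 0" and "angle_curve \<Gamma> \<rho>"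
    and b: "smooth b" "smooth b1" "\<And>x. (b has_real_derivative b1 x) (at x)" "\<And>x. (b1 has_real_derivative b2 x) (at x)"
      "smooth b2"
    and b_per: "\<And>x. b (x + 2 * pi / n) = b x" "\<And>x. b1 (x + 2 * pi / n) = b1 x"
    and bd: "bounded (range b)" "bounded (range b1)" "bounded (range b2)"
    and \<delta>: "\<delta> > 0"
  shows "\<forall>\<^sub>F e in at_right 0. bumped \<Gamma> b b1 e \<in> symmetric_ovals n \<and> oval_dist (bumped \<Gamma> b b1 e) \<Gamma> < \<delta> \<and>
    angle_curve (bumped \<Gamma> b b1 e) (\<lambda>\<phi>. \<rho> \<phi> + e * (b \<phi> + b2 \<phi>))"
proof -
  interpret angle_curve \<Gamma> \<rho> by fact
  obtain m where m: "m > 0" "\<And>\<phi>. m \<le> \<rho> \<phi>" using radius_lower_bound by blast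
  obtain B0 B1 B2 where B: "B0 > 0" "B1 > 0" "B2 > 0" "\<And>x. \<bar>b x\<bar> \<le> B0" "\<And>x. \<bar>b1 x\<bar> \<le> B1" "\<And>x. \<bar>b2 x\<bar> \<le> B2"
    using bd unfolding bounded_pos by auto
  \<comment> \<open>\<open>e * S\<close> bounds both the change of the radius of curvature, which
    must stay below its lower bound \<open>m\<close>, and the C^2 distance, which must stay below
    \<delta>.\<close>
  define S where "S = B0 + B1 + B2"
  have S: "S > 0" using B by (simp add: S_def)
  have "\<forall>\<^sub>F e in at_right (0::real). e < min (m / S) (\<delta> / S)"
    using S m \<delta> by (intro order_tendstoD(2)[OF tendsto_ident_at]) simp
  moreover have "\<forall>\<^sub>F e in at_right (0::real). e > 0"
    by (simp add: eventually_at_right_less)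
  ultimately show ?thesis
  proof eventually_elim
    case (elim e)
    let ?\<Delta> = "bumped \<Gamma> b b1 e" and ?r = "\<lambda>\<phi>. \<rho> \<phi> + e * (b \<phi> + b2 \<phi>)"
    have e: "e > 0" "e * S < m" "e * S < \<delta>" using elim S by (simp_all add: field_simps)
    have rot: "\<Gamma> (\<phi> + 2 * pi / n) = cis (2 * pi / n) * \<Gamma> \<phi>" for \<phi>
      using rotation_equivariant \<Gamma> by (simp add: symmetric_ovals_def)
    have rot': "?\<Delta> (\<phi> + 2 * pi / n) = cis (2 * pi / n) * ?\<Delta> \<phi>" for \<phi>
      unfolding bumped_def rot b_per cis_mult[symmetric] by (simp add: algebra_simps)
    define a where "a = 2 * pi / real n"
    \<comment> \<open>After n steps the rotation is a full turn, so equivariance yields the period 2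
      pi.\<close>
    have rotk: "?\<Delta> (\<phi> + of_nat k * a) = cis (of_nat k * a) * ?\<Delta> \<phi>" for k \<phi>
    proof (induction k)
      case (Suc k)
      have "?\<Delta> (\<phi> + of_nat (Suc k) * a) = cis a * ?\<Delta> (\<phi> + of_nat k * a)"
        using rot'[of "\<phi> + of_nat k * a", folded a_def] by (simp add: algebra_simps)
      also have "\<dots> = cis a * cis (of_nat k * a) * ?\<Delta> \<phi>" by (simp add: Suc)
      also have "cis a * cis (of_nat k * a) = cis (of_nat (Suc k) * a)"
        unfolding cis_mult by (simp add: algebra_simps)
      finally show ?case .
    qed simp
    have per': "?\<Delta> (\<phi> + 2 * pi) = ?\<Delta> \<phi>" for \<phi> using rotk[of \<phi> n] n by (simp add: a_def)
    have pos': "?r \<phi> > 0" for \<phi>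
    proof -
      have "\<bar>e * (b \<phi> + b2 \<phi>)\<bar> \<le> e * S"
        unfolding abs_mult using e B(2) B(4)[of \<phi>] B(6)[of \<phi>] by (intro mult_mono) (auto simp: S_def)
      then show ?thesis using m(2)[of \<phi>] e(2) by linarith
    qed
    have sm: "smooth ?\<Delta>" using \<Gamma> b by (intro smooth_bumped) (auto simp: symmetric_ovals_def oval_def)
    have ac: "angle_curve ?\<Delta> ?r"
    proof
      show "(?\<Delta> has_vector_derivative ?r \<phi> *\<^sub>R cis \<phi>) (at \<phi>)" for \<phi> by (rule bumped_deriv[OF deriv b(3,4)])
      show "continuous_on UNIV ?r" by (intro continuous_intros cont smooth_continuous b)
    qed (use pos' per' in auto)
    have "range ?\<Delta> \<subseteq> (\<lambda>z. cis (2 * pi / n) * z) ` range ?\<Delta>"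
    proof
      fix w assume "w \<in> range ?\<Delta>"
      then obtain \<phi> where "w = ?\<Delta> \<phi>" by blast
      then have "w = cis (2 * pi / n) * ?\<Delta> (\<phi> - 2 * pi / n)" using rot'[of "\<phi> - 2 * pi / n"] by simp
      then show "w \<in> (\<lambda>z. cis (2 * pi / n) * z) ` range ?\<Delta>" by blast
    qed
    moreover have "(\<lambda>z. cis (2 * pi / n) * z) ` range ?\<Delta> \<subseteq> range ?\<Delta>"
      using rot' by (auto simp: image_iff) (metis rot')
    ultimately have "?\<Delta> \<in> symmetric_ovals n"
      using angle_curve.oval_if_smooth[OF ac sm] by (simp add: symmetric_ovals_def)
    moreover have "oval_dist ?\<Delta> \<Gamma> < \<delta>"
    proof -
      have "C2_norm (\<lambda>\<phi>. e * b \<phi>) \<le> e * B0 + e * B1 + e * B2"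
        by (rule C2_norm_le[of _ "\<lambda>\<phi>. e * b1 \<phi>" "\<lambda>\<phi>. e * b2 \<phi>"])
          (use e(1) B b in \<open>auto intro!: DERIV_cmult simp: abs_mult\<close>)
      also have "\<dots> = e * S" by (simp add: S_def algebra_simps)
      finally show ?thesis using e by (simp add: oval_dist_def support_fun_bumped)
    qed
    ultimately show ?case using ac by blast
  qed
qed

section \<open>Breaking the tangency\<close>

context angle_curve begin

text \<open>The points T^(-k) z and T^(q k - k) z have the same k-th image on the cylinder. So the
  backward orbit visits only angles of the forward one.\<close>

lemma backward_periodic:
  assumes z: "z \<in> phase" and q: "q > 0" "cyl ((T ^^ q) z) = cyl z"
  obtains i where "cyl ((billiard_inv \<Gamma> ^^ k) z) = cyl ((T ^^ i) z)"
proof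
  let ?y = "(billiard_inv \<Gamma> ^^ k) z"
  have "cyl ((T ^^ k) ?y) = cyl z"
    using iter_inverse[OF C1_map_billiard_inv billiard_inv_inverse(2) z] by simp
  also have "\<dots> = cyl ((T ^^ (0 + q * k)) z)"
    using cyl_periodic[OF z q(2), of 0 k] by simp
  also have "(T ^^ (0 + q * k)) z = (T ^^ k) ((T ^^ (q * k - k)) z)"
    using q(1) by (simp add: iter_iter)
  finally show "cyl ?y = cyl ((T ^^ (q * k - k)) z)"
    by (rule cyl_iter_inject[OF iter_phase[OF C1_map_billiard_inv z] iter_phase[OF C1_map_T z]])
qed

lemma finite_periodic_angles:
  assumes z: "z \<in> phase" and q: "q > 0" "cyl ((T ^^ q) z) = cyl z"
  shows "finite (range (\<lambda>k. cis (fst ((T ^^ k) z)) ^ n))"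
proof (rule finite_subset)
  show "range (\<lambda>k. cis (fst ((T ^^ k) z)) ^ n) \<subseteq> (\<lambda>k. cis (fst ((T ^^ k) z)) ^ n) ` {..<q}"
  proof
    fix w assume "w \<in> range (\<lambda>k. cis (fst ((T ^^ k) z)) ^ n)"
    then obtain k where w: "w = cis (fst ((T ^^ k) z)) ^ n" by blast
    have "cyl ((T ^^ (k mod q + q * (k div q))) z) = cyl ((T ^^ (k mod q)) z)"
      by (rule cyl_periodic[OF z q(2)])
    then have "w = cis (fst ((T ^^ (k mod q)) z)) ^ n" by (simp add: w cyl_def)
    then show "w \<in> (\<lambda>k. cis (fst ((T ^^ k) z)) ^ n) ` {..<q}" using q(1) by auto
  qed
qed simp

lemma hyperbolic_periodicE:
  assumes "hyperbolic_periodic \<Gamma> z"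
  obtains q where "z \<in> phase" "q > 0" "cyl ((T ^^ q) z) = cyl z"
    "\<And>\<mu>. complex_eigenvalue (Diter T DT q z) \<mu> \<Longrightarrow> cmod \<mu> \<noteq> 1"
proof -
  obtain q D where z: "z \<in> phase" and q: "q > 0" "cyl ((T ^^ q) z) = cyl z"
    and D: "(T ^^ q has_derivative D) (at z)" "\<And>\<mu>. complex_eigenvalue D \<mu> \<Longrightarrow> cmod \<mu> \<noteq> 1"
    using assms by (auto simp: hyperbolic_periodic_def)
  have "D = Diter T DT q z"
    by (rule has_derivative_unique[OF D(1) C1_map_deriv[OF C1_map_iter[OF C1_map_T] z]])
  then show thesis using that z q D(2) by blast
qed

end

text \<open>Distance of n-th powers measures angles modulo the symmetry; here it is converted into
  the profile 1 - cos on which the bump is built.\<close>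

lemma cis_power_dist: "(dist (cis (n * \<phi>)) (cis (n * c)))\<^sup>2 = 2 * (1 - cos (n * (\<phi> - c)))"
proof -
  have "(dist (cis s) (cis t))\<^sup>2 = 2 * (1 - cos (s - t))" for s t
  proof -
    have "(dist (cis s) (cis t))\<^sup>2 = (cos s - cos t)\<^sup>2 + (sin s - sin t)\<^sup>2"
      by (simp add: dist_norm cmod_power2)
    also have "\<dots> = ((sin s)\<^sup>2 + (cos s)\<^sup>2) + ((sin t)\<^sup>2 + (cos t)\<^sup>2) - 2 * (cos s * cos t + sin s * sin t)"
      by (simp only: power2_diff) (simp add: algebra_simps)
    finally show ?thesis by (simp add: cos_diff)
  qed
  then show ?thesis by (simp add: right_diff_distrib)
qed

theorem proposition6p1:
  fixes n :: nat
    and \<Gamma> :: "real \<Rightarrow> complex"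
    and \<phi>\<^sub>0 \<alpha>\<^sub>0 \<phi>\<^sub>1 \<alpha>\<^sub>1 \<phi>' \<alpha>' :: real
  assumes "n \<ge> 2"
    and "\<Gamma> \<in> symmetric_ovals n"
    and "hyperbolic_periodic \<Gamma> (\<phi>\<^sub>0, \<alpha>\<^sub>0)"
    and "hyperbolic_periodic \<Gamma> (\<phi>\<^sub>1, \<alpha>\<^sub>1)"
    and "tangent_connecting_point \<Gamma> (\<phi>\<^sub>0, \<alpha>\<^sub>0) (\<phi>\<^sub>1, \<alpha>\<^sub>1) (\<phi>', \<alpha>')"
  shows "\<forall>\<delta>>0. \<exists>\<Gamma>\<^sub>\<epsilon> \<in> symmetric_ovals n.
           oval_dist \<Gamma>\<^sub>\<epsilon> \<Gamma> < \<delta> \<and>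
           hyperbolic_periodic \<Gamma>\<^sub>\<epsilon> (\<phi>\<^sub>0, \<alpha>\<^sub>0) \<and>
           hyperbolic_periodic \<Gamma>\<^sub>\<epsilon> (\<phi>\<^sub>1, \<alpha>\<^sub>1) \<and>
           transversal_connecting_point \<Gamma>\<^sub>\<epsilon> (\<phi>\<^sub>0, \<alpha>\<^sub>0) (\<phi>\<^sub>1, \<alpha>\<^sub>1) (\<phi>', \<alpha>')"
proof (intro allI impI)
  fix \<delta> :: real assume \<delta>: "\<delta> > 0"
  define z0 z1 x where "z0 = (\<phi>\<^sub>0, \<alpha>\<^sub>0)" and "z1 = (\<phi>\<^sub>1, \<alpha>\<^sub>1)" and "x = (\<phi>', \<alpha>')"
  have n: "n > 0" using assms(1) by simp
  obtain \<rho> where ac: "angle_curve \<Gamma> \<rho>"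
    using oval_imp_angle_curve assms(2) by (auto simp: symmetric_ovals_def)
  interpret angle_curve \<Gamma> \<rho> by (rule ac)
  let ?Ti = "billiard_inv \<Gamma>"
  note maps = C1_map_T C1_map_billiard_inv
  have hyp0: "hyperbolic_periodic \<Gamma> z0" and hyp1: "hyperbolic_periodic \<Gamma> z1"
    and conn: "connecting_point \<Gamma> z0 z1 x"
    using assms(3-5) by (simp_all add: z0_def z1_def x_def tangent_connecting_point_def)
  obtain v where v: "v \<noteq> 0" "asymptotic_tangent_space T z0 x = span {v}" "asymptotic_tangent_space ?Ti z1 x = span {v}"
    using assms(5) by (auto simp: z0_def z1_def x_def tangent_connecting_point_def tangent_line_s_def tangent_line_u_def)
  obtain q0 where q0: "z0 \<in> phase" "q0 > 0" "cyl ((T ^^ q0) z0) = cyl z0"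
    "\<And>\<mu>. complex_eigenvalue (Diter T DT q0 z0) \<mu> \<Longrightarrow> cmod \<mu> \<noteq> 1"
    using hyperbolic_periodicE[OF hyp0] by blast
  obtain q1 where q1: "z1 \<in> phase" "q1 > 0" "cyl ((T ^^ q1) z1) = cyl z1"
    using hyperbolic_periodicE[OF hyp1] by metis
  have x: "x \<in> phase" and ne: "cyl x \<noteq> cyl z0"
    and lim0: "(\<lambda>k. dist (cyl ((T ^^ k) x)) (cyl ((T ^^ k) z0))) \<longlonglongrightarrow> 0"
    and lim1: "(\<lambda>k. dist (cyl ((?Ti ^^ k) x)) (cyl ((?Ti ^^ k) z1))) \<longlonglongrightarrow> 0"
    using conn by (auto simp: connecting_point_def W_s_def W_u_def asymptotic_set_def)
  define P where "P = range (\<lambda>k. cis (fst ((T ^^ k) z0)) ^ n) \<union> range (\<lambda>k. cis (fst ((T ^^ k) z1)) ^ n)"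
  have finP: "finite P"
    unfolding P_def using finite_periodic_angles q0 q1 by blast
  have P0: "cis (fst ((T ^^ k) z0)) ^ n \<in> P" and P1: "cis (fst ((T ^^ k) z1)) ^ n \<in> P" for k
    by (auto simp: P_def)
  have P1': "cis (fst ((?Ti ^^ k) z1)) ^ n \<in> P" for k
  proof -
    obtain i where "cyl ((?Ti ^^ k) z1) = cyl ((T ^^ i) z1)" using backward_periodic[OF q1] by blast
    then show ?thesis using P1[of i] by (simp add: cyl_def)
  qed
  obtain m where m: "cis (fst ((T ^^ m) x)) ^ n \<notin> P" "fst (Diter T DT m x v) \<noteq> 0"
    using exists_nonfocused_impact[OF n x q0(1-3) q0(4) lim0 ne finP P0 v(1)] v(2) span_base[of v "{v}"] by auto
  define c where "c = fst ((T ^^ m) x)"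
  \<comment> \<open>The distance of an impact from the bump centre, modulo the symmetry.\<close>
  define E where "E y = dist (cis (fst y) ^ n) (cis c ^ n)" for y :: "real \<times> real"
  have "finite ((\<lambda>w. dist w (cis c ^ n)) ` P)" using finP by simp
  then obtain d where d: "d > 0" "\<And>w. w \<in> P \<Longrightarrow> d < dist w (cis c ^ n)"
    by (rule ex_pos_less_finite) (use m(1) in \<open>auto simp: c_def\<close>)
  \<comment> \<open>The n-th power is n-Lipschitz on the unit circle, so impacts within
    \<open>r\<close> of a periodic orbit keep the distance d / 2 from the centre.\<close>
  define r where "r = d / (2 * real n)"
  have r: "r > 0" using d(1) n by (simp add: r_def)
  have near_P: "E y > d / 2" if "cis (fst z) ^ n \<in> P" "dist (cyl y) (cyl z) < r" for y z
  proof -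
    have "dist (cis (fst y) ^ n) (cis (fst z) ^ n) \<le> real n * dist (cis (fst y)) (cis (fst z))"
      using norm_power_diff[of "cis (fst y)" "cis (fst z)" n] by (simp add: dist_norm)
    also have "\<dots> \<le> real n * dist (cyl y) (cyl z)" by (intro mult_left_mono dist_cis_le_dist_cyl) simp
    also have "\<dots> < d / 2" using that(2) n by (simp add: r_def field_simps)
    finally have "dist (cis (fst y) ^ n) (cis (fst z) ^ n) < d / 2" .
    moreover have "dist (cis (fst z) ^ n) (cis c ^ n) \<le> dist (cis (fst y) ^ n) (cis (fst z) ^ n) + E y"
      unfolding E_def by (rule dist_triangle3)
    ultimately show ?thesis using d(2)[OF that(1)] by linarith
  qed
  obtain N where N: "\<And>k. k \<ge> N \<Longrightarrow> dist (cyl ((T ^^ k) x)) (cyl ((T ^^ k) z0)) < r"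
    using order_tendstoD(2)[OF lim0 r] by (auto simp: eventually_sequentially)
  obtain M where M: "\<And>k. k \<ge> M \<Longrightarrow> dist (cyl ((?Ti ^^ k) x)) (cyl ((?Ti ^^ k) z1)) < r"
    using order_tendstoD(2)[OF lim1 r] by (auto simp: eventually_sequentially)
  \<comment> \<open>Only finitely many impacts of the connecting orbit lie outside the two tails;
    those not at the centre have a positive minimal distance from it.\<close>
  obtain d' where d': "d' > 0" "d' < d / 2" "\<And>k. k < N \<Longrightarrow> E ((T ^^ k) x) \<noteq> 0 \<Longrightarrow> d' < E ((T ^^ k) x)"
    "\<And>k. k < M \<Longrightarrow> E ((?Ti ^^ k) x) \<noteq> 0 \<Longrightarrow> d' < E ((?Ti ^^ k) x)"
  proof -
    define A where "A = {d / 2} \<union> (\<lambda>k. E ((T ^^ k) x)) ` {k. k < N \<and> E ((T ^^ k) x) \<noteq> 0} \<union>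
      (\<lambda>k. E ((?Ti ^^ k) x)) ` {k. k < M \<and> E ((?Ti ^^ k) x) \<noteq> 0}"
    have "finite A" "\<And>a. a \<in> A \<Longrightarrow> 0 < a" using d(1) by (auto simp: A_def E_def)
    then obtain d' where d': "d' > 0" "\<And>a. a \<in> A \<Longrightarrow> d' < a" using ex_pos_less_finite by metis
    show thesis
      by (rule that[of d'], rule d'(1); rule d'(2)) (auto simp: A_def)
  qed
  obtain b b1 b2 :: "real \<Rightarrow> real" where sb: "smooth b" "smooth b1" "smooth b2"
    and db: "\<And>x. (b has_real_derivative b1 x) (at x)" "\<And>x. (b1 has_real_derivative b2 x) (at x)"
    and pb: "\<And>x. b (x + 2 * pi / n) = b x" "\<And>x. b1 (x + 2 * pi / n) = b1 x"
    and bb: "bounded (range b)" "bounded (range b1)" "bounded (range b2)"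
    and far: "\<And>x. 1 - cos (n * (x - c)) \<ge> d'\<^sup>2 / 2 \<Longrightarrow> b x = 0 \<and> b1 x = 0 \<and> b2 x = 0"
    and centre: "\<And>x. cos (n * (x - c)) = 1 \<Longrightarrow> b x = 0 \<and> b1 x = 0 \<and> b2 x > 0"
    using periodic_bump[OF n, of "d'\<^sup>2 / 2" c] d'(1) by auto
  have E2: "(E y)\<^sup>2 = 2 * (1 - cos (n * (fst y - c)))" for y
    unfolding E_def Complex.DeMoivre by (rule cis_power_dist)
  have farE: "b (fst y) = 0 \<and> b1 (fst y) = 0 \<and> b2 (fst y) = 0" if "E y > d'" for y
  proof (rule far)
    have "d'\<^sup>2 \<le> (E y)\<^sup>2" using that d'(1) by (intro power_mono) auto
    then show "1 - cos (n * (fst y - c)) \<ge> d'\<^sup>2 / 2" by (simp add: E2)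
  qed
  have centreE: "b (fst y) = 0 \<and> b1 (fst y) = 0 \<and> b2 (fst y) > 0" if "E y = 0" for y
    using E2[of y] that by (intro centre) simp
  \<comment> \<open>An impact is either at the centre, where \<open>b\<close> and \<open>b1\<close>
    vanish, or off the support: in both cases the curve keeps its point there.\<close>
  have fwd: "E ((T ^^ k) x) = 0 \<or> E ((T ^^ k) x) > d'" for k
    using d'(2) d'(3)[of k] near_P[OF P0 N[of k]] by (cases "k < N") auto
  have bwd: "E ((?Ti ^^ k) x) = 0 \<or> E ((?Ti ^^ k) x) > d'" for k
    using d'(2) d'(4)[of k] near_P[OF P1' M[of k]] by (cases "k < M") auto
  have per0: "E ((T ^^ k) z0) > d'" and per1: "E ((T ^^ k) z1) > d'" for k
    using near_P[OF P0, of "(T ^^ k) z0" k] near_P[OF P1, of "(T ^^ k) z1" k] r d'(2) by simp_all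
  have safe0: "E y > d'" if "dist (cyl y) (cyl ((T ^^ k) z0)) < r" for y k
    using near_P[OF P0 that] d'(2) by simp
  have safe1: "E y > d'" if "dist (cyl y) (cyl ((?Ti ^^ k) z1)) < r" for y k
    using near_P[OF P1' that] d'(2) by simp

  \<comment> \<open>The comparison starts in the backward tail, where the perturbation changes
    neither the curve nor its radius of curvature, so the initial beam is common to both.\<close>
  define a where "a = (?Ti ^^ M) x"
  define p where "p = beam a (Diter ?Ti DTi M x v)"
  define l where "l k = step_chord ((T ^^ k) a)" for k
  define \<kappa> where "\<kappa> k = 2 / jac ((T ^^ k) a)" for k
  define B where "B \<phi> = b \<phi> + b2 \<phi>" for \<phi>
  define \<kappa>' where "\<kappa>' e k = 2 / ((\<rho> (fst ((T ^^ k) a)) + e * B (fst ((T ^^ k) a))) * sin (snd ((T ^^ k) a)))" for e k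
  have a: "a \<in> phase" unfolding a_def by (rule iter_phase[OF maps(2) x])
  have ax: "(T ^^ M) a = x" unfolding a_def by (rule iter_inverse[OF maps(2) billiard_inv_inverse(2) x])
  have a_orb: "E ((T ^^ k) a) = 0 \<or> E ((T ^^ k) a) > d'" for k
  proof (cases "k \<le> M")
    case True
    have "(T ^^ k) a = (?Ti ^^ (M - k)) x"
    proof -
      have "a = (?Ti ^^ k) ((?Ti ^^ (M - k)) x)" using True by (simp add: a_def iter_iter)
      then show ?thesis
        using iter_inverse[OF maps(2) billiard_inv_inverse(2) iter_phase[OF maps(2) x]] by simp
    qed
    then show ?thesis using bwd by simp
  next
    case False
    then have "(T ^^ k) a = (T ^^ (k - M)) x"
      using iter_iter[where f = T and m = "k - M" and n = M and x = a] by (simp add: ax)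
    then show ?thesis using fwd by simp
  qed
  have am: "(T ^^ (M + m)) a = (T ^^ m) x"
    using iter_iter[where f = T and m = m and n = M and x = a] by (simp add: ax)
  have Em: "E ((T ^^ m) x) = 0" by (simp add: E_def c_def)
  have mN: "m < N"
  proof (rule ccontr)
    assume "\<not> m < N"
    then show False using safe0[OF N[of m]] Em d'(1) by simp
  qed
  \<comment> \<open>\<open>beam_seq\<close> applies shears on arrival, from index 1 on. Index 0 is
    the point \<open>a\<close> in the unperturbed tail and cannot be the centre impact.\<close>
  have Mm: "M + m \<ge> 1"
  proof (rule ccontr)
    assume "\<not> M + m \<ge> 1"
    then have "M = 0" "m = 0" by auto
    then show False using safe1[OF M[of 0]] Em d'(1) by simp
  qed
  \<comment> \<open>The radius of curvature changes by e times \<open>B\<close>, which is zero off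
    the support and \<open>b2\<close> > 0 at the centre: no impact of the orbit sees a negative
    change.\<close>
  have B_nonneg: "B (fst ((T ^^ k) a)) \<ge> 0" for k
    using a_orb[of k] farE[of "(T ^^ k) a"] centreE[of "(T ^^ k) a"] by (auto simp: B_def)
  have B_pos: "B (fst ((T ^^ (M + m)) a)) > 0"
    using centreE[OF Em] by (simp add: am B_def)
  have sin_pos: "sin (snd ((T ^^ k) a)) > 0" for k
    using iter_phase[OF maps(1) a, of k] by (auto simp: phase_def mem_Times_iff intro: sin_gt_zero)
  have "\<forall>\<^sub>F e in at_right 0. fst (beam_seq l (\<kappa>' e) p (N + M)) * snd (beam_seq l \<kappa> p (N + M)) -
      snd (beam_seq l (\<kappa>' e) p (N + M)) * fst (beam_seq l \<kappa> p (N + M)) > 0"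
  proof (rule beam_seq_transversal[where m = "M + m"])
    show "((\<lambda>e. \<kappa>' e i) \<longlongrightarrow> \<kappa> i) (at_right 0)" for i
    proof -
      have "((\<lambda>e. \<kappa>' e i) \<longlongrightarrow> 2 / ((\<rho> (fst ((T ^^ i) a)) + 0 * B (fst ((T ^^ i) a))) * sin (snd ((T ^^ i) a)))) (at_right 0)"
        unfolding \<kappa>'_def using sin_pos[of i] pos[of "fst ((T ^^ i) a)"] by (intro tendsto_intros) auto
      then show ?thesis by (simp add: \<kappa>_def jac_def)
    qed
    have e0: "\<forall>\<^sub>F e in at_right (0::real). e > 0" by (simp add: eventually_at_right_less)
    show "\<forall>\<^sub>F e in at_right 0. \<forall>i. \<kappa>' e i \<le> \<kappa> i"
      using e0
    proof eventually_elim
      case (elim e)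
      then show ?case
        unfolding \<kappa>'_def \<kappa>_def jac_def using B_nonneg sin_pos pos
        by (intro allI divide_left_mono mult_right_mono mult_pos_pos add_pos_nonneg mult_nonneg_nonneg)
          (auto intro: less_imp_le)
    qed
    show "\<forall>\<^sub>F e in at_right 0. \<kappa>' e (M + m) < \<kappa> (M + m)"
      using e0
    proof eventually_elim
      case (elim e)
      then show ?case
        unfolding \<kappa>'_def \<kappa>_def jac_def using B_pos sin_pos[of "M + m"] pos
        by (intro divide_strict_left_mono mult_strict_right_mono mult_pos_pos add_pos_pos) auto
    qed
    show "1 \<le> M + m" "M + m \<le> N + M" using Mm mN by auto
    have "beam ((T ^^ (M + m)) a) (Diter T DT (M + m) a (Diter ?Ti DTi M x v)) = beam_seq l \<kappa> p (M + m)"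
    proof -
      interpret angle_curve_pair \<Gamma> \<rho> \<Gamma> \<rho> by unfold_locales
      show ?thesis
        unfolding p_def l_def[abs_def] \<kappa>_def[abs_def] by (rule beam_iter(1)[OF a]) auto
    qed
    moreover have "Diter T DT (M + m) a (Diter ?Ti DTi M x v) = Diter T DT m x v"
    proof -
      have "Diter T DT M a (Diter ?Ti DTi M x v) = v"
        unfolding a_def by (rule Diter_inverse[OF maps(2,1) billiard_inv_inverse(2) x])
      then show ?thesis using Diter_add[of T DT m M a] by (simp add: ax add.commute)
    qed
    \<comment> \<open>The first beam coordinate is the width, so the impact found by
      \<open>exists_nonfocused_impact\<close> has nonzero width.\<close>
    ultimately have "fst (beam_seq l \<kappa> p (M + m)) = jac ((T ^^ m) x) * fst (Diter T DT m x v)"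
      by (metis am beam_def fst_conv)
    then show "fst (beam_seq l \<kappa> p (M + m)) \<noteq> 0"
      using m(2) jac_pos[OF iter_phase[OF maps(1) x, of m]] by simp
  qed
  then have "\<forall>\<^sub>F e in at_right (0::real). (fst (beam_seq l (\<kappa>' e) p (N + M)) * snd (beam_seq l \<kappa> p (N + M)) -
      snd (beam_seq l (\<kappa>' e) p (N + M)) * fst (beam_seq l \<kappa> p (N + M)) > 0) \<and>
      bumped \<Gamma> b b1 e \<in> symmetric_ovals n \<and> oval_dist (bumped \<Gamma> b b1 e) \<Gamma> < \<delta> \<and>
      angle_curve (bumped \<Gamma> b b1 e) (\<lambda>\<phi>. \<rho> \<phi> + e * (b \<phi> + b2 \<phi>))"
    by (rule eventually_conj)
      (rule bumped_symmetric_oval[OF assms(2) n ac sb(1,2) db sb(3) pb bb \<delta>])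
  then obtain e where e: "fst (beam_seq l (\<kappa>' e) p (N + M)) * snd (beam_seq l \<kappa> p (N + M)) -
      snd (beam_seq l (\<kappa>' e) p (N + M)) * fst (beam_seq l \<kappa> p (N + M)) > 0"
      "bumped \<Gamma> b b1 e \<in> symmetric_ovals n" "oval_dist (bumped \<Gamma> b b1 e) \<Gamma> < \<delta>"
      "angle_curve (bumped \<Gamma> b b1 e) (\<lambda>\<phi>. \<rho> \<phi> + e * (b \<phi> + b2 \<phi>))"
    using eventually_happens'[OF trivial_limit_at_right_real] by blast
  define \<Delta> where "\<Delta> = bumped \<Gamma> b b1 e"
  interpret C: angle_curve_pair \<Gamma> \<rho> \<Delta> "\<lambda>\<phi>. \<rho> \<phi> + e * (b \<phi> + b2 \<phi>)"
    using e(4) by (simp add: angle_curve_pair_def ac \<Delta>_def)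
  have sameE: "\<Delta> (fst y) = \<Gamma> (fst y)" if "E y = 0 \<or> E y > d'" for y
    using that farE[of y] centreE[of y] by (auto simp: \<Delta>_def bumped_def)
  have sameE': "\<rho> (fst y) + e * (b (fst y) + b2 (fst y)) = \<rho> (fst y)" if "E y > d'" for y
    using farE[OF that] by simp
  have hyp0': "hyperbolic_periodic \<Delta> z0"
    by (rule C.hyperbolic_agree[OF hyp0 sameE sameE']) (use per0 in auto)
  have hyp1': "hyperbolic_periodic \<Delta> z1"
    by (rule C.hyperbolic_agree[OF hyp1 sameE sameE']) (use per1 in auto)
  have "transversal_connecting_point \<Delta> z0 z1 x"
  proof (rule C.transversal_connecting_pointI[OF x q0(1) q1(1) conn v sameE[OF fwd] sameE[OF bwd] N M])
    show "\<Delta> (fst y) = \<Gamma> (fst y) \<and> \<rho> (fst y) + e * (b (fst y) + b2 (fst y)) = \<rho> (fst y)"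
      if "dist (cyl y) (cyl ((T ^^ k) z0)) < r" for y k
      using sameE[of y] sameE'[of y] safe0[OF that] by blast
    show "\<Delta> (fst y) = \<Gamma> (fst y) \<and> \<rho> (fst y) + e * (b (fst y) + b2 (fst y)) = \<rho> (fst y)"
      if "dist (cyl y) (cyl ((?Ti ^^ k) z1)) < r" for y k
      using sameE[of y] sameE'[of y] safe1[OF that] by blast
    fix a' p' l' k1 k2
    assume eqs: "a' = (?Ti ^^ M) x" "p' = beam a' (Diter ?Ti DTi M x v)" "l' = (\<lambda>k. step_chord ((T ^^ k) a'))"
      "k1 = (\<lambda>k. 2 / jac ((T ^^ k) a'))" "k2 = (\<lambda>k. 2 / C.G'.jac ((T ^^ k) a'))"
    have "a' = a" "p' = p" "l' = l" "k1 = \<kappa>" "k2 = \<kappa>' e"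
      unfolding eqs by (simp_all add: a_def p_def l_def[abs_def] \<kappa>_def[abs_def] \<kappa>'_def[abs_def] C.G'.jac_def B_def)
    then show "fst (beam_seq l' k2 p' (N + M)) * snd (beam_seq l' k1 p' (N + M)) -
      snd (beam_seq l' k2 p' (N + M)) * fst (beam_seq l' k1 p' (N + M)) \<noteq> 0"
      using e(1) by simp
  qed
  then show "\<exists>\<Gamma>\<^sub>\<epsilon> \<in> symmetric_ovals n.
           oval_dist \<Gamma>\<^sub>\<epsilon> \<Gamma> < \<delta> \<and>
           hyperbolic_periodic \<Gamma>\<^sub>\<epsilon> (\<phi>\<^sub>0, \<alpha>\<^sub>0) \<and>
           hyperbolic_periodic \<Gamma>\<^sub>\<epsilon> (\<phi>\<^sub>1, \<alpha>\<^sub>1) \<and>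
           transversal_connecting_point \<Gamma>\<^sub>\<epsilon> (\<phi>\<^sub>0, \<alpha>\<^sub>0) (\<phi>\<^sub>1, \<alpha>\<^sub>1) (\<phi>', \<alpha>')"
    using e(2,3) hyp0' hyp1' by (intro bexI[of _ \<Delta>]) (simp_all add: \<Delta>_def z0_def z1_def x_def)
qed

end
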